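(* Let $(W_n)_n$ be a sequence of graphons converging to a graphon $W$ in the cut metric, i.e. $\delta_{\square}(W_n,W)\to0$, and assume there exists $\varepsilon>0$ such that $d_{W_n}>\varepsilon$ almost everywhere for every $n$. Then the spectra of the random walk kernel operators $(\mathcal{K}_{W_n})_n$ converge pointwise to the spectrum of $\mathcal{K}_W$, and the spectra of the random walk Laplacian operators $(\mathcal{L}_{W_n})_n$ converge pointwise to the spectrum of $\mathcal{L}_W$.
   Context: A graphon is a symmetric measurable function $W:[0,1]^2\to[0,1]$; its degree function is $d_W(x)=\int_0^1W(x,y)\,\mathrm{d}y$. The cut norm of a bounded measurable $V:[0,1]^2\to\mathbb{R}$ is $\|V\|_\square=\sup_{f,g}|\int V(x,y)f(x)g(y)\,\mathrm{d}x\,\mathrm{d}y|$ over measurable $f,g:[0,1]\to[0,1]$, and the cut metric is $\delta_\square(U,W)=\inf_\varphi\|U-W^\varphi\|_\square$, the infimum over measure preserving maps $\varphi:[0,1]\to[0,1]$, with $W^\varphi(x,y)=W(\varphi(x),\varphi(y))$. The random walk kernel is $K_W(x,y)=W(x,y)/d_W(x)$ if $d_W(x)>0$ and $0$ otherwise. The random walk kernel operator $\mathcal{K}_W$ on $L^2([0,1])$ is $(\mathcal{K}_Wf)(x)=\int_0^1K_W(x,y)f(y)\,\mathrm{d}y$, and the random walk Laplacian operator is $\mathcal{L}_W f=f-\mathcal{K}_Wf$. (When $d_W>\varepsilon$ a.e., $\mathcal{K}_W$ is compact and self-adjoint with respect to the inner product $\langle f,g\rangle=\int fg\,d_W$, so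 its nonzero spectrum is a countable multiset of real eigenvalues of finite multiplicity accumulating only at $0$.) Pointwise convergence of spectra of $\mathcal{K}_{W_n}$ to that of $\mathcal{K}_W$ means: listing the positive eigenvalues in decreasing order $\lambda_1\ge\lambda_2\ge\dots$ and the negative eigenvalues in increasing order $\lambda'_1\le\lambda'_2\le\dots$ (with multiplicity, padded with zeros if there are finitely many), one has $\lambda_i(\mathcal{K}_{W_n})\to\lambda_i(\mathcal{K}_W)$ and $\lambda'_i(\mathcal{K}_{W_n})\to\lambda'_i(\mathcal{K}_W)$ for every $i$; for $\mathcal{L}_W=I-\mathcal{K}_W$ the analogous statement is made for the eigenvalues $1-\lambda$. *)

theory Defs
  imports "HOL-Analysis.Analysis"
begin

section \<open>Graphons and the cut metric\<close>

text \<open>Measurability is Lebesgue measurability throughout; functions on the unit interval or the unit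
  square are total functions whose values elsewhere are never used.\<close>

abbreviation unit_interval :: "real measure" where
  "unit_interval \<equiv> lebesgue_on {0..1}"

abbreviation unit_square :: "(real \<times> real) measure" where
  "unit_square \<equiv> lebesgue_on ({0..1} \<times> {0..1})"

definition graphon :: "(real \<Rightarrow> real \<Rightarrow> real) \<Rightarrow> bool" where
  "graphon W \<longleftrightarrow>
     (\<lambda>z. W (fst z) (snd z)) \<in> borel_measurable unit_square \<and>
     (\<forall>x\<in>{0..1}. \<forall>y\<in>{0..1}. W x y \<in> {0..1} \<and> W x y = W y x)"

definition degree_fun :: "(real \<Rightarrow> real \<Rightarrow> real) \<Rightarrow> real \<Rightarrow> real" where
  "degree_fun W x = (\<integral>y. W x y \<partial>unit_interval)"

definition unit_valued :: "(real \<Rightarrow> real) set" where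
  "unit_valued = {f. f \<in> borel_measurable unit_interval \<and> (\<forall>x\<in>{0..1}. f x \<in> {0..1})}"

definition cut_norm :: "(real \<Rightarrow> real \<Rightarrow> real) \<Rightarrow> real" where
  "cut_norm V =
     (SUP (f, g)\<in>unit_valued \<times> unit_valued.
        \<bar>\<integral>z. V (fst z) (snd z) * f (fst z) * g (snd z) \<partial>unit_square\<bar>)"

definition measure_preserving_maps :: "(real \<Rightarrow> real) set" where
  "measure_preserving_maps =
     {\<phi>. \<phi> \<in> measurable unit_interval unit_interval \<and>
         distr unit_interval unit_interval \<phi> = unit_interval}"

definition cut_dist :: "(real \<Rightarrow> real \<Rightarrow> real) \<Rightarrow> (real \<Rightarrow> real \<Rightarrow> real) \<Rightarrow> real" where
  "cut_dist U W =
     (INF \<phi>\<in>measure_preserving_maps. cut_norm (\<lambda>x y. U x y - W (\<phi> x) (\<phi> y)))"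


section \<open>Random walk operators\<close>

text \<open>An operator on \<open>L\<^sup>2([0,1])\<close> is represented by its action on square integrable functions.
  Identification of functions that agree almost everywhere is built into the notions of
  eigenfunction and multiplicity below.\<close>

definition rw_kernel :: "(real \<Rightarrow> real \<Rightarrow> real) \<Rightarrow> real \<Rightarrow> real \<Rightarrow> real" where
  "rw_kernel W x y = (if degree_fun W x > 0 then W x y / degree_fun W x else 0)"

definition rw_kernel_op :: "(real \<Rightarrow> real \<Rightarrow> real) \<Rightarrow> (real \<Rightarrow> real) \<Rightarrow> real \<Rightarrow> real" where
  "rw_kernel_op W f x = (\<integral>y. rw_kernel W x y * f y \<partial>unit_interval)"

definition rw_laplacian_op :: "(real \<Rightarrow> real \<Rightarrow> real) \<Rightarrow> (real \<Rightarrow> real) \<Rightarrow> real \<Rightarrow> real" where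
  "rw_laplacian_op W f x = f x - rw_kernel_op W f x"


section \<open>Eigenvalues with multiplicity\<close>

definition square_integrable :: "(real \<Rightarrow> real) set" where
  "square_integrable =
     {f. f \<in> borel_measurable unit_interval \<and> integrable unit_interval (\<lambda>x. (f x)\<^sup>2)}"

definition eigenfunctions :: "((real \<Rightarrow> real) \<Rightarrow> real \<Rightarrow> real) \<Rightarrow> real \<Rightarrow> (real \<Rightarrow> real) set" where
  "eigenfunctions T \<mu> = {f \<in> square_integrable. AE x in unit_interval. T f x = \<mu> * f x}"

text \<open>The eigenspace of \<open>\<mu>\<close> in \<open>L\<^sup>2([0,1])\<close> has finite dimension \<open>m\<close>, witnessed by a basis
  modulo null functions; \<open>m = 0\<close> means that \<open>\<mu>\<close> is not an eigenvalue.\<close>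

definition has_multiplicity ::
    "((real \<Rightarrow> real) \<Rightarrow> real \<Rightarrow> real) \<Rightarrow> real \<Rightarrow> nat \<Rightarrow> bool" where
  "has_multiplicity T \<mu> m \<longleftrightarrow>
     (\<exists>b :: nat \<Rightarrow> real \<Rightarrow> real.
        (\<forall>i<m. b i \<in> eigenfunctions T \<mu>) \<and>
        (\<forall>a :: nat \<Rightarrow> real.
           (AE x in unit_interval. (\<Sum>i<m. a i * b i x) = 0) \<longrightarrow> (\<forall>i<m. a i = 0)) \<and>
        (\<forall>f\<in>eigenfunctions T \<mu>. \<exists>a :: nat \<Rightarrow> real.
           AE x in unit_interval. f x = (\<Sum>i<m. a i * b i x)))"

text \<open>\<open>l 0 \<ge> l 1 \<ge> \<dots>\<close> are the eigenvalues of \<open>T\<close> above \<open>c\<close>, each repeated according to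
  its multiplicity, padded with \<open>c\<close> if there are finitely many of them. Every eigenvalue above \<open>c\<close>
  must have finite multiplicity and occur at a finite position. Since \<open>l\<close> is monotone and
  the number of occurrences of each \<open>\<mu> > c\<close> is prescribed, there is at most one such \<open>l\<close>.\<close>

definition eigenvalues_above ::
    "real \<Rightarrow> ((real \<Rightarrow> real) \<Rightarrow> real \<Rightarrow> real) \<Rightarrow> (nat \<Rightarrow> real) \<Rightarrow> bool" where
  "eigenvalues_above c T l \<longleftrightarrow>
     decseq l \<and> (\<forall>i. c \<le> l i) \<and>
     (\<forall>\<mu>>c. finite {i. l i = \<mu>} \<and> has_multiplicity T \<mu> (card {i. l i = \<mu>}))"

definition eigenvalues_below ::
    "real \<Rightarrow> ((real \<Rightarrow> real) \<Rightarrow> real \<Rightarrow> real) \<Rightarrow> (nat \<Rightarrow> real) \<Rightarrow> bool" where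
  "eigenvalues_below c T l \<longleftrightarrow>
     incseq l \<and> (\<forall>i. l i \<le> c) \<and>
     (\<forall>\<mu><c. finite {i. l i = \<mu>} \<and> has_multiplicity T \<mu> (card {i. l i = \<mu>}))"

text \<open>Pointwise convergence of spectra that can accumulate only at \<open>c\<close>: \<open>c = 0\<close> for the compact
  random walk kernel operator and \<open>c = 1\<close> for the Laplacian. Existence of the enumerations is part
  of the assertion.\<close>

definition spectra_converge_pointwise ::
    "real \<Rightarrow> (nat \<Rightarrow> (real \<Rightarrow> real) \<Rightarrow> real \<Rightarrow> real) \<Rightarrow> ((real \<Rightarrow> real) \<Rightarrow> real \<Rightarrow> real) \<Rightarrow> bool"
where
  "spectra_converge_pointwise c Tn T \<longleftrightarrow>
     (\<exists>ls l. (\<forall>n. eigenvalues_above c (Tn n) (ls n)) \<and> eigenvalues_above c T l \<and>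
             (\<forall>i. (\<lambda>n. ls n i) \<longlonglongrightarrow> l i)) \<and>
     (\<exists>ls l. (\<forall>n. eigenvalues_below c (Tn n) (ls n)) \<and> eigenvalues_below c T l \<and>
             (\<forall>i. (\<lambda>n. ls n i) \<longlonglongrightarrow> l i))"

end

(* The random walk kernel of a graphon U is conjugate, by multiplication with a = d_U^(-1/2), to the
   symmetric bounded kernel a(x) U(x,y) a(y), so its eigenvalues are those of a compact self-adjoint
   operator on L^2, and by Weyl's inequality they move by at most the operator norm of a
   perturbation. The operator norm is controlled by the cut norm c: for a symmetric kernel D with
   |D| <= 1 the square D o D has L^2 norm at most (4c)^(1/2), hence D has operator norm at most
   (4c)^(1/4), and the degrees differ by at most 2c in L^1. Convergence in the cut metric compares
   W_n with pullbacks of W along measure preserving maps; a pullback has the same nonzero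
   eigenvalues with the same multiplicities. Negative eigenvalues are obtained from the negated
   kernel, and testing the cut norm on the set where d_W < epsilon shows that d_W >= epsilon a.e. *)
theory Submission
  imports Defs
begin

section \<open>Compact self-adjoint operators\<close>

text \<open>The cut norm does not control the Hilbert-Schmidt norm of a kernel, which is the bound
  for operator norms that is at hand. Squaring removes this obstacle: the squared L^2 norm of D o D
  is an average over x of expressions in which D is tested against two bounded functions, and
  splitting each of these into positive and negative part costs the factor 4. The degree weights
  raise no such difficulty, because they are bounded and close in L^1, hence close in L^2.

  Measurability shapes the rest. A graphon is Lebesgue measurable on the square, so only almost all
  of its sections are sure to be measurable, whereas Fubini arguments want the product of two
  one-dimensional Lebesgue spaces. Each graphon is therefore replaced by an almost everywhere equal
  kernel that is measurable for the product, and symmetric and bounded at every point.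

  The maps in the cut metric depend on n and need not be invertible. No limit of them is taken: the
  enumeration belonging to W is one fixed target for all n.\<close>

lemma homogeneous_system_nontrivial:
  fixes c :: "nat \<Rightarrow> nat \<Rightarrow> real"
  assumes "m < n"
  shows "\<exists>a. (\<exists>j<n. a j \<noteq> 0) \<and> (\<forall>k<m. (\<Sum>j<n. c k j * a j) = 0)"
  using assms
proof (induction m arbitrary: n c)
  case 0
  then show ?case by (intro exI[of _ "\<lambda>_. 1"]) auto
next
  case (Suc m)
  show ?case
  proof (cases "\<forall>j<n. c m j = 0")
    case True
    obtain a where "\<exists>j<n. a j \<noteq> 0" "\<forall>k<m. (\<Sum>j<n. c k j * a j) = 0"
      using Suc.IH[of n c] Suc.prems by auto
    with True show ?thesis
      by (intro exI[of _ a]) (auto simp: less_Suc_eq)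
  next
    case False
    then obtain p where p: "p < n" "c m p \<noteq> 0" by blast
    \<comment> \<open>The unknowns other than the pivot \<open>p\<close>, renumbered without a
      gap.\<close>
    define s where "s j = (if j < p then j else Suc j)" for j
    have bij: "bij_betw s {..<n - 1} ({..<n} - {p})"
      by (rule bij_betw_byWitness[where f' = "\<lambda>j. if j < p then j else j - 1"])
         (use p in \<open>auto simp: s_def\<close>)
    \<comment> \<open>Gaussian elimination: from row \<open>k\<close> the multiple of row
      \<open>m\<close> is subtracted that clears column \<open>p\<close>, which leaves
      \<open>m\<close> equations in \<open>n - 1\<close> unknowns.\<close>
    define d where "d k j = c k (s j) - c k p * c m (s j) / c m p" for k j
    obtain b where b: "\<exists>j<n - 1. b j \<noteq> 0" "\<forall>k<m. (\<Sum>j<n - 1. d k j * b j) = 0"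
    proof -
      have "m < n - 1" using Suc.prems by simp
      from Suc.IH[OF this] show ?thesis using that by blast
    qed
    define r where "r = the_inv_into {..<n - 1} s"
    have rs: "r (s j) = j" if "j < n - 1" for j
      unfolding r_def using bij that by (simp add: bij_betw_def the_inv_into_f_f)
    define B where "B = (\<Sum>j<n - 1. c m (s j) * b j)"
    \<comment> \<open>Equation \<open>m\<close> determines the pivot unknown once the other unknowns
      are taken from \<open>b\<close>.\<close>
    define a where "a j = (if j = p then - B / c m p else b (r j))" for j
    have sp: "s j \<noteq> p" for j by (auto simp: s_def)
    have sum_a: "(\<Sum>j<n. c k j * a j) = c k p * (- B / c m p) + (\<Sum>j<n - 1. c k (s j) * b j)" for k
    proof -
      have "(\<Sum>j<n. c k j * a j) = c k p * a p + (\<Sum>j\<in>{..<n} - {p}. c k j * a j)"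
        using p by (subst sum.remove[of _ p]) auto
      also have "(\<Sum>j\<in>{..<n} - {p}. c k j * a j) = (\<Sum>j<n - 1. c k (s j) * a (s j))"
        by (rule sum.reindex_bij_betw[OF bij, symmetric])
      also have "\<dots> = (\<Sum>j<n - 1. c k (s j) * b j)"
        by (intro sum.cong) (auto simp: a_def sp rs)
      finally show ?thesis by (simp add: a_def)
    qed
    have "(\<Sum>j<n. c k j * a j) = 0" if "k < Suc m" for k
    proof (cases "k = m")
      case True
      then show ?thesis using p by (simp add: sum_a B_def)
    next
      case False
      then have "0 = (\<Sum>j<n - 1. d k j * b j)" using b(2) that by auto
      also have "\<dots> = (\<Sum>j<n - 1. c k (s j) * b j) - c k p / c m p * B"
        by (simp add: d_def B_def sum_distrib_left sum_subtractf algebra_simps)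
      finally show ?thesis by (simp add: sum_a)
    qed
    moreover from b(1) obtain j where j: "j < n - 1" "b j \<noteq> 0" by blast
    then have "a (s j) \<noteq> 0" by (simp add: a_def sp rs)
    moreover have "s j < n" using bij j by (auto simp: bij_betw_def)
    ultimately show ?thesis by (intro exI[of _ a] conjI exI[of _ "s j"]) auto
  qed
qed

text \<open>Only the nonnegative part of the spectrum is recorded. The last clause is the upper half
  of the Courant-Fischer principle and takes the place of a full spectral decomposition. Sequences
  are infinite: where \<open>l i = 0\<close>, the vector \<open>e i\<close> is padding in the kernel
  of \<open>T\<close> and may be zero, so unit length is asked only for positive
  \<open>l i\<close>.\<close>

definition spectral_sequence :: "('a::real_inner \<Rightarrow> 'a) \<Rightarrow> (nat \<Rightarrow> real) \<Rightarrow> (nat \<Rightarrow> 'a) \<Rightarrow> bool" where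
  "spectral_sequence T l e \<longleftrightarrow>
     decseq l \<and> (\<forall>i. 0 \<le> l i) \<and> l \<longlonglongrightarrow> 0 \<and>
     (\<forall>i. T (e i) = l i *\<^sub>R e i) \<and>
     (\<forall>i j. i \<noteq> j \<longrightarrow> inner (e i) (e j) = 0) \<and>
     (\<forall>i. l i > 0 \<longrightarrow> norm (e i) = 1) \<and>
     (\<forall>i x. (\<forall>j<i. inner x (e j) = 0) \<longrightarrow> inner (T x) x \<le> l i * (norm x)\<^sup>2)"

lemma finite_spectral_sequence_level:
  assumes S: "spectral_sequence T l e" and "\<mu> > 0"
  shows "finite {i. l i = \<mu>}"
proof -
  have "eventually (\<lambda>n. l n < \<mu>) sequentially"
    using S \<open>\<mu> > 0\<close> by (intro order_tendstoD(2)) (auto simp: spectral_sequence_def)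
  then obtain N where N: "\<And>n. n \<ge> N \<Longrightarrow> l n < \<mu>"
    unfolding eventually_sequentially by blast
  have "{i. l i = \<mu>} \<subseteq> {..<N}"
  proof
    fix i assume "i \<in> {i. l i = \<mu>}"
    then have "\<not> N \<le> i" using N[of i] by auto
    then show "i \<in> {..<N}" by simp
  qed
  then show ?thesis by (rule finite_subset) simp
qed

section \<open>Variational construction of eigenvectors\<close>

locale compact_selfadjoint =
  fixes T :: "'a::real_inner \<Rightarrow> 'a"
  assumes bounded_linear: "bounded_linear T"
    and selfadjoint: "inner (T x) y = inner x (T y)"
    and compact_op: "(\<And>n::nat. norm (X n) \<le> 1) \<Longrightarrow>
                       \<exists>r. strict_mono r \<and> convergent (\<lambda>n. T (X (r n)))"
begin

sublocale bounded_linear T by (rule bounded_linear)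

text \<open>The supremum runs over the unit ball, not the unit sphere: the vector 0 always competes,
  so the value is nonnegative and makes sense even if the orthogonal complement of \<open>E\<close>
  is trivial.\<close>

definition top_value :: "'a set \<Rightarrow> real" where
  "top_value E = (SUP x\<in>{x. norm x \<le> 1 \<and> (\<forall>y\<in>E. inner x y = 0)}. inner (T x) x)"

lemma bdd_above_top_value: "bdd_above ((\<lambda>x. inner (T x) x) ` {x. norm x \<le> 1 \<and> (\<forall>y\<in>E. inner x y = 0)})"
proof -
  obtain K where K: "0 \<le> K" "\<And>x. norm (T x) \<le> norm x * K" using nonneg_bounded by blast
  show ?thesis
  proof (rule bdd_aboveI2)
    fix x assume "x \<in> {x. norm x \<le> 1 \<and> (\<forall>y\<in>E. inner x y = 0)}"
    then have x: "norm x \<le> 1" by simp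
    have "inner (T x) x \<le> norm (T x) * norm x" by (rule norm_cauchy_schwarz)
    also have "\<dots> \<le> (norm x * K) * norm x" by (intro mult_right_mono K) auto
    also have "\<dots> \<le> (1 * K) * 1" using x K by (intro mult_mono) auto
    finally show "inner (T x) x \<le> K" by simp
  qed
qed

lemma top_value_nonneg: "0 \<le> top_value E"
  unfolding top_value_def by (rule cSUP_upper2[OF bdd_above_top_value, of 0]) (auto simp: zero)

lemma top_value_upper:
  assumes "\<And>y. y \<in> E \<Longrightarrow> inner x y = 0"
  shows "inner (T x) x \<le> top_value E * (norm x)\<^sup>2"
proof (cases "x = 0")
  case False
  define u where "u = x /\<^sub>R norm x"
  have "inner (T u) u \<le> top_value E"
    unfolding top_value_def by (rule cSUP_upper[OF _ bdd_above_top_value]) (use assms False in \<open>auto simp: u_def\<close>)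
  also have "inner (T u) u = inner (T x) x / (norm x)\<^sup>2"
    by (simp add: u_def scaleR power2_eq_square divide_inverse mult_ac)
  finally show ?thesis using False by (simp add: field_simps)
qed (simp add: zero)

lemma top_value_antimono: "E \<subseteq> F \<Longrightarrow> top_value F \<le> top_value E"
  unfolding top_value_def
  by (rule cSUP_subset_mono[OF _ bdd_above_top_value]) (auto intro!: exI[of _ 0])

text \<open>The form \<open>s\<parallel>x\<parallel>\<^sup>2 - \<langle>T x, x\<rangle>\<close> is nonnegative on the orthogonal complement of \<open>E\<close>; testing it
  at \<open>x - t (s x - T x)\<close> bounds the defect \<open>\<parallel>s x - T x\<parallel>\<close>, so maximizing sequences consist of
  approximate eigenvectors.\<close>

lemma eigenvector_top_value:
  assumes E: "\<And>y. y \<in> E \<Longrightarrow> \<exists>c. T y = c *\<^sub>R y" and pos: "top_value E > 0"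
  shows "\<exists>x. norm x = 1 \<and> (\<forall>y\<in>E. inner x y = 0) \<and> T x = top_value E *\<^sub>R x"
proof -
  define s where "s = top_value E"
  define M where "M = {x. \<forall>y\<in>E. inner x y = 0}"
  obtain K where K: "0 < K" "\<And>x. norm (T x) \<le> norm x * K" using pos_bounded by blast
  have s: "s > 0" using pos by (simp add: s_def)
  \<comment> \<open>\<open>C\<close> bounds the norm of s - T. With the step length 1/C the
    second-order term is at most \<open>inner y y / C\<close>, half of the first-order gain
    \<open>2 / C * inner y y\<close>.\<close>
  define C where "C = s + K"
  have C: "C > 0" using s K by (simp add: C_def)
  have TM: "T x \<in> M" if "x \<in> M" for x
    using that E by (fastforce simp: M_def selfadjoint)
  have defect: "(norm (s *\<^sub>R x - T x))\<^sup>2 \<le> C * (s * (norm x)\<^sup>2 - inner (T x) x)" if x: "x \<in> M" for x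
  proof -
    define y where "y = s *\<^sub>R x - T x"
    have yM: "y \<in> M" using x TM[OF x] by (simp add: y_def M_def inner_diff_left)
    define v where "v = x - (1 / C) *\<^sub>R y"
    have vM: "v \<in> M" using x yM by (simp add: v_def M_def inner_diff_left)
    have "inner (T v) v \<le> s * (norm v)\<^sup>2"
      using top_value_upper[of E v] vM by (simp add: s_def M_def)
    then have 1: "0 \<le> inner (s *\<^sub>R v - T v) v"
      by (simp add: inner_diff_left power2_norm_eq_inner)
    define w where "w = s *\<^sub>R y - T y"
    have wv: "s *\<^sub>R v - T v = y - (1 / C) *\<^sub>R w"
      by (simp add: v_def y_def w_def diff scaleR add scaleR_diff_right algebra_simps)
    have wx: "inner w x = inner y y"
    proof -
      have "inner w x = inner y (s *\<^sub>R x) - inner y (T x)"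
        by (simp add: w_def inner_diff_left selfadjoint)
      also have "\<dots> = inner y y" unfolding y_def by (simp add: inner_diff_right)
      finally show ?thesis .
    qed
    have "inner (s *\<^sub>R v - T v) v = inner y x - 2 / C * inner y y + (1 / C)\<^sup>2 * inner w y"
      unfolding wv unfolding v_def
      by (simp add: inner_diff_left inner_diff_right wx power2_eq_square diff_divide_distrib)
    moreover have "inner w y \<le> C * inner y y"
    proof -
      have "- inner (T y) y \<le> norm (T y) * norm y"
        using Cauchy_Schwarz_ineq2[of "T y" y] by linarith
      also have "\<dots> \<le> (norm y * K) * norm y" by (intro mult_right_mono K) auto
      also have "\<dots> = K * inner y y" by (simp add: power2_norm_eq_inner[symmetric] power2_eq_square)
      finally show ?thesis by (simp add: w_def C_def inner_diff_left algebra_simps)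
    qed
    then have "(1 / C)\<^sup>2 * inner w y \<le> (1 / C)\<^sup>2 * (C * inner y y)"
      by (intro mult_left_mono) auto
    moreover have "(1 / C)\<^sup>2 * (C * inner y y) = inner y y / C"
      using C by (simp add: power2_eq_square)
    ultimately have "0 \<le> inner y x - 2 / C * inner y y + inner y y / C" using 1 by linarith
    then have "inner y y \<le> C * inner y x" using C by (simp add: field_simps)
    then show ?thesis by (simp add: y_def inner_diff_left power2_norm_eq_inner)
  qed
  have "\<exists>x. norm x \<le> 1 \<and> x \<in> M \<and> s - 1 / real (Suc n) < inner (T x) x" for n
  proof -
    have "s - 1 / real (Suc n) < (SUP x\<in>{x. norm x \<le> 1 \<and> (\<forall>y\<in>E. inner x y = 0)}. inner (T x) x)"
      unfolding top_value_def[symmetric] s_def by simp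
    moreover have "{x. norm x \<le> 1 \<and> (\<forall>y\<in>E. inner x y = 0)} \<noteq> {}" by (auto intro!: exI[of _ 0])
    ultimately show ?thesis
      by (subst (asm) less_cSUP_iff[OF _ bdd_above_top_value]) (auto simp: M_def)
  qed
  then obtain X where X: "\<And>n. norm (X n) \<le> 1" "\<And>n. X n \<in> M"
      "\<And>n. s - 1 / real (Suc n) < inner (T (X n)) (X n)"
    by metis
  obtain r z where r: "strict_mono r" and z: "(\<lambda>n. T (X (r n))) \<longlonglongrightarrow> z"
    using compact_op[of X] X(1) by (auto simp: convergent_def)
  have Y0: "(\<lambda>n. s *\<^sub>R X n - T (X n)) \<longlonglongrightarrow> 0"
  proof (rule tendsto_norm_zero_cancel)
    have *: "(\<lambda>n. sqrt (C * (1 / real (Suc n)))) \<longlonglongrightarrow> sqrt (C * 0)"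
      by (intro tendsto_intros LIMSEQ_Suc[OF lim_1_over_n])
    show "(\<lambda>n. norm (s *\<^sub>R X n - T (X n))) \<longlonglongrightarrow> 0"
    proof (rule tendsto_sandwich[OF _ _ tendsto_const, where h = "\<lambda>n. sqrt (C * (1 / real (Suc n)))"])
      show "(\<lambda>n. sqrt (C * (1 / real (Suc n)))) \<longlonglongrightarrow> 0" using * by simp
      have "norm (s *\<^sub>R X n - T (X n)) \<le> sqrt (C * (1 / real (Suc n)))" for n
      proof (rule real_le_rsqrt)
        have "s * (norm (X n))\<^sup>2 \<le> s * 1"
          using X(1)[of n] s by (intro mult_left_mono power_le_one) auto
        then have "s * (norm (X n))\<^sup>2 - inner (T (X n)) (X n) \<le> 1 / real (Suc n)"
          using X(3)[of n] by linarith
        then have "C * (s * (norm (X n))\<^sup>2 - inner (T (X n)) (X n)) \<le> C * (1 / real (Suc n))"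
          using C by (intro mult_left_mono) auto
        with defect[OF X(2)[of n]]
        show "(norm (s *\<^sub>R X n - T (X n)))\<^sup>2 \<le> C * (1 / real (Suc n))" by linarith
      qed
      then show "\<forall>\<^sub>F n in sequentially. norm (s *\<^sub>R X n - T (X n)) \<le> sqrt (C * (1 / real (Suc n)))" by simp
    qed auto
  qed
  \<comment> \<open>Along \<open>r\<close> both s X - T X and T X converge, the former to 0, so X
    itself converges to z / s; this needs s > 0.\<close>
  define x where "x = (1 / s) *\<^sub>R z"
  have "(\<lambda>n. (1 / s) *\<^sub>R ((s *\<^sub>R X (r n) - T (X (r n))) + T (X (r n)))) \<longlonglongrightarrow> (1 / s) *\<^sub>R (0 + z)"
    by (intro tendsto_intros z LIMSEQ_subseq_LIMSEQ[OF Y0 r, unfolded o_def])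
  then have Xx: "(\<lambda>n. X (r n)) \<longlonglongrightarrow> x" using s by (simp add: x_def)
  have "(\<lambda>n. T (X (r n))) \<longlonglongrightarrow> T x" by (rule tendsto[OF Xx])
  then have "T x = z" using z LIMSEQ_unique by blast
  then have Tx: "T x = s *\<^sub>R x" using s by (simp add: x_def)
  have xM: "inner x y = 0" if "y \<in> E" for y
  proof -
    have "(\<lambda>n. inner (X (r n)) y) \<longlonglongrightarrow> inner x y" by (intro tendsto_intros Xx)
    moreover have "(\<lambda>n. inner (X (r n)) y) = (\<lambda>n. 0)" using X(2) that by (auto simp: M_def)
    ultimately show ?thesis using LIMSEQ_unique[OF _ tendsto_const] by metis
  qed
  have n1: "norm x \<le> 1"
    by (rule LIMSEQ_le_const2[OF tendsto_norm[OF Xx]]) (use X in auto)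
  have "(\<lambda>n. inner (T (X (r n))) (X (r n))) \<longlonglongrightarrow> inner (T x) x"
    by (intro tendsto_intros Xx tendsto)
  moreover have "(\<lambda>n. s - 1 / real (Suc (r n))) \<longlonglongrightarrow> s - 0"
    by (intro tendsto_intros LIMSEQ_subseq_LIMSEQ[OF LIMSEQ_Suc[OF lim_1_over_n] r, unfolded o_def])
  ultimately have "s - 0 \<le> inner (T x) x"
    by (rule_tac LIMSEQ_le) (use X(3) less_imp_le in auto)
  then have "s * 1 \<le> s * (norm x)\<^sup>2" by (simp add: Tx power2_norm_eq_inner)
  then have "1 \<le> (norm x)\<^sup>2" using s by simp
  then have "1 \<le> norm x" using power2_le_imp_le[of 1 "norm x"] by simp
  then have "norm x = 1" using n1 by simp
  then show ?thesis using xM Tx s_def by blast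
qed

text \<open>Once the top value is 0 the choice is the zero vector. It satisfies the eigenvalue
  equation and the orthogonality relations trivially, so the greedy construction never
  stops.\<close>

definition pick :: "'a set \<Rightarrow> 'a" where
  "pick E = (if top_value E > 0
     then SOME x. norm x = 1 \<and> (\<forall>y\<in>E. inner x y = 0) \<and> T x = top_value E *\<^sub>R x else 0)"

text \<open>Each choice depends on all earlier ones; carrying the whole list makes the recursion
  primitive.\<close>

primrec picks :: "nat \<Rightarrow> 'a list" where
  "picks 0 = []"
| "picks (Suc n) = picks n @ [pick (set (picks n))]"

lemma picks_eq: "picks n = map (\<lambda>i. pick (set (picks i))) [0..<n]"
  by (induction n) auto

lemma set_picks: "set (picks n) = (\<lambda>i. pick (set (picks i))) ` {..<n}"
  by (subst picks_eq) auto

lemma pick_eigenvector: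
  assumes "\<And>y. y \<in> E \<Longrightarrow> \<exists>c. T y = c *\<^sub>R y"
  shows "(top_value E > 0 \<longrightarrow> norm (pick E) = 1) \<and> (\<forall>y\<in>E. inner (pick E) y = 0) \<and>
         T (pick E) = top_value E *\<^sub>R pick E"
proof (cases "top_value E > 0")
  case True
  then show ?thesis
    using someI_ex[OF eigenvector_top_value[OF assms True]] by (simp add: pick_def)
qed (simp add: pick_def zero)

lemma picks_eigenvectors: "y \<in> set (picks n) \<Longrightarrow> \<exists>c. T y = c *\<^sub>R y"
proof (induction n arbitrary: y)
  case (Suc n)
  then show ?case using pick_eigenvector[of "set (picks n)"] by auto
qed simp

text \<open>Greedy maximization of the form on successive orthogonal complements. The values
  decrease because the constraints accumulate, and the form bound in the last clause is what the
  supremum expresses.\<close>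

theorem ex_spectral_sequence: "\<exists>l e. spectral_sequence T l e"
proof -
  define e where "e n = pick (set (picks n))" for n
  define l where "l n = top_value (set (picks n))" for n
  have set_e: "set (picks n) = e ` {..<n}" for n
    unfolding e_def by (rule set_picks)
  have e: "(l n > 0 \<longrightarrow> norm (e n) = 1) \<and> (\<forall>i<n. inner (e n) (e i) = 0) \<and> T (e n) = l n *\<^sub>R e n" for n
  proof -
    have "\<exists>c. T y = c *\<^sub>R y" if "y \<in> e ` {..<n}" for y
      using picks_eigenvectors[of y n] that by (simp add: set_e)
    from pick_eigenvector[OF this] show ?thesis
      unfolding l_def e_def[of n] set_e by auto
  qed
  have orth: "inner (e i) (e j) = 0" if "i \<noteq> j" for i j
    using that e[of i] e[of j] by (metis inner_commute linorder_neqE_nat)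
  have dec: "decseq l"
    unfolding decseq_def l_def set_e by (auto intro!: top_value_antimono)
  have nonneg: "0 \<le> l i" for i by (simp add: l_def top_value_nonneg)
  obtain L where L: "l \<longlonglongrightarrow> L" "\<And>i. L \<le> l i"
    using decseq_convergent[OF dec, of 0] nonneg by blast
  have "L \<ge> 0" by (rule LIMSEQ_le_const[OF L(1)]) (use nonneg in auto)
  \<comment> \<open>A positive limit would yield infinitely many orthonormal eigenvectors whose
    images are, by Pythagoras, pairwise at distance at least \<open>L\<close>, against
    compactness.\<close>
  moreover have "\<not> L > 0"
  proof
    assume "L > 0"
    then have pos: "l i > 0" for i using L(2)[of i] by linarith
    then have n1: "norm (e i) = 1" for i using e by blast
    then obtain r where r: "strict_mono r" "convergent (\<lambda>n. T (e (r n)))"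
      using compact_op[of e] by auto
    then obtain N where N: "\<And>m n. m \<ge> N \<Longrightarrow> n \<ge> N \<Longrightarrow> norm (T (e (r m)) - T (e (r n))) < L"
      using convergent_Cauchy[OF r(2)] \<open>L > 0\<close> unfolding Cauchy_iff by blast
    have neq: "r (Suc N) \<noteq> r N" using strict_monoD[OF r(1), of N "Suc N"] by simp
    have "(norm (l (r (Suc N)) *\<^sub>R e (r (Suc N)) - l (r N) *\<^sub>R e (r N)))\<^sup>2 = (l (r (Suc N)))\<^sup>2 + (l (r N))\<^sup>2"
      using orth[OF neq] orth[OF neq[symmetric]] n1[unfolded norm_eq_1]
      unfolding power2_norm_eq_inner
      by (simp add: inner_diff_left inner_diff_right power2_eq_square)
    moreover have "norm (l (r (Suc N)) *\<^sub>R e (r (Suc N)) - l (r N) *\<^sub>R e (r N)) < L"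
      using N[of "Suc N" N] e by simp
    then have "(norm (l (r (Suc N)) *\<^sub>R e (r (Suc N)) - l (r N) *\<^sub>R e (r N)))\<^sup>2 < L\<^sup>2"
      by (intro power_strict_mono) auto
    moreover have "L\<^sup>2 \<le> (l (r N))\<^sup>2" using L(2) \<open>L > 0\<close> by (intro power_mono) auto
    moreover have "0 \<le> (l (r (Suc N)))\<^sup>2" by simp
    ultimately show False by linarith
  qed
  ultimately have "l \<longlonglongrightarrow> 0" using L by simp
  moreover have "inner (T x) x \<le> l i * (norm x)\<^sup>2" if "\<forall>j<i. inner x (e j) = 0" for i x
    unfolding l_def by (rule top_value_upper) (use that in \<open>auto simp: set_e\<close>)
  ultimately show ?thesis
    unfolding spectral_sequence_def using dec nonneg e orth by blast
qed

text \<open>The residual \<open>w\<close> of the expansion is orthogonal to every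
  \<open>e j\<close>: by construction if \<open>l j = \<mu>\<close>, by self-adjointness otherwise.
  The form bound then applies to \<open>w\<close> at every index i, and since \<open>l i\<close>
  tends to 0 it leaves no room for a nonzero eigenvector of positive eigenvalue.\<close>

lemma eigenvector_expansion:
  assumes S: "spectral_sequence T l e" and "\<mu> > 0" and v: "T v = \<mu> *\<^sub>R v"
  shows "v = (\<Sum>i | l i = \<mu>. inner v (e i) *\<^sub>R e i)"
proof -
  have l0: "l \<longlonglongrightarrow> 0" and Te: "\<And>i. T (e i) = l i *\<^sub>R e i"
    and orth: "\<And>i j. i \<noteq> j \<Longrightarrow> inner (e i) (e j) = 0"
    and n1: "\<And>i. l i > 0 \<Longrightarrow> norm (e i) = 1"
    and ub: "\<And>i x. (\<forall>j<i. inner x (e j) = 0) \<Longrightarrow> inner (T x) x \<le> l i * (norm x)\<^sup>2"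
    using S by (auto simp: spectral_sequence_def)
  define w where "w = v - (\<Sum>i | l i = \<mu>. inner v (e i) *\<^sub>R e i)"
  have Tw: "T w = \<mu> *\<^sub>R w"
  proof -
    have "T w = \<mu> *\<^sub>R v - (\<Sum>i | l i = \<mu>. inner v (e i) *\<^sub>R (l i *\<^sub>R e i))"
      unfolding w_def diff sum scaleR Te v ..
    also have "(\<Sum>i | l i = \<mu>. inner v (e i) *\<^sub>R (l i *\<^sub>R e i)) = (\<Sum>i | l i = \<mu>. \<mu> *\<^sub>R (inner v (e i) *\<^sub>R e i))"
      by (rule sum.cong) (auto simp: mult.commute)
    finally show ?thesis by (simp add: w_def scaleR_diff_right scaleR_sum_right)
  qed
  have fin: "finite {i. l i = \<mu>}" by (rule finite_spectral_sequence_level[OF S \<open>\<mu> > 0\<close>])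
  have wj: "inner w (e j) = 0" for j
  proof (cases "l j = \<mu>")
    case True
    then have "inner (e j) (e j) = 1" using n1[of j] \<open>\<mu> > 0\<close> by (simp add: norm_eq_sqrt_inner)
    have "(\<Sum>i | l i = \<mu>. inner v (e i) * inner (e i) (e j)) = (\<Sum>i | l i = \<mu>. if i = j then inner v (e j) else 0)"
      using \<open>inner (e j) (e j) = 1\<close> by (intro sum.cong refl) (simp add: orth)
    also have "\<dots> = inner v (e j)" using True fin by (subst sum.delta) auto
    finally show ?thesis by (simp add: w_def inner_diff_left inner_sum_left)
  next
    case False
    have "\<mu> * inner w (e j) = l j * inner w (e j)"
      using selfadjoint[of w "e j"] by (simp add: Tw Te)
    then show ?thesis using False by simp
  qed
  have "\<mu> * (norm w)\<^sup>2 \<le> l i * (norm w)\<^sup>2" for i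
    using ub[of i w] wj by (simp add: Tw power2_norm_eq_inner)
  then have "\<mu> * (norm w)\<^sup>2 \<le> 0 * (norm w)\<^sup>2"
    using LIMSEQ_le_const[OF tendsto_mult[OF l0 tendsto_const]] by blast
  then have "w = 0" using \<open>\<mu> > 0\<close> by (simp add: mult_le_0_iff)
  then show ?thesis by (simp add: w_def)
qed

end

text \<open>Weyl's inequality: some unit vector in the span of \<open>e' 0, \<dots>, e' i\<close> is orthogonal to
  \<open>e 0, \<dots>, e (i - 1)\<close>.\<close>

lemma spectral_sequence_perturbation:
  assumes S: "spectral_sequence T l e" and S': "spectral_sequence T' l' e'"
    and T': "linear T'"
    and close: "\<And>x. inner (T' x) x \<le> inner (T x) x + \<delta> * (norm x)\<^sup>2" and "\<delta> \<ge> 0"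
  shows "l' i \<le> l i + \<delta>"
\<comment> \<open>Positivity of \<open>l' i\<close> makes \<open>e' 0\<close>, ...,
  \<open>e' i\<close> unit vectors, since \<open>l'\<close> decreases. Otherwise some of them may be
  zero padding, but then the claim is immediate from \<open>0 \<le> l i\<close>.\<close>
proof (cases "l' i > 0")
  case False
  moreover have "0 \<le> l i" using S by (simp add: spectral_sequence_def)
  ultimately show ?thesis using \<open>\<delta> \<ge> 0\<close> by linarith
next
  case True
  obtain a where a: "\<exists>j<Suc i. a j \<noteq> 0" "\<And>k. k < i \<Longrightarrow> (\<Sum>j<Suc i. inner (e' j) (e k) * a j) = 0"
    using homogeneous_system_nontrivial[of i "Suc i" "\<lambda>k j. inner (e' j) (e k)"] by auto
  define x where "x = (\<Sum>j<Suc i. a j *\<^sub>R e' j)"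
  have xe: "\<forall>k<i. inner x (e k) = 0"
    using a(2) by (simp add: x_def inner_sum_left inner_add_left mult.commute)
  have l': "l' i \<le> l' j" if "j < Suc i" for j
    using S' that by (auto simp: spectral_sequence_def decseq_def)
  have orth: "inner (e' j) (e' k) = (if j = k then 1 else 0)" if "j < Suc i" for j k
  proof (cases "j = k")
    case True
    have "norm (e' j) = 1" using S' l'[OF that] \<open>l' i > 0\<close> by (auto simp: spectral_sequence_def)
    then show ?thesis using True by (simp add: norm_eq_sqrt_inner)
  next
    case False
    then show ?thesis using S' by (auto simp: spectral_sequence_def)
  qed
  have expand: "inner (\<Sum>j<Suc i. b j *\<^sub>R e' j) x = (\<Sum>j<Suc i. b j * a j)" for b
  proof -
    have "inner (e' j) x = a j" if "j < Suc i" for j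
    proof -
      have "inner (e' j) x = (\<Sum>k<Suc i. if k = j then a j else 0)"
        unfolding x_def inner_sum_right by (intro sum.cong) (auto simp: orth[OF that])
      then show ?thesis using that by simp
    qed
    then show ?thesis by (simp only: inner_sum_left inner_scaleR_left) (auto intro!: sum.cong)
  qed
  have nx: "(norm x)\<^sup>2 = (\<Sum>j<Suc i. a j * a j)"
    using expand[of a] by (simp only: power2_norm_eq_inner x_def[symmetric])
  have "T' (e' j) = l' j *\<^sub>R e' j" for j using S' by (simp add: spectral_sequence_def)
  then have "T' x = (\<Sum>j<Suc i. (l' j * a j) *\<^sub>R e' j)"
    unfolding x_def linear_sum[OF T'] linear_scale[OF T'] by (simp add: mult.commute)
  then have "inner (T' x) x = (\<Sum>j<Suc i. (l' j * a j) * a j)"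
    using expand[of "\<lambda>j. l' j * a j"] by simp
  \<comment> \<open>On the span of \<open>e' 0\<close>, ..., \<open>e' i\<close> the form of
    \<open>T'\<close> is at least \<open>l' i\<close> times the squared norm, because
    \<open>l'\<close> decreases.\<close>
  also have "\<dots> \<ge> (\<Sum>j<Suc i. l' i * (a j * a j))"
    by (intro sum_mono) (use l' in \<open>auto simp: mult.assoc intro!: mult_right_mono\<close>)
  finally have "l' i * (norm x)\<^sup>2 \<le> inner (T' x) x" by (simp only: nx sum_distrib_left)
  also have "\<dots> \<le> l i * (norm x)\<^sup>2 + \<delta> * (norm x)\<^sup>2"
  proof -
    have "inner (T x) x \<le> l i * (norm x)\<^sup>2" using S xe by (simp add: spectral_sequence_def)
    then show ?thesis using close[of x] by linarith
  qed
  finally have *: "l' i * (norm x)\<^sup>2 \<le> (l i + \<delta>) * (norm x)\<^sup>2" by (simp add: algebra_simps)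
  obtain j where "j < Suc i" "a j \<noteq> 0" using a(1) by blast
  then have "0 < (norm x)\<^sup>2" unfolding nx by (intro sum_pos2[of _ j]) (auto simp: less_le)
  with * show ?thesis by simp
qed

section \<open>The Hilbert space of square integrable functions\<close>

lemma finite_measure_unit_interval: "finite_measure unit_interval"
  by (rule finite_measure_lebesgue_on) simp

interpretation unit_interval: finite_measure unit_interval
  by (rule finite_measure_unit_interval)

lemma emeasure_unit_interval: "emeasure unit_interval (space unit_interval) = 1"
  by (simp add: emeasure_restrict_space)

lemma measure_unit_interval [simp]: "measure unit_interval {0..1} = 1"
  using emeasure_unit_interval by (simp add: measure_def)

lemma square_integrableD:
  assumes "f \<in> square_integrable"
  shows "f \<in> borel_measurable unit_interval" "integrable unit_interval (\<lambda>x. (f x)\<^sup>2)"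
  using assms by (auto simp: square_integrable_def)

lemma integrable_mult_square_integrable:
  assumes f: "f \<in> square_integrable" and g: "g \<in> square_integrable"
  shows "integrable unit_interval (\<lambda>x. f x * g x)"
proof (rule Bochner_Integration.integrable_bound)
  show "integrable unit_interval (\<lambda>x. (f x)\<^sup>2 + (g x)\<^sup>2)"
    using square_integrableD[OF f] square_integrableD[OF g] by auto
  show "(\<lambda>x. f x * g x) \<in> borel_measurable unit_interval"
    using square_integrableD(1)[OF f] square_integrableD(1)[OF g] by measurable
  have "\<bar>f x * g x\<bar> \<le> (f x)\<^sup>2 + (g x)\<^sup>2" for x
  proof -
    have "2 * (\<bar>f x\<bar> * \<bar>g x\<bar>) \<le> (f x)\<^sup>2 + (g x)\<^sup>2"
      using sum_squares_bound[of "\<bar>f x\<bar>" "\<bar>g x\<bar>"] by simp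
    moreover have "0 \<le> \<bar>f x\<bar> * \<bar>g x\<bar>" by simp
    ultimately show ?thesis unfolding abs_mult by linarith
  qed
  then show "AE x in unit_interval. norm (f x * g x) \<le> norm ((f x)\<^sup>2 + (g x)\<^sup>2)" by simp
qed

lemma square_integrable_scale:
  assumes "f \<in> square_integrable"
  shows "(\<lambda>x. c * f x) \<in> square_integrable"
  using assms by (auto simp: square_integrable_def power_mult_distrib)

lemma square_integrable_add:
  assumes f: "f \<in> square_integrable" and g: "g \<in> square_integrable"
  shows "(\<lambda>x. f x + g x) \<in> square_integrable"
proof -
  have "integrable unit_interval (\<lambda>x. (f x)\<^sup>2 + (g x)\<^sup>2 + 2 * (f x * g x))"
    using square_integrableD[OF f] square_integrableD[OF g] integrable_mult_square_integrable[OF f g]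
    by auto
  then show ?thesis
    using square_integrableD[OF f] square_integrableD[OF g]
    by (auto simp: square_integrable_def power2_sum mult.assoc)
qed

lemma square_integrable_diff:
  assumes "f \<in> square_integrable" "g \<in> square_integrable"
  shows "(\<lambda>x. f x - g x) \<in> square_integrable"
  using square_integrable_add[OF assms(1) square_integrable_scale[OF assms(2), of "-1"]] by simp

lemma square_integrable_const: "(\<lambda>x. c) \<in> square_integrable"
  by (auto simp: square_integrable_def)

lemma square_integrable_sum:
  "(\<And>i. i \<in> I \<Longrightarrow> f i \<in> square_integrable) \<Longrightarrow> (\<lambda>x. \<Sum>i\<in>I. c i * f i x) \<in> square_integrable"
  by (induction I rule: infinite_finite_induct)
     (auto simp: square_integrable_const intro!: square_integrable_add square_integrable_scale)

\<comment> \<open>A partial quotient: the relation is reflexive exactly on the square integrable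
  functions, so one construction both restricts to them and identifies functions that agree almost
  everywhere. The result is a type that can be made an instance of \<open>real_inner\<close>, as the
  abstract operator theory requires.\<close>
quotient_type l2 = "real \<Rightarrow> real" / partial:
  "\<lambda>f g. f \<in> square_integrable \<and> g \<in> square_integrable \<and> (AE x in unit_interval. f x = g x)"
proof (rule part_equivpI)
  show "\<exists>f. f \<in> square_integrable \<and> f \<in> square_integrable \<and> (AE x in unit_interval. f x = f x)"
    using square_integrable_const by auto
  show "symp (\<lambda>f g. f \<in> square_integrable \<and> g \<in> square_integrable \<and> (AE x in unit_interval. f x = g x))"
    by (auto intro!: sympI elim: AE_mp)
  show "transp (\<lambda>f g. f \<in> square_integrable \<and> g \<in> square_integrable \<and> (AE x in unit_interval. f x = g x))"
  proof (rule transpI)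
    fix f g h :: "real \<Rightarrow> real"
    assume 1: "f \<in> square_integrable \<and> g \<in> square_integrable \<and> (AE x in unit_interval. f x = g x)"
      and 2: "g \<in> square_integrable \<and> h \<in> square_integrable \<and> (AE x in unit_interval. g x = h x)"
    from 1 2 have "AE x in unit_interval. f x = g x" "AE x in unit_interval. g x = h x" by auto
    then have "AE x in unit_interval. f x = h x" by eventually_elim simp
    with 1 2 show "f \<in> square_integrable \<and> h \<in> square_integrable \<and> (AE x in unit_interval. f x = h x)"
      by simp
  qed
qed

lemma rep_l2_square_integrable: "rep_l2 x \<in> square_integrable"
  using Quotient3_rep_reflp[OF Quotient3_l2, of x] by simp

lemma abs_rep_l2 [simp]: "abs_l2 (rep_l2 x) = x"
  by (rule Quotient3_abs_rep[OF Quotient3_l2])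

lemma abs_l2_eq_iff:
  assumes "f \<in> square_integrable" "g \<in> square_integrable"
  shows "abs_l2 f = abs_l2 g \<longleftrightarrow> (AE x in unit_interval. f x = g x)"
  using Quotient3_rel[OF Quotient3_l2, of f g] assms by auto

lemma rep_abs_l2:
  assumes "f \<in> square_integrable"
  shows "AE x in unit_interval. rep_l2 (abs_l2 f) x = f x"
  using abs_l2_eq_iff[OF rep_l2_square_integrable[of "abs_l2 f"] assms] by simp

instantiation l2 :: real_vector
begin

lift_definition zero_l2 :: l2 is "\<lambda>x. 0" by (simp add: square_integrable_const)

lift_definition plus_l2 :: "l2 \<Rightarrow> l2 \<Rightarrow> l2" is "\<lambda>f g x. f x + g x"
  by (auto intro!: square_integrable_add)

lift_definition minus_l2 :: "l2 \<Rightarrow> l2 \<Rightarrow> l2" is "\<lambda>f g x. f x - g x"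
  by (auto intro!: square_integrable_diff)

lift_definition scaleR_l2 :: "real \<Rightarrow> l2 \<Rightarrow> l2" is "\<lambda>c f x. c * f x"
  by (auto intro!: square_integrable_scale)

definition uminus_l2 :: "l2 \<Rightarrow> l2" where "uminus_l2 x = (-1) *\<^sub>R x"

instance
proof
  fix x y z :: l2 and a b :: real
  show "x + y + z = x + (y + z)"
    by transfer (auto simp: add.assoc intro!: square_integrable_add)
  show "x + y = y + x"
    by transfer (auto simp: add.commute intro!: square_integrable_add)
  show "0 + x = x" by transfer auto
  show "- x + x = 0" unfolding uminus_l2_def
    by transfer (auto intro!: square_integrable_add square_integrable_scale[of _ "-1", simplified] square_integrable_const)
  show "x - y = x + - y" unfolding uminus_l2_def
    by transfer (auto intro!: square_integrable_diff)
  show "a *\<^sub>R (x + y) = a *\<^sub>R x + a *\<^sub>R y"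
    by transfer (auto simp: algebra_simps intro!: square_integrable_add square_integrable_scale)
  show "(a + b) *\<^sub>R x = a *\<^sub>R x + b *\<^sub>R x"
    by transfer (auto simp: algebra_simps intro!: square_integrable_add square_integrable_scale)
  show "a *\<^sub>R b *\<^sub>R x = (a * b) *\<^sub>R x"
    by transfer (auto simp: algebra_simps intro!: square_integrable_scale)
  show "1 *\<^sub>R x = x" by transfer auto
qed

end

instantiation l2 :: real_inner
begin

lift_definition inner_l2 :: "l2 \<Rightarrow> l2 \<Rightarrow> real" is "\<lambda>f g. \<integral>x. f x * g x \<partial>unit_interval"
proof -
  fix f f' g g' :: "real \<Rightarrow> real"
  assume *: "f \<in> square_integrable \<and> f' \<in> square_integrable \<and> (AE x in unit_interval. f x = f' x)"
    "g \<in> square_integrable \<and> g' \<in> square_integrable \<and> (AE x in unit_interval. g x = g' x)"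
  then have "AE x in unit_interval. f x = f' x" "AE x in unit_interval. g x = g' x" by auto
  then have "AE x in unit_interval. f x * g x = f' x * g' x" by eventually_elim simp
  then show "(\<integral>x. f x * g x \<partial>unit_interval) = (\<integral>x. f' x * g' x \<partial>unit_interval)"
    using * by (intro integral_cong_AE borel_measurable_times) (auto dest: square_integrableD)
qed

definition norm_l2 :: "l2 \<Rightarrow> real" where "norm_l2 x = sqrt (inner x x)"
definition dist_l2 :: "l2 \<Rightarrow> l2 \<Rightarrow> real" where "dist_l2 x y = norm (x - y)"
definition sgn_l2 :: "l2 \<Rightarrow> l2" where "sgn_l2 x = x /\<^sub>R norm x"
definition uniformity_l2 :: "(l2 \<times> l2) filter" where
  "uniformity_l2 = (INF e\<in>{0<..}. principal {(x, y). dist x y < e})"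
definition open_l2 :: "l2 set \<Rightarrow> bool" where
  "open_l2 U = (\<forall>x\<in>U. eventually (\<lambda>(x', y). x' = x \<longrightarrow> y \<in> U) uniformity)"

instance
proof
  fix x y z :: l2 and a :: real
  show "sgn x = inverse (norm x) *\<^sub>R x" by (simp add: sgn_l2_def)
  show "dist x y = norm (x - y)" by (simp add: dist_l2_def)
  show "(uniformity :: (l2 \<times> l2) filter) = (INF e\<in>{0<..}. principal {(x, y). dist x y < e})"
    by (rule uniformity_l2_def)
  show "open U = (\<forall>x\<in>U. eventually (\<lambda>(x', y). x' = x \<longrightarrow> y \<in> U) uniformity)" for U :: "l2 set"
    by (rule open_l2_def)
  show "inner x y = inner y x" by transfer (simp add: mult.commute)
  show "inner (x + y) z = inner x z + inner y z"
  proof (transfer, clarify)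
    fix f g h assume "f \<in> square_integrable" "g \<in> square_integrable" "h \<in> square_integrable"
    then show "(\<integral>x. (f x + g x) * h x \<partial>unit_interval) =
        (\<integral>x. f x * h x \<partial>unit_interval) + (\<integral>x. g x * h x \<partial>unit_interval)"
      unfolding distrib_right
      by (intro Bochner_Integration.integral_add integrable_mult_square_integrable)
  qed
  show "inner (a *\<^sub>R x) y = a * inner x y" by transfer (simp add: mult.assoc)
  show "0 \<le> inner x x" by transfer (auto intro!: integral_nonneg_AE)
  show "inner x x = 0 \<longleftrightarrow> x = 0"
  proof (transfer, clarify)
    fix f assume f: "f \<in> square_integrable"
    have "(\<integral>x. f x * f x \<partial>unit_interval) = 0 \<longleftrightarrow> (AE x in unit_interval. f x * f x = 0)"
      by (rule integral_nonneg_eq_0_iff_AE[OF integrable_mult_square_integrable[OF f f]]) simp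
    then show "((\<integral>x. f x * f x \<partial>unit_interval) = 0) =
        (f \<in> square_integrable \<and> (\<lambda>x. 0) \<in> square_integrable \<and> (AE x in unit_interval. f x = 0))"
      using f by (simp add: square_integrable_const)
  qed
  show "norm x = sqrt (inner x x)" by (simp add: norm_l2_def)
qed

end

section \<open>Computing with representatives, and completeness\<close>

lemma inner_abs_l2:
  "f \<in> square_integrable \<Longrightarrow> g \<in> square_integrable \<Longrightarrow>
   inner (abs_l2 f) (abs_l2 g) = (\<integral>x. f x * g x \<partial>unit_interval)"
  by (rule inner_l2.abs_eq) auto

lemma norm_abs_l2:
  "f \<in> square_integrable \<Longrightarrow> (norm (abs_l2 f))\<^sup>2 = (\<integral>x. (f x)\<^sup>2 \<partial>unit_interval)"
  unfolding power2_norm_eq_inner by (simp add: inner_abs_l2 power2_eq_square)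

lemma norm_rep_l2: "(norm x)\<^sup>2 = (\<integral>t. (rep_l2 x t)\<^sup>2 \<partial>unit_interval)"
  using norm_abs_l2[OF rep_l2_square_integrable[of x]] by simp

lemma plus_abs_l2:
  "f \<in> square_integrable \<Longrightarrow> g \<in> square_integrable \<Longrightarrow> abs_l2 f + abs_l2 g = abs_l2 (\<lambda>x. f x + g x)"
  by (rule plus_l2.abs_eq) auto

lemma minus_abs_l2:
  "f \<in> square_integrable \<Longrightarrow> g \<in> square_integrable \<Longrightarrow> abs_l2 f - abs_l2 g = abs_l2 (\<lambda>x. f x - g x)"
  by (rule minus_l2.abs_eq) auto

lemma scaleR_abs_l2: "f \<in> square_integrable \<Longrightarrow> c *\<^sub>R abs_l2 f = abs_l2 (\<lambda>x. c * f x)"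
  by (rule scaleR_l2.abs_eq) auto

lemma zero_l2_eq: "0 = abs_l2 (\<lambda>x. 0)"
  by (simp add: zero_l2_def)

lemma sum_abs_l2:
  "finite I \<Longrightarrow> (\<And>i. i \<in> I \<Longrightarrow> f i \<in> square_integrable) \<Longrightarrow>
   (\<Sum>i\<in>I. c i *\<^sub>R abs_l2 (f i)) = abs_l2 (\<lambda>x. \<Sum>i\<in>I. c i * f i x)"
  by (induction I rule: finite_induct)
     (auto simp: zero_l2_eq scaleR_abs_l2 plus_abs_l2 square_integrable_scale square_integrable_sum)

lemma Cauchy_Schwarz_integral:
  assumes f: "f \<in> square_integrable" and g: "g \<in> square_integrable"
  shows "(\<integral>x. f x * g x \<partial>unit_interval)\<^sup>2 \<le>
         (\<integral>x. (f x)\<^sup>2 \<partial>unit_interval) * (\<integral>x. (g x)\<^sup>2 \<partial>unit_interval)"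
  using Cauchy_Schwarz_ineq[of "abs_l2 f" "abs_l2 g"] f g
  by (simp add: inner_abs_l2 power2_eq_square)

lemma integral_abs_le_L2:
  assumes f: "f \<in> square_integrable"
  shows "(\<integral>x. \<bar>f x\<bar> \<partial>unit_interval)\<^sup>2 \<le> (\<integral>x. (f x)\<^sup>2 \<partial>unit_interval)"
proof -
  have "(\<lambda>x. \<bar>f x\<bar>) \<in> square_integrable" using f by (auto simp: square_integrable_def)
  from Cauchy_Schwarz_integral[OF this square_integrable_const[of 1]] show ?thesis by simp
qed

lemma integrable_square_integrable:
  assumes "f \<in> square_integrable" shows "integrable unit_interval f"
  using integrable_mult_square_integrable[OF assms square_integrable_const[of 1]] by simp

text \<open>Riesz--Fischer: a rapidly convergent subsequence converges almost everywhere, and Fatou's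
  lemma identifies its limit as the limit in the mean.\<close>

instance l2 :: complete_space
proof
  fix X :: "nat \<Rightarrow> l2"
  assume X: "Cauchy X"
  have "\<exists>N. \<forall>m\<ge>N. \<forall>n\<ge>N. norm (X m - X n) < (1/2) ^ k" for k
    using X unfolding Cauchy_iff by simp
  then obtain N where N: "\<And>k m n. N k \<le> m \<Longrightarrow> N k \<le> n \<Longrightarrow> norm (X m - X n) < (1/2) ^ k"
    by metis
  \<comment> \<open>The sum pushes \<open>r k\<close> past \<open>N k\<close>, and the summand
    \<open>k\<close> makes \<open>r\<close> strictly increasing.\<close>
  define r where "r k = k + (\<Sum>i\<le>k. N i)" for k
  have r: "strict_mono r" unfolding strict_mono_Suc_iff by (simp add: r_def)
  have rN: "N k \<le> r k" "N k \<le> r (Suc k)" for k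
  proof -
    have "N k \<le> (\<Sum>i\<le>k. N i)" by (rule member_le_sum) auto
    then show "N k \<le> r k" "N k \<le> r (Suc k)" by (auto simp: r_def)
  qed
  define g where "g k = rep_l2 (X (r k))" for k
  have g: "g k \<in> square_integrable" for k by (simp add: g_def rep_l2_square_integrable)
  have gm[measurable]: "g k \<in> borel_measurable unit_interval" for k by (rule square_integrableD(1)[OF g])
  have Xg: "X (r k) = abs_l2 (g k)" for k by (simp add: g_def)
  have dist_g: "(norm (X (r k) - X (r m)))\<^sup>2 = (\<integral>x. (g k x - g m x)\<^sup>2 \<partial>unit_interval)" for k m
    by (simp add: Xg minus_abs_l2 g norm_abs_l2 square_integrable_diff)
  \<comment> \<open>The interval has measure 1, so the L^1 norm is at most the L^2 norm.\<close>
  have L1: "(\<integral>x. \<bar>g (Suc k) x - g k x\<bar> \<partial>unit_interval) \<le> (1/2) ^ k" for k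
  proof (rule power2_le_imp_le)
    have "(\<integral>x. \<bar>g (Suc k) x - g k x\<bar> \<partial>unit_interval)\<^sup>2 \<le> (norm (X (r (Suc k)) - X (r k)))\<^sup>2"
      unfolding dist_g by (rule integral_abs_le_L2) (intro square_integrable_diff g)
    also have "\<dots> \<le> ((1/2) ^ k)\<^sup>2"
      using N[OF rN(2) rN(1), of k] by (intro power_mono) auto
    finally show "(\<integral>x. \<bar>g (Suc k) x - g k x\<bar> \<partial>unit_interval)\<^sup>2 \<le> ((1/2) ^ k)\<^sup>2" .
  qed simp
  have int: "integrable unit_interval (\<lambda>x. \<bar>g (Suc k) x - g k x\<bar>)" for k
    by (intro integrable_abs integrable_square_integrable square_integrable_diff g)
  have "(\<integral>\<^sup>+x. (\<Sum>k. ennreal \<bar>g (Suc k) x - g k x\<bar>) \<partial>unit_interval)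
      = (\<Sum>k. \<integral>\<^sup>+x. ennreal \<bar>g (Suc k) x - g k x\<bar> \<partial>unit_interval)"
    by (rule nn_integral_suminf) measurable
  also have "\<dots> = (\<Sum>k. ennreal (\<integral>x. \<bar>g (Suc k) x - g k x\<bar> \<partial>unit_interval))"
    by (subst nn_integral_eq_integral[OF int]) auto
  also have "\<dots> \<le> (\<Sum>k. ennreal ((1/2) ^ k))"
    by (intro suminf_le ennreal_leI L1) auto
  also have "\<dots> = ennreal (\<Sum>k. (1/2) ^ k)"
    by (intro suminf_ennreal2 summable_geometric) auto
  also have "\<dots> < \<infinity>" by simp
  \<comment> \<open>The increments have summable L^1 norms, so they are absolutely summable at
    almost every point.\<close>
  finally have "AE x in unit_interval. (\<Sum>k. ennreal \<bar>g (Suc k) x - g k x\<bar>) \<noteq> \<infinity>"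
    by (intro nn_integral_PInf_AE) auto
  then have conv: "AE x in unit_interval. (\<lambda>n. g n x) \<longlonglongrightarrow> lim (\<lambda>n. g n x)"
  proof eventually_elim
    case (elim x)
    have "summable (\<lambda>k. \<bar>g (Suc k) x - g k x\<bar>)"
      by (rule summable_suminf_not_top) (use elim in auto)
    then have "summable (\<lambda>k. g (Suc k) x - g k x)" by (rule summable_rabs_cancel)
    then have "convergent (\<lambda>n. \<Sum>k<n. g (Suc k) x - g k x)" by (rule summable_iff_convergent[THEN iffD1])
    then have "convergent (\<lambda>n. g n x - g 0 x)"       using sum_lessThan_telescope[of "\<lambda>n. g n x"] by simp
    then have "convergent (\<lambda>n. g n x)"
    proof -
      from \<open>convergent (\<lambda>n. g n x - g 0 x)\<close> obtain c where "(\<lambda>n. g n x - g 0 x) \<longlonglongrightarrow> c" by (auto simp: convergent_def)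
      from tendsto_add[OF this tendsto_const[of "g 0 x"]] show ?thesis by (auto simp: convergent_def)
    qed
    then show ?case by (simp add: convergent_LIMSEQ_iff)
  qed
  define f where "f x = lim (\<lambda>n. g n x)" for x
  have fm[measurable]: "f \<in> borel_measurable unit_interval"
    unfolding f_def by (rule borel_measurable_lim_metric) simp
  have close: "(\<integral>\<^sup>+x. ennreal ((g n x - f x)\<^sup>2) \<partial>unit_interval) \<le> ennreal (((1/2) ^ n)\<^sup>2)" for n
  proof -
    have "(\<integral>\<^sup>+x. ennreal ((g n x - f x)\<^sup>2) \<partial>unit_interval)
        = (\<integral>\<^sup>+x. liminf (\<lambda>m. ennreal ((g n x - g m x)\<^sup>2)) \<partial>unit_interval)"
    proof (rule nn_integral_cong_AE, use conv in eventually_elim)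
      case (elim x)
      then have "(\<lambda>m. ennreal ((g n x - g m x)\<^sup>2)) \<longlonglongrightarrow> ennreal ((g n x - f x)\<^sup>2)"
        unfolding f_def by (intro tendsto_ennrealI tendsto_intros)
      from lim_imp_Liminf[OF sequentially_bot this] show ?case by simp
    qed
    also have "\<dots> \<le> liminf (\<lambda>m. \<integral>\<^sup>+x. ennreal ((g n x - g m x)\<^sup>2) \<partial>unit_interval)"
      by (rule nn_integral_liminf) measurable
    also have "\<dots> \<le> ennreal (((1/2) ^ n)\<^sup>2)"
    proof (rule Liminf_le)
      have "(\<integral>\<^sup>+x. ennreal ((g n x - g m x)\<^sup>2) \<partial>unit_interval) \<le> ennreal (((1/2) ^ n)\<^sup>2)" if "m \<ge> n" for m
      proof -
        have "(\<integral>\<^sup>+x. ennreal ((g n x - g m x)\<^sup>2) \<partial>unit_interval)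
            = ennreal (\<integral>x. (g n x - g m x)\<^sup>2 \<partial>unit_interval)"
          using square_integrableD(2)[OF square_integrable_diff[OF g g]] by (intro nn_integral_eq_integral) auto
        also have "\<dots> = ennreal ((norm (X (r n) - X (r m)))\<^sup>2)" by (simp add: dist_g)
        also have "\<dots> \<le> ennreal (((1/2) ^ n)\<^sup>2)"
        proof -
          have "N n \<le> r m"
            using rN(1)[of n] strict_mono_mono[OF r] that by (meson monoD order_trans)
          then show ?thesis
            using N[OF rN(1), of n "r m"] by (intro ennreal_leI power_mono) auto
        qed
        finally show ?thesis .
      qed
      then show "\<forall>\<^sub>F m in sequentially. (\<integral>\<^sup>+x. ennreal ((g n x - g m x)\<^sup>2) \<partial>unit_interval) \<le> ennreal (((1/2) ^ n)\<^sup>2)"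
        unfolding eventually_sequentially by blast
    qed simp
    finally show ?thesis .
  qed
  have diff_sq: "(\<lambda>x. g n x - f x) \<in> square_integrable" for n
  proof -
    have "integrable unit_interval (\<lambda>x. (g n x - f x)\<^sup>2)"
      by (rule integrableI_nonneg) (use order_le_less_trans[OF close[of n] ennreal_less_top] in auto)
    then show ?thesis by (simp add: square_integrable_def)
  qed
  have f: "f \<in> square_integrable"
    using square_integrable_diff[OF g[of 0] diff_sq[of 0]] by simp
  have "norm (X (r n) - abs_l2 f) \<le> (1/2) ^ n" for n
  proof (rule power2_le_imp_le)
    have "(norm (X (r n) - abs_l2 f))\<^sup>2 = (\<integral>x. (g n x - f x)\<^sup>2 \<partial>unit_interval)"
      by (simp add: Xg minus_abs_l2 g f norm_abs_l2 diff_sq)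
    also have "ennreal \<dots> \<le> ennreal (((1/2) ^ n)\<^sup>2)"
      using close[of n] square_integrableD(2)[OF diff_sq[of n]]
      by (subst nn_integral_eq_integral[symmetric]) auto
    finally show "(norm (X (r n) - abs_l2 f))\<^sup>2 \<le> ((1/2) ^ n)\<^sup>2" by (simp add: ennreal_le_iff)
  qed simp
  then have "(\<lambda>n. X (r n) - abs_l2 f) \<longlonglongrightarrow> 0"
    by (intro Lim_null_comparison[OF _ LIMSEQ_power_zero[of "1/2 :: real"]]) auto
  then have "(X \<circ> r) \<longlonglongrightarrow> abs_l2 f" by (subst LIM_zero_iff[symmetric]) (simp add: o_def)
  then show "convergent X"
    using Cauchy_converges_subseq[OF X r] by (auto simp: convergent_def)
qed

section \<open>The unit square as a product measure space\<close>

text \<open>Fubini's theorem speaks of the product measure, while graphons and the cut norm are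
  given by Lebesgue measure on the square, whose sigma-algebra properly contains that of the
  product. Null sets and integrals have to be carried from one to the other.\<close>

abbreviation unit_pair :: "(real \<times> real) measure" where
  "unit_pair \<equiv> unit_interval \<Otimes>\<^sub>M unit_interval"

interpretation unit_pair: pair_sigma_finite unit_interval unit_interval ..

lemma finite_measure_unit_pair: "finite_measure unit_pair"
  by (intro finite_measure_pair_measure finite_measure_unit_interval)

interpretation unit_pair': finite_measure unit_pair
  by (rule finite_measure_unit_pair)

lemma null_sets_lborel_Times:
  fixes N :: "real set"
  assumes "N \<in> null_sets lborel"
  shows "N \<times> UNIV \<in> null_sets (lborel :: (real \<times> real) measure)"
    "UNIV \<times> N \<in> null_sets (lborel :: (real \<times> real) measure)"
proof -
  have N: "N \<in> sets lborel" "emeasure lborel N = 0" using assms by auto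
  have [simp]: "N \<in> sets borel" using N by simp
  have "emeasure (lborel \<Otimes>\<^sub>M lborel) (N \<times> (UNIV :: real set)) = emeasure lborel N * emeasure lborel (UNIV :: real set)"
    by (rule lborel.emeasure_pair_measure_Times) auto
  moreover have "emeasure (lborel \<Otimes>\<^sub>M lborel) ((UNIV :: real set) \<times> N) = emeasure lborel (UNIV :: real set) * emeasure lborel N"
    by (rule lborel.emeasure_pair_measure_Times) auto
  moreover have "N \<times> UNIV \<in> sets (lborel \<Otimes>\<^sub>M lborel :: (real \<times> real) measure)"
    "UNIV \<times> N \<in> sets (lborel \<Otimes>\<^sub>M lborel :: (real \<times> real) measure)"
    by (intro pair_measureI; simp)+
  ultimately show "N \<times> UNIV \<in> null_sets (lborel :: (real \<times> real) measure)"
    "UNIV \<times> N \<in> null_sets (lborel :: (real \<times> real) measure)"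
    using N unfolding lborel_prod by auto
qed

text \<open>Measurability into a completed sigma-algebra asks in addition that null sets have null
  preimages; here the preimages are strips over null sets.\<close>

lemma measurable_fst_snd_lebesgue:
  "fst \<in> measurable (lebesgue :: (real \<times> real) measure) (lebesgue :: real measure)"
  "snd \<in> measurable (lebesgue :: (real \<times> real) measure) (lebesgue :: real measure)"
proof -
  have m: "fst \<in> measurable (lebesgue :: (real \<times> real) measure) (lborel :: real measure)"
    "snd \<in> measurable (lebesgue :: (real \<times> real) measure) (lborel :: real measure)"
    by (auto intro!: measurable_completion borel_measurable_continuous_onI continuous_intros)
  have v: "(fst :: real \<times> real \<Rightarrow> real) -` N = N \<times> UNIV" "(snd :: real \<times> real \<Rightarrow> real) -` N = UNIV \<times> N" for N
    by auto
  have "N \<in> null_sets (distr lebesgue lborel (fst :: real \<times> real \<Rightarrow> real)) \<and>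
      N \<in> null_sets (distr lebesgue lborel (snd :: real \<times> real \<Rightarrow> real))"
    if N: "N \<in> null_sets lborel" for N
    using null_sets_lborel_Times[OF N, THEN null_sets_completionI] N
      null_setsD2[OF N]
    by (simp add: null_sets_distr_iff[OF m(1)] null_sets_distr_iff[OF m(2)] v)
  then have "null_sets (lborel :: real measure) \<subseteq> null_sets (distr lebesgue lborel (fst :: real \<times> real \<Rightarrow> real))"
    "null_sets (lborel :: real measure) \<subseteq> null_sets (distr lebesgue lborel (snd :: real \<times> real \<Rightarrow> real))"
    by blast+
  with m show "fst \<in> measurable (lebesgue :: (real \<times> real) measure) (lebesgue :: real measure)"
    "snd \<in> measurable (lebesgue :: (real \<times> real) measure) (lebesgue :: real measure)"
    by (auto intro!: completion.measurable_completion2)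
qed

lemma measurable_id_unit_square: "(\<lambda>z. z) \<in> measurable unit_square unit_pair"
proof -
  have "fst \<in> measurable unit_square unit_interval" "snd \<in> measurable unit_square unit_interval"
    by (auto intro!: measurable_restrict_space3 measurable_fst_snd_lebesgue)
  then have "(\<lambda>z. (fst z, snd z)) \<in> measurable unit_square unit_pair" by (rule measurable_Pair)
  then show ?thesis by simp
qed

text \<open>\<open>A\<close> and \<open>B\<close> differ from Borel sets only inside null sets. The
  rectangle then changes only inside two null strips, and for Borel rectangles the product formula
  is the one for the product of Borel measures.\<close>

lemma emeasure_lebesgue_Times:
  fixes A B :: "real set"
  assumes A: "A \<in> sets lebesgue" and B: "B \<in> sets lebesgue"
  shows "emeasure lebesgue (A \<times> B) = emeasure lebesgue A * emeasure lebesgue B"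
proof -
  have *: "\<exists>S N. S \<in> sets lborel \<and> N \<in> null_sets lborel \<and> (\<forall>x. x \<notin> N \<longrightarrow> (x \<in> A \<longleftrightarrow> x \<in> S)) \<and>
      emeasure lborel S = emeasure lebesgue A"
    if A: "A \<in> sets lebesgue" for A :: "real set"
  proof -
    obtain S N where S: "S \<in> sets lborel" "N \<in> null_sets lborel" "\<And>x. x \<notin> N \<Longrightarrow> (x \<in> A \<longleftrightarrow> x \<in> S)"
      using sets_completionE[OF A] by (metis Un_iff subsetD)
    have "emeasure lebesgue S = emeasure lebesgue A"
    proof (rule emeasure_eq_AE)
      have "AE x in lebesgue. x \<notin> N" using S by (auto intro!: AE_not_in null_sets_completionI)
      then show "AE x in lebesgue. x \<in> S \<longleftrightarrow> x \<in> A" by eventually_elim (use S in auto)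
    qed (use S A in \<open>auto intro: sets_completionI_sets\<close>)
    then have "emeasure lborel S = emeasure lebesgue A" using S by simp
    with S show ?thesis by blast
  qed
  obtain S N where S: "S \<in> sets lborel" "N \<in> null_sets lborel" "\<And>x. x \<notin> N \<Longrightarrow> (x \<in> A \<longleftrightarrow> x \<in> S)"
      "emeasure lborel S = emeasure lebesgue A"
    using *[OF A] by blast
  obtain S' N' where S': "S' \<in> sets lborel" "N' \<in> null_sets lborel" "\<And>x. x \<notin> N' \<Longrightarrow> (x \<in> B \<longleftrightarrow> x \<in> S')"
      "emeasure lborel S' = emeasure lebesgue B"
    using *[OF B] by blast
  have AB: "A \<times> B \<in> sets lebesgue"
  proof -
    have "fst -` A \<inter> space lebesgue \<inter> (snd -` B \<inter> space lebesgue) \<in> sets (lebesgue :: (real \<times> real) measure)"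
      by (intro sets.Int measurable_sets[OF measurable_fst_snd_lebesgue(1) A]
            measurable_sets[OF measurable_fst_snd_lebesgue(2) B])
    also have "fst -` A \<inter> space lebesgue \<inter> (snd -` B \<inter> space lebesgue) = A \<times> B" by auto
    finally show ?thesis .
  qed
  have SS: "S \<times> S' \<in> sets (lborel :: (real \<times> real) measure)"
    unfolding lborel_prod[symmetric] using S S' by (intro pair_measureI)
  have "emeasure lebesgue (A \<times> B) = emeasure lebesgue (S \<times> S')"
  proof (rule emeasure_eq_AE)
    have "AE z in lebesgue. z \<notin> N \<times> (UNIV :: real set)" "AE z in lebesgue. z \<notin> (UNIV :: real set) \<times> N'"
      using null_sets_lborel_Times S S' by (auto intro!: AE_not_in null_sets_completionI)
    then show "AE z in lebesgue. z \<in> A \<times> B \<longleftrightarrow> z \<in> S \<times> S'"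
      by eventually_elim (use S S' in auto)
    show "S \<times> S' \<in> sets lebesgue" using SS by (rule sets_completionI_sets)
  qed (rule AB)
  also have "\<dots> = emeasure (lborel \<Otimes>\<^sub>M lborel) (S \<times> S')"
    using SS by (simp add: lborel_prod)
  also have "\<dots> = emeasure lborel S * emeasure lborel S'"
    using S S' by (intro lborel.emeasure_pair_measure_Times)
  finally show ?thesis by (simp only: S(4) S'(4))
qed

lemma unit_square_in_sets: "{0..1} \<times> {0..1} \<in> sets (lebesgue :: (real \<times> real) measure)"
  by (intro sets_completionI_sets) (auto intro!: borel_closed closed_Times)

text \<open>Both measures agree on rectangles, which determines a product of sigma-finite measures.
  With this, passing between the square and the product is a change of variables along the
  identity.\<close>

lemma unit_pair_eq_distr: "unit_pair = distr unit_square unit_pair (\<lambda>z. z)"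
proof (rule pair_measure_eqI)
  fix A B assume A: "A \<in> sets unit_interval" and B: "B \<in> sets unit_interval"
  then have A': "A \<in> sets lebesgue" "A \<subseteq> {0..1}" and B': "B \<in> sets lebesgue" "B \<subseteq> {0..1}"
    by (auto simp: sets_restrict_space)
  have "emeasure (distr unit_square unit_pair (\<lambda>z. z)) (A \<times> B) = emeasure unit_square (A \<times> B)"
    using A B A' B' by (subst emeasure_distr[OF measurable_id_unit_square]) (auto intro!: pair_measureI arg_cong2[where f = emeasure])
  also have "\<dots> = emeasure lebesgue (A \<times> B)"
    using A' B' unit_square_in_sets by (intro emeasure_restrict_space) auto
  also have "\<dots> = emeasure unit_interval A * emeasure unit_interval B"
    using A' B' by (simp add: emeasure_lebesgue_Times emeasure_restrict_space)
  finally show "emeasure unit_interval A * emeasure unit_interval B = emeasure (distr unit_square unit_pair (\<lambda>z. z)) (A \<times> B)" ..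
qed (auto intro: unit_interval.sigma_finite_measure_axioms)

lemma AE_unit_square_if_unit_pair: "AE z in unit_pair. P z \<Longrightarrow> AE z in unit_square. P z"
  by (subst (asm) unit_pair_eq_distr) (rule AE_distrD[OF measurable_id_unit_square])

lemma integral_unit_square:
  fixes h :: "real \<times> real \<Rightarrow> real"
  assumes "h \<in> borel_measurable unit_pair"
  shows "(\<integral>z. h z \<partial>unit_square) = (\<integral>z. h z \<partial>unit_pair)"
  using arg_cong[OF unit_pair_eq_distr, of "\<lambda>M. integral\<^sup>L M h"]
  by (simp add: integral_distr[OF measurable_id_unit_square assms])

lemma measurable_id_unit_interval: "(\<lambda>x. x) \<in> borel_measurable unit_interval"
  by (intro measurable_restrict_space1 measurable_completion) simp

lemma measurable_id_unit_pair: "(\<lambda>z. z) \<in> borel_measurable unit_pair"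
proof -
  have "(\<lambda>z. (fst z, snd z)) \<in> borel_measurable unit_pair"
    by (intro borel_measurable_Pair measurable_compose[OF measurable_fst measurable_id_unit_interval]
          measurable_compose[OF measurable_snd measurable_id_unit_interval])
  then show ?thesis by simp
qed

text \<open>A Lebesgue null set of the square need not be measurable for the product. It is,
  however, contained in a Borel null set, which is.\<close>

lemma AE_unit_pair_if_unit_square:
  assumes "AE z in unit_square. P z"
  shows "AE z in unit_pair. P z"
proof -
  have "AE z in lebesgue. z \<in> {0..1} \<times> {0..1} \<longrightarrow> P z"
    using assms unit_square_in_sets by (subst (asm) AE_restrict_space_iff) auto
  then have "AE z in lborel. z \<in> {0..1} \<times> {0..1} \<longrightarrow> P z"
    by (simp add: AE_completion_iff)
  then obtain N where N: "N \<in> null_sets lborel"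
      "\<And>z. z \<in> space lborel - N \<Longrightarrow> z \<in> {0..1} \<times> {0..1} \<longrightarrow> P z"
    by (rule AE_E3) blast
  define N' where "N' = N \<inter> ({0..1} \<times> {0..1})"
  have N'': "N' \<in> sets unit_pair"
  proof -
    have "(\<lambda>z. z) -` N \<inter> space unit_pair \<in> sets unit_pair"
      by (rule measurable_sets[OF measurable_id_unit_pair]) (use N in auto)
    also have "(\<lambda>z. z) -` N \<inter> space unit_pair = N'"
      by (auto simp: N'_def space_pair_measure)
    finally show ?thesis .
  qed
  have "emeasure unit_pair N' = emeasure unit_square N'"
    by (subst unit_pair_eq_distr) (use N'' in \<open>auto simp: emeasure_distr[OF measurable_id_unit_square] N'_def space_restrict_space intro!: arg_cong2[where f = emeasure]\<close>)
  also have "\<dots> = emeasure lebesgue N'"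
    using unit_square_in_sets by (intro emeasure_restrict_space) (auto simp: N'_def)
  also have "\<dots> \<le> emeasure lebesgue N"
    using N by (intro emeasure_mono) (auto simp: N'_def)
  also have "\<dots> = 0" using null_sets_completionI[OF N(1)] by auto
  finally have "N' \<in> null_sets unit_pair" using N'' by auto
  then show ?thesis
    by (rule AE_I') (use N in \<open>auto simp: N'_def space_pair_measure\<close>)
qed

section \<open>Integral operators with bounded kernels\<close>

definition integral_op :: "(real \<Rightarrow> real \<Rightarrow> real) \<Rightarrow> (real \<Rightarrow> real) \<Rightarrow> real \<Rightarrow> real" where
  "integral_op k f x = (\<integral>y. k x y * f y \<partial>unit_interval)"

text \<open>The action on classes goes through a chosen representative; the choice is immaterial, as
  the integral against a section ignores null sets.\<close>

definition op_l2 :: "(real \<Rightarrow> real \<Rightarrow> real) \<Rightarrow> l2 \<Rightarrow> l2" where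
  "op_l2 k u = abs_l2 (integral_op k (rep_l2 u))"

lemma integrable_unit_interval_bounded:
  fixes f :: "real \<Rightarrow> real"
  assumes "f \<in> borel_measurable unit_interval" and "\<And>x. x \<in> {0..1} \<Longrightarrow> \<bar>f x\<bar> \<le> B"
  shows "integrable unit_interval f"
  using assms by (intro unit_interval.integrable_const_bound[of _ B]) auto

lemma integrable_unit_pair_bounded:
  fixes f :: "real \<times> real \<Rightarrow> real"
  assumes "f \<in> borel_measurable unit_pair"
    and "\<And>x y. x \<in> {0..1} \<Longrightarrow> y \<in> {0..1} \<Longrightarrow> \<bar>f (x, y)\<bar> \<le> B"
  shows "integrable unit_pair f"
  using assms by (intro unit_pair'.integrable_const_bound[of _ B]) (auto simp: space_pair_measure)

lemma square_integrable_bounded: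
  assumes "f \<in> borel_measurable unit_interval" and "\<And>x. x \<in> {0..1} \<Longrightarrow> \<bar>f x\<bar> \<le> B"
  shows "f \<in> square_integrable"
proof -
  have "integrable unit_interval (\<lambda>x. (f x)\<^sup>2)"
  proof (rule integrable_unit_interval_bounded)
    show "\<bar>(f x)\<^sup>2\<bar> \<le> B\<^sup>2" if "x \<in> {0..1}" for x
      using power_mono[OF assms(2)[OF that], of 2] by simp
  qed (use assms in auto)
  then show ?thesis using assms by (simp add: square_integrable_def)
qed

lemma integral_unit_interval_mono:
  fixes f g :: "real \<Rightarrow> real"
  assumes "integrable unit_interval f" "integrable unit_interval g"
    and "\<And>x. x \<in> {0..1} \<Longrightarrow> f x \<le> g x"
  shows "(\<integral>x. f x \<partial>unit_interval) \<le> (\<integral>x. g x \<partial>unit_interval)"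
  using assms by (intro integral_mono) auto

lemma integral_unit_interval_le_const:
  fixes f :: "real \<Rightarrow> real"
  assumes "integrable unit_interval f" and "\<And>x. x \<in> {0..1} \<Longrightarrow> f x \<le> c"
  shows "(\<integral>x. f x \<partial>unit_interval) \<le> c"
  using integral_unit_interval_mono[OF assms(1), of "\<lambda>_. c"] assms(2) by simp

lemma integral_op_cong_AE:
  assumes k: "k x \<in> borel_measurable unit_interval"
    and "f \<in> borel_measurable unit_interval" "g \<in> borel_measurable unit_interval"
    and ae: "AE y in unit_interval. f y = g y"
  shows "integral_op k f x = integral_op k g x"
  unfolding integral_op_def
  by (intro integral_cong_AE borel_measurable_times assms) (use ae in eventually_elim, simp)

text \<open>Measurability is asked for the product and the bound at every point, so that each single
  section \<open>k x\<close> is square integrable and integrals over y make sense for every x, not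
  just for almost every x.\<close>

locale bounded_kernel =
  fixes k :: "real \<Rightarrow> real \<Rightarrow> real" and B :: real
  assumes measurable_pair: "(\<lambda>z. k (fst z) (snd z)) \<in> borel_measurable unit_pair"
    and bound: "x \<in> {0..1} \<Longrightarrow> y \<in> {0..1} \<Longrightarrow> \<bar>k x y\<bar> \<le> B"
begin

lemma measurable_section: "x \<in> {0..1} \<Longrightarrow> k x \<in> borel_measurable unit_interval"
  using measurable_Pair2[OF measurable_pair, of x] by simp

lemma bound_nonneg: "0 \<le> B"
  using bound[of 0 0] by simp

lemma section_square_integrable: "x \<in> {0..1} \<Longrightarrow> k x \<in> square_integrable"
  by (rule square_integrable_bounded[OF measurable_section bound])

lemma integrable_section:
  "x \<in> {0..1} \<Longrightarrow> f \<in> square_integrable \<Longrightarrow> integrable unit_interval (\<lambda>y. k x y * f y)"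
  by (rule integrable_mult_square_integrable[OF section_square_integrable])

lemma measurable_integral_op:
  assumes "f \<in> borel_measurable unit_interval"
  shows "integral_op k f \<in> borel_measurable unit_interval"
proof -
  have "(\<lambda>z. k (fst z) (snd z) * f (snd z)) \<in> borel_measurable unit_pair"
    by (intro borel_measurable_times measurable_pair measurable_compose[OF measurable_snd assms])
  then show ?thesis
    unfolding integral_op_def[abs_def]
    by (intro unit_interval.borel_measurable_lebesgue_integral) (simp add: split_beta')
qed

lemma integral_op_le:
  assumes x: "x \<in> {0..1}" and f: "f \<in> square_integrable"
  shows "(integral_op k f x)\<^sup>2 \<le> (\<integral>y. (k x y)\<^sup>2 \<partial>unit_interval) * (\<integral>y. (f y)\<^sup>2 \<partial>unit_interval)"
  unfolding integral_op_def by (rule Cauchy_Schwarz_integral[OF section_square_integrable[OF x] f])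

lemma integral_op_le_bound:
  assumes x: "x \<in> {0..1}" and f: "f \<in> square_integrable"
  shows "(integral_op k f x)\<^sup>2 \<le> B\<^sup>2 * (\<integral>y. (f y)\<^sup>2 \<partial>unit_interval)"
proof -
  have "(\<integral>y. (k x y)\<^sup>2 \<partial>unit_interval) \<le> B\<^sup>2"
  proof (rule integral_unit_interval_le_const)
    show "(k x y)\<^sup>2 \<le> B\<^sup>2" if "y \<in> {0..1}" for y
      using power_mono[OF bound[OF x that], of 2] by simp
  qed (rule square_integrableD(2)[OF section_square_integrable[OF x]])
  moreover have "0 \<le> (\<integral>y. (f y)\<^sup>2 \<partial>unit_interval)" by simp
  ultimately show ?thesis
    using integral_op_le[OF x f] by (meson mult_right_mono order_trans)
qed

lemma integral_op_square_integrable: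
  assumes f: "f \<in> square_integrable"
  shows "integral_op k f \<in> square_integrable"
proof (rule square_integrable_bounded)
  show "integral_op k f \<in> borel_measurable unit_interval"
    by (rule measurable_integral_op[OF square_integrableD(1)[OF f]])
  show "\<bar>integral_op k f x\<bar> \<le> sqrt (B\<^sup>2 * (\<integral>y. (f y)\<^sup>2 \<partial>unit_interval))" if "x \<in> {0..1}" for x
    using integral_op_le_bound[OF that f] by (intro real_le_rsqrt) simp
qed

text \<open>Cauchy-Schwarz in y for each fixed x, followed by integration over x.\<close>

lemma integral_op_hilbert_schmidt:
  assumes f: "f \<in> square_integrable"
  shows "(\<integral>x. (integral_op k f x)\<^sup>2 \<partial>unit_interval) \<le>
         (\<integral>z. (k (fst z) (snd z))\<^sup>2 \<partial>unit_pair) * (\<integral>y. (f y)\<^sup>2 \<partial>unit_interval)"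
proof -
  have int: "integrable unit_pair (\<lambda>z. (k (fst z) (snd z))\<^sup>2)"
  proof (rule integrable_unit_pair_bounded)
    show "\<bar>(k (fst (x, y)) (snd (x, y)))\<^sup>2\<bar> \<le> B\<^sup>2" if "x \<in> {0..1}" "y \<in> {0..1}" for x y
      using power_mono[OF bound[OF that], of 2] by simp
  qed (use measurable_pair in auto)
  have int': "integrable unit_interval (\<lambda>x. \<integral>y. (k x y)\<^sup>2 \<partial>unit_interval)"
    using unit_pair.integrable_fst'[OF int] by simp
  have "(\<integral>x. (integral_op k f x)\<^sup>2 \<partial>unit_interval) \<le>
      (\<integral>x. (\<integral>y. (k x y)\<^sup>2 \<partial>unit_interval) * (\<integral>y. (f y)\<^sup>2 \<partial>unit_interval) \<partial>unit_interval)"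
    by (intro integral_unit_interval_mono integrable_mult_left int' integral_op_le[OF _ f]
          square_integrableD integral_op_square_integrable f)
  also have "\<dots> = (\<integral>x. (\<integral>y. (k x y)\<^sup>2 \<partial>unit_interval) \<partial>unit_interval) * (\<integral>y. (f y)\<^sup>2 \<partial>unit_interval)"
    by simp
  also have "(\<integral>x. (\<integral>y. (k x y)\<^sup>2 \<partial>unit_interval) \<partial>unit_interval) = (\<integral>z. (k (fst z) (snd z))\<^sup>2 \<partial>unit_pair)"
    using unit_pair.integral_fst'[OF int] by simp
  finally show ?thesis .
qed

lemma op_abs_l2:
  assumes f: "f \<in> square_integrable"
  shows "op_l2 k (abs_l2 f) = abs_l2 (integral_op k f)"
  unfolding op_l2_def
proof (subst abs_l2_eq_iff)
  have "integral_op k (rep_l2 (abs_l2 f)) x = integral_op k f x" if "x \<in> {0..1}" for x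
    by (intro integral_op_cong_AE measurable_section that square_integrableD rep_l2_square_integrable f rep_abs_l2)
  then show "AE x in unit_interval. integral_op k (rep_l2 (abs_l2 f)) x = integral_op k f x"
    by (intro AE_I2) simp
qed (auto intro!: integral_op_square_integrable f rep_l2_square_integrable)

lemma norm_op_l2_le:
  "(norm (op_l2 k u))\<^sup>2 \<le> (\<integral>z. (k (fst z) (snd z))\<^sup>2 \<partial>unit_pair) * (norm u)\<^sup>2"
  using integral_op_hilbert_schmidt[OF rep_l2_square_integrable[of u]]
  by (simp add: op_l2_def norm_abs_l2 integral_op_square_integrable rep_l2_square_integrable norm_rep_l2[of u])

lemma inner_op_l2:
  "f \<in> square_integrable \<Longrightarrow> g \<in> square_integrable \<Longrightarrow>
   inner (op_l2 k (abs_l2 f)) (abs_l2 g) = (\<integral>x. integral_op k f x * g x \<partial>unit_interval)"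
  by (simp add: op_abs_l2 inner_abs_l2 integral_op_square_integrable)

lemma linear_op_l2: "linear (op_l2 k)"
proof (rule linearI)
  fix u v :: l2 and c :: real
  define f g where "f = rep_l2 u" and "g = rep_l2 v"
  have f: "f \<in> square_integrable" "u = abs_l2 f" and g: "g \<in> square_integrable" "v = abs_l2 g"
    by (simp_all add: f_def g_def rep_l2_square_integrable)
  have "AE x in unit_interval. integral_op k (\<lambda>y. f y + g y) x = integral_op k f x + integral_op k g x"
    by (rule AE_I2) (simp add: integral_op_def distrib_left integrable_section f g)
  then show "op_l2 k (u + v) = op_l2 k u + op_l2 k v"
    by (simp add: f g plus_abs_l2 square_integrable_add op_abs_l2 integral_op_square_integrable abs_l2_eq_iff)
  have "AE x in unit_interval. integral_op k (\<lambda>y. c * f y) x = c * integral_op k f x"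
    by (rule AE_I2) (simp add: integral_op_def mult.left_commute)
  then show "op_l2 k (c *\<^sub>R u) = c *\<^sub>R op_l2 k u"
    by (simp add: f scaleR_abs_l2 square_integrable_scale op_abs_l2 integral_op_square_integrable abs_l2_eq_iff)
qed

lemma bounded_linear_op_l2: "bounded_linear (op_l2 k)"
proof -
  have "norm (op_l2 k u) \<le> norm u * sqrt (\<integral>z. (k (fst z) (snd z))\<^sup>2 \<partial>unit_pair)" for u
  proof (rule power2_le_imp_le)
    show "(norm (op_l2 k u))\<^sup>2 \<le> (norm u * sqrt (\<integral>z. (k (fst z) (snd z))\<^sup>2 \<partial>unit_pair))\<^sup>2"
      using norm_op_l2_le[of u] by (simp add: power_mult_distrib mult.commute)
  qed simp
  then show ?thesis using linear_op_l2 by (intro bounded_linear_intro) (auto simp: linear_add linear_scale)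
qed

text \<open>Tonelli's criterion: with absolute values inserted, the inner integral is the operator
  of the kernel |k| applied to |f|, and its product with |g| is integrable because both are square
  integrable.\<close>

lemma integrable_kernel_times:
  assumes f: "f \<in> square_integrable" and g: "g \<in> square_integrable"
  shows "integrable unit_pair (\<lambda>z. k (fst z) (snd z) * f (snd z) * g (fst z))"
proof (rule unit_pair.Fubini_integrable)
  have m[measurable]: "f \<in> borel_measurable unit_interval" "g \<in> borel_measurable unit_interval"
    using f g by (simp_all add: square_integrableD)
  note [measurable] = measurable_pair
  show "(\<lambda>z. k (fst z) (snd z) * f (snd z) * g (fst z)) \<in> borel_measurable unit_pair"
    by measurable
  have "integrable unit_interval (\<lambda>x. integral_op (\<lambda>x y. \<bar>k x y\<bar>) (\<lambda>y. \<bar>f y\<bar>) x * \<bar>g x\<bar>)"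
  proof (rule integrable_mult_square_integrable)
    interpret abs: bounded_kernel "\<lambda>x y. \<bar>k x y\<bar>" B
      by unfold_locales (use bound in auto)
    have "(\<lambda>y. \<bar>f y\<bar>) \<in> square_integrable" "(\<lambda>y. \<bar>g y\<bar>) \<in> square_integrable"
      using f g by (auto simp: square_integrable_def)
    then show "integral_op (\<lambda>x y. \<bar>k x y\<bar>) (\<lambda>y. \<bar>f y\<bar>) \<in> square_integrable" "(\<lambda>y. \<bar>g y\<bar>) \<in> square_integrable"
      by (auto intro: abs.integral_op_square_integrable)
  qed
  then show "integrable unit_interval (\<lambda>x. \<integral>y. norm (k (fst (x, y)) (snd (x, y)) * f (snd (x, y)) * g (fst (x, y))) \<partial>unit_interval)"
    by (simp add: abs_mult integral_op_def)
  show "AE x in unit_interval. integrable unit_interval (\<lambda>y. k (fst (x, y)) (snd (x, y)) * f (snd (x, y)) * g (fst (x, y)))"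
    by (rule AE_I2) (simp add: integrable_section f)
qed

lemma integral_op_inner:
  assumes f: "f \<in> square_integrable" and g: "g \<in> square_integrable"
  shows "(\<integral>x. integral_op k f x * g x \<partial>unit_interval) =
         (\<integral>z. k (fst z) (snd z) * f (snd z) * g (fst z) \<partial>unit_pair)"
  using unit_pair.integral_fst'[OF integrable_kernel_times[OF f g]]
  by (simp add: integral_op_def)

lemma selfadjoint_op_l2:
  assumes sym: "\<And>x y. x \<in> {0..1} \<Longrightarrow> y \<in> {0..1} \<Longrightarrow> k x y = k y x"
  shows "inner (op_l2 k u) v = inner u (op_l2 k v)"
proof -
  define f g where "f = rep_l2 u" and "g = rep_l2 v"
  have f: "f \<in> square_integrable" "u = abs_l2 f" and g: "g \<in> square_integrable" "v = abs_l2 g"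
    by (simp_all add: f_def g_def rep_l2_square_integrable)
  have int: "integrable unit_pair (\<lambda>z. k (fst z) (snd z) * f (snd z) * g (fst z))"
    by (rule integrable_kernel_times[OF f(1) g(1)])
  have "inner (op_l2 k u) v = (\<integral>x. (\<integral>y. k x y * f y * g x \<partial>unit_interval) \<partial>unit_interval)"
    using f g by (simp add: inner_op_l2 integral_op_def)
  also have "\<dots> = (\<integral>y. (\<integral>x. k x y * f y * g x \<partial>unit_interval) \<partial>unit_interval)"
    using unit_pair.Fubini_integral[of "\<lambda>x y. k x y * f y * g x"] int by (simp add: split_beta')
  also have "\<dots> = (\<integral>y. (\<integral>x. k y x * g x * f y \<partial>unit_interval) \<partial>unit_interval)"
    by (intro Bochner_Integration.integral_cong refl) (auto simp: sym)
  also have "\<dots> = inner (op_l2 k v) u"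
    using f g by (simp add: inner_op_l2 integral_op_def)
  finally show ?thesis by (simp add: inner_commute)
qed

end

subsection \<open>Compactness\<close>

text \<open>The set \<open>K\<close> is a sum of finitely many compact segments. It will contain the
  image of the unit ball under a finite rank operator.\<close>

lemma compact_combinations:
  fixes v :: "nat \<Rightarrow> 'a::real_normed_vector"
  shows "\<exists>K. compact K \<and> (\<forall>a. (\<forall>j<N. \<bar>a j\<bar> \<le> C) \<longrightarrow> (\<Sum>j<N. a j *\<^sub>R v j) \<in> K)"
proof (induction N)
  case 0
  show ?case by (rule exI[of _ "{0}"]) simp
next
  case (Suc N)
  then obtain K where K: "compact K" "\<And>a. (\<forall>j<N. \<bar>a j\<bar> \<le> C) \<Longrightarrow> (\<Sum>j<N. a j *\<^sub>R v j) \<in> K" by blast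
  define L where "L = (\<lambda>c. c *\<^sub>R v N) ` {-C..C}"
  have "compact L"
    unfolding L_def by (intro compact_continuous_image continuous_intros compact_Icc)
  with K(1) have "compact {x + y | x y. x \<in> K \<and> y \<in> L}" by (rule compact_sums)
  moreover have "(\<Sum>j<Suc N. a j *\<^sub>R v j) \<in> {x + y | x y. x \<in> K \<and> y \<in> L}"
    if "\<forall>j<Suc N. \<bar>a j\<bar> \<le> C" for a
  proof -
    have "a N \<in> {-C..C}" using that[rule_format, of N] by (auto simp: abs_le_iff)
    then have "a N *\<^sub>R v N \<in> L" by (auto simp: L_def)
    moreover have "(\<Sum>j<N. a j *\<^sub>R v j) \<in> K" using that by (intro K) auto
    ultimately show ?thesis by auto
  qed
  ultimately show ?case by blast
qed

text \<open>An image that lies within every \<delta> of a compact set is totally bounded, and in a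
  complete space its closure is then compact.\<close>

lemma convergent_subsequence_if_compact_approx:
  fixes T :: "'a::real_normed_vector \<Rightarrow> 'b::{real_normed_vector, complete_space}"
  assumes approx: "\<And>\<delta>. \<delta> > 0 \<Longrightarrow> \<exists>K. compact K \<and> (\<forall>x. norm x \<le> 1 \<longrightarrow> (\<exists>y\<in>K. dist (T x) y < \<delta>))"
    and X: "\<And>n::nat. norm (X n) \<le> 1"
  shows "\<exists>r. strict_mono r \<and> convergent (\<lambda>n. T (X (r n)))"
proof -
  define S where "S = T ` {x. norm x \<le> 1}"
  have "\<exists>k. finite k \<and> closure S \<subseteq> (\<Union>x\<in>k. ball x e)" if "e > 0" for e
  proof -
    \<comment> \<open>One third of \<open>e\<close> each for passing from the closure to the image,
      from the image to \<open>K\<close>, and from \<open>K\<close> to its finite net.\<close>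
    obtain K where K: "compact K" "\<And>x. norm x \<le> 1 \<Longrightarrow> \<exists>y\<in>K. dist (T x) y < e / 3"
      using approx[of "e / 3"] \<open>e > 0\<close> by auto
    obtain k where k: "finite k" "K \<subseteq> (\<Union>x\<in>k. ball x (e / 3))"
      using K(1) \<open>e > 0\<close> unfolding compact_eq_totally_bounded by (meson divide_pos_pos zero_less_numeral)
    have "closure S \<subseteq> (\<Union>x\<in>k. ball x e)"
    proof
      fix z assume "z \<in> closure S"
      then obtain s where "s \<in> S" "dist s z < e / 3"
        using \<open>e > 0\<close> unfolding closure_approachable by (meson divide_pos_pos zero_less_numeral)
      then obtain x where x: "norm x \<le> 1" "dist (T x) z < e / 3" by (auto simp: S_def)
      obtain y where y: "y \<in> K" "dist (T x) y < e / 3" using K(2)[OF x(1)] by blast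
      obtain c where c: "c \<in> k" "dist c y < e / 3" using k(2) y(1) by auto
      have "dist c z \<le> dist c y + dist y z" "dist y z \<le> dist (T x) y + dist (T x) z"
        by (rule dist_triangle, rule dist_triangle3)
      then have "dist c z < e" using x y c by linarith
      then show "z \<in> (\<Union>x\<in>k. ball x e)" using c by auto
    qed
    then show ?thesis using k(1) by blast
  qed
  moreover have "complete (closure S)" by (simp add: complete_eq_closed)
  ultimately have "compact (closure S)" unfolding compact_eq_totally_bounded by blast
  then have "seq_compact (closure S)" by (rule compact_imp_seq_compact)
  moreover have "\<forall>n. (T \<circ> X) n \<in> closure S"
    using X closure_subset[of S] by (auto simp: S_def)
  ultimately obtain l r where "strict_mono (r :: nat \<Rightarrow> nat)" "((T \<circ> X) \<circ> r) \<longlonglongrightarrow> l"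
    unfolding seq_compact_def by blast
  then show ?thesis by (auto simp: convergent_def o_def)
qed

context bounded_kernel
begin

text \<open>Lebesgue measurability provides continuous functions converging to the kernel almost
  everywhere. Truncating them to [-B, B] keeps continuity, leaves the limit unchanged and supplies
  the bound for dominated convergence.\<close>

lemma continuous_L2_approximation:
  assumes "\<delta> > 0"
  shows "\<exists>g :: real \<times> real \<Rightarrow> real. continuous_on UNIV g \<and> (\<forall>z. \<bar>g z\<bar> \<le> B) \<and>
           (\<integral>z. (k (fst z) (snd z) - g z)\<^sup>2 \<partial>unit_pair) < \<delta>"
proof -
  define h where "h z = k (fst z) (snd z)" for z
  have h[measurable]: "h \<in> borel_measurable unit_pair" using measurable_pair by (simp add: h_def[abs_def])
  then have "h \<in> borel_measurable unit_square"
    using measurable_compose[OF measurable_id_unit_square] by blast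
  then have "h measurable_on ({0..1} \<times> {0..1})"
    using measurable_on_iff_borel_measurable[OF unit_square_in_sets] by blast
  then obtain N g where N: "negligible N" and g: "\<And>n. continuous_on UNIV (g n)"
    and lim: "\<And>z. z \<notin> N \<Longrightarrow> (\<lambda>n. g n z) \<longlonglongrightarrow> (if z \<in> {0..1} \<times> {0..1} then h z else 0)"
    unfolding measurable_on_def by blast
  define c where "c n z = max (- B) (min B (g n z))" for n :: nat and z :: "real \<times> real"
  have c_cont: "continuous_on UNIV (c n)" for n
    unfolding c_def by (intro continuous_intros g)
  have c_bound: "\<bar>c n z\<bar> \<le> B" for n z
    using bound_nonneg by (auto simp: c_def)
  have [measurable]: "c n \<in> borel_measurable unit_pair" for n
    by (rule measurable_compose[OF measurable_id_unit_pair borel_measurable_continuous_onI[OF c_cont]])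
  have "AE z in lebesgue. z \<notin> N" using N by (intro AE_not_in) (simp add: negligible_iff_null_sets)
  then have "AE z in unit_square. z \<notin> N"
    using unit_square_in_sets by (subst AE_restrict_space_iff) auto
  then have "AE z in unit_pair. z \<notin> N" by (rule AE_unit_pair_if_unit_square)
  moreover have "AE z in unit_pair. z \<in> {0..1} \<times> {0..1}"
    by (rule AE_I2) (auto simp: space_pair_measure)
  ultimately have ae: "AE z in unit_pair. (\<lambda>n. (h z - c n z)\<^sup>2) \<longlonglongrightarrow> 0"
  proof eventually_elim
    case (elim z)
    have "\<bar>h z\<bar> \<le> B" using elim bound by (auto simp: h_def)
    then have hz: "max (- B) (min B (h z)) = h z" by auto
    have "(\<lambda>n. g n z) \<longlonglongrightarrow> h z" using lim[of z] elim by simp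
    then have "(\<lambda>n. (h z - c n z)\<^sup>2) \<longlonglongrightarrow> (h z - max (- B) (min B (h z)))\<^sup>2"
      unfolding c_def by (intro tendsto_intros)
    then show ?case by (simp add: hz)
  qed
  have "(\<lambda>n. \<integral>z. (h z - c n z)\<^sup>2 \<partial>unit_pair) \<longlonglongrightarrow> (\<integral>z. 0 \<partial>unit_pair)"
  proof (rule integral_dominated_convergence[OF _ _ _ ae])
    show "integrable unit_pair (\<lambda>z. (2 * B)\<^sup>2)" by simp
    show "AE z in unit_pair. norm ((h z - c n z)\<^sup>2) \<le> (2 * B)\<^sup>2" for n
    proof (rule AE_I2)
      fix z assume "z \<in> space unit_pair"
      then have "\<bar>h z\<bar> \<le> B" using bound by (auto simp: h_def space_pair_measure)
      then have "\<bar>h z - c n z\<bar> \<le> 2 * B" using c_bound[of n z] by linarith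
      then show "norm ((h z - c n z)\<^sup>2) \<le> (2 * B)\<^sup>2"
        using power_mono[of "\<bar>h z - c n z\<bar>" "2 * B" 2] by simp
    qed
  qed measurable
  then have "eventually (\<lambda>n. (\<integral>z. (h z - c n z)\<^sup>2 \<partial>unit_pair) < \<delta>) sequentially"
    using \<open>\<delta> > 0\<close> by (intro order_tendstoD) auto
  then obtain n where "(\<integral>z. (h z - c n z)\<^sup>2 \<partial>unit_pair) < \<delta>"
    by (auto simp: eventually_sequentially)
  then show ?thesis using c_cont[of n] c_bound[of n] unfolding h_def by blast
qed

text \<open>The kernel is approximated in L^2 by a continuous one, and this one, by uniform
  continuity, by a kernel that is constant in y on strips. The operator of the latter has finite
  rank and sends the unit ball into a compact set of combinations, while the Hilbert-Schmidt norm
  controls the error.\<close>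

lemma op_l2_compact_approx:
  assumes "\<delta> > 0"
  shows "\<exists>K. compact K \<and> (\<forall>u. norm u \<le> 1 \<longrightarrow> (\<exists>w\<in>K. dist (op_l2 k u) w < \<delta>))"
proof -
  \<comment> \<open>Both approximation errors are at most \<eta> in L^2 norm, and (a + b)^2 \<le> 2
    a^2 + 2 b^2 makes the total at most 2 \<eta> = \<delta> / 2.\<close>
  define \<eta> where "\<eta> = \<delta> / 4"
  have \<eta>: "\<eta> > 0" using assms by (simp add: \<eta>_def)
  obtain g :: "real \<times> real \<Rightarrow> real" where g: "continuous_on UNIV g" "\<And>z. \<bar>g z\<bar> \<le> B"
      "(\<integral>z. (k (fst z) (snd z) - g z)\<^sup>2 \<partial>unit_pair) < \<eta>\<^sup>2"
    using continuous_L2_approximation[of "\<eta>\<^sup>2"] \<eta> by auto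
  have "uniformly_continuous_on ({0..1} \<times> {0..1}) g"
    by (intro compact_uniformly_continuous continuous_on_subset[OF g(1)] compact_Times) auto
  then obtain d where d: "d > 0" "\<And>z z'. z \<in> {0..1} \<times> {0..1} \<Longrightarrow> z' \<in> {0..1} \<times> {0..1} \<Longrightarrow>
      dist z' z < d \<Longrightarrow> dist (g z') (g z) < \<eta>"
    unfolding uniformly_continuous_on_def using \<eta> by metis
  obtain n where n: "1 / real (Suc n) < d" using nat_approx_posE[OF d(1)] by blast
  define N where "N = Suc n"
  have N: "N > 0" "1 / real N < d" using n by (simp_all add: N_def)
  \<comment> \<open>The strips that meet the interval have indices 0, ..., N, and N occurs only for
    y = 1; hence the \<open>Suc N\<close> summands below.\<close>
  define I where "I j = {y. \<lfloor>real N * y\<rfloor> = int j}" for j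
  have I[measurable]: "I j \<in> sets borel" for j unfolding I_def by measurable
  have I': "indicator (I j) \<in> borel_measurable unit_interval" for j
    by (rule measurable_compose[OF measurable_id_unit_interval borel_measurable_indicator[OF I]])
  define p where "p j x = g (x, real j / real N)" for j x
  define k' where "k' x y = (\<Sum>j<Suc N. p j x * indicator (I j) y)" for x y
  have p_meas: "p j \<in> borel_measurable unit_interval" for j
  proof -
    have "continuous_on UNIV (p j)"
      unfolding p_def by (rule continuous_on_compose2[OF g(1)]) (auto intro!: continuous_intros)
    then show ?thesis
      by (rule measurable_compose[OF measurable_id_unit_interval borel_measurable_continuous_onI])
  qed
  have p_sq: "p j \<in> square_integrable" for j
    by (rule square_integrable_bounded[OF p_meas, of _ B]) (simp add: p_def g)
  have k'_eq: "k' x y = g (x, real_of_int \<lfloor>real N * y\<rfloor> / real N) \<and>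
      0 \<le> \<lfloor>real N * y\<rfloor> \<and> \<lfloor>real N * y\<rfloor> \<le> int N" if y: "y \<in> {0..1}" for x y
  proof -
    define m where "m = nat \<lfloor>real N * y\<rfloor>"
    have m: "\<lfloor>real N * y\<rfloor> = int m" using y by (simp add: m_def)
    have "real N * y \<le> real N" using y by (simp add: mult_left_le)
    then have "\<lfloor>real N * y\<rfloor> \<le> int N" by linarith
    then have mN: "m < Suc N" using m by simp
    have "k' x y = (\<Sum>j<Suc N. if j = m then p m x else 0)"
      unfolding k'_def by (intro sum.cong) (auto simp: I_def m)
    also have "\<dots> = p m x" using mN by (subst sum.delta) auto
    finally show ?thesis using m mN by (simp add: p_def)
  qed
  interpret k': bounded_kernel k' B
  proof
    show "(\<lambda>z. k' (fst z) (snd z)) \<in> borel_measurable unit_pair"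
      unfolding k'_def
      by (intro borel_measurable_sum borel_measurable_times measurable_compose[OF measurable_fst p_meas]
            measurable_compose[OF measurable_snd I'])
    show "\<bar>k' x y\<bar> \<le> B" if "y \<in> {0..1}" for x y using k'_eq[OF that] g(2) by simp
  qed
  interpret D: bounded_kernel "\<lambda>x y. k x y - k' x y" "2 * B"
  proof
    show "(\<lambda>z. k (fst z) (snd z) - k' (fst z) (snd z)) \<in> borel_measurable unit_pair"
      by (intro borel_measurable_diff measurable_pair k'.measurable_pair)
    show "\<bar>k x y - k' x y\<bar> \<le> 2 * B" if "x \<in> {0..1}" "y \<in> {0..1}" for x y
      using bound[OF that] k'.bound[OF that] by linarith
  qed
  have gk': "\<bar>g (x, y) - k' x y\<bar> < \<eta>" if x: "x \<in> {0..1}" and y: "y \<in> {0..1}" for x y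
  proof -
    define t where "t = real_of_int \<lfloor>real N * y\<rfloor> / real N"
    have "0 \<le> real_of_int \<lfloor>real N * y\<rfloor>" "real_of_int \<lfloor>real N * y\<rfloor> \<le> real_of_int (int N)"
      using k'_eq[OF y] by (simp_all only: of_int_le_iff of_int_0_le_iff)
    then have t: "t \<in> {0..1}" using N(1) by (simp add: t_def)
    have "real_of_int \<lfloor>real N * y\<rfloor> \<le> real N * y" "real N * y < real_of_int \<lfloor>real N * y\<rfloor> + 1" by linarith+
    then have "t \<le> y" "y < t + 1 / real N" using N(1) by (simp_all add: t_def field_simps)
    then have "dist t y < d" using N(2) by (simp add: dist_real_def)
    then have "dist (x, y) (x, t) < d" by (simp add: dist_Pair_Pair dist_commute)
    from d(2)[OF _ _ this] x y t show ?thesis using k'_eq[OF y] by (simp add: t_def dist_real_def)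
  qed
  have Dsmall: "(\<integral>z. (k (fst z) (snd z) - k' (fst z) (snd z))\<^sup>2 \<partial>unit_pair) \<le> (2 * \<eta>)\<^sup>2"
  proof -
    have gm: "g \<in> borel_measurable unit_pair"
      by (rule measurable_compose[OF measurable_id_unit_pair borel_measurable_continuous_onI[OF g(1)]])
    have int1: "integrable unit_pair (\<lambda>z. (k (fst z) (snd z) - g z)\<^sup>2)"
    proof (rule integrable_unit_pair_bounded)
      show "\<bar>(k (fst (x, y)) (snd (x, y)) - g (x, y))\<^sup>2\<bar> \<le> (2 * B)\<^sup>2" if "x \<in> {0..1}" "y \<in> {0..1}" for x y
      proof -
        have "\<bar>k x y - g (x, y)\<bar> \<le> 2 * B" using bound[OF that] g(2)[of "(x, y)"] by linarith
        then show ?thesis using power_mono[of "\<bar>k x y - g (x, y)\<bar>" "2 * B" 2] by simp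
      qed
    qed (use gm measurable_pair in auto)
    have int2: "integrable unit_pair (\<lambda>z. (k (fst z) (snd z) - k' (fst z) (snd z))\<^sup>2)"
    proof (rule integrable_unit_pair_bounded)
      show "\<bar>(k (fst (x, y)) (snd (x, y)) - k' (fst (x, y)) (snd (x, y)))\<^sup>2\<bar> \<le> (2 * B)\<^sup>2"
        if "x \<in> {0..1}" "y \<in> {0..1}" for x y
        using power_mono[OF D.bound[OF that], of 2] by simp
    qed (use D.measurable_pair in auto)
    have "(\<integral>z. (k (fst z) (snd z) - k' (fst z) (snd z))\<^sup>2 \<partial>unit_pair)
        \<le> (\<integral>z. 2 * (k (fst z) (snd z) - g z)\<^sup>2 + 2 * \<eta>\<^sup>2 \<partial>unit_pair)"
    proof (rule integral_mono[OF int2])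
      show "integrable unit_pair (\<lambda>z. 2 * (k (fst z) (snd z) - g z)\<^sup>2 + 2 * \<eta>\<^sup>2)" using int1 by simp
      fix z assume "z \<in> space unit_pair"
      then have z: "fst z \<in> {0..1}" "snd z \<in> {0..1}" by (auto simp: space_pair_measure)
      define a b where "a = k (fst z) (snd z) - g z" and "b = g z - k' (fst z) (snd z)"
      have "\<bar>b\<bar> < \<eta>" using gk'[OF z] by (simp add: b_def)
      then have "b\<^sup>2 \<le> \<eta>\<^sup>2" using power_mono[of "\<bar>b\<bar>" \<eta> 2] by simp
      moreover have "(a + b)\<^sup>2 \<le> 2 * a\<^sup>2 + 2 * b\<^sup>2"
        using zero_le_power2[of "a - b"] by (simp add: power2_eq_square algebra_simps)
      ultimately show "(k (fst z) (snd z) - k' (fst z) (snd z))\<^sup>2 \<le> 2 * (k (fst z) (snd z) - g z)\<^sup>2 + 2 * \<eta>\<^sup>2"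
        by (simp add: a_def b_def)
    qed
    also have "\<dots> = 2 * (\<integral>z. (k (fst z) (snd z) - g z)\<^sup>2 \<partial>unit_pair) + 2 * \<eta>\<^sup>2"
    proof -
      have "emeasure unit_pair ({0..1} \<times> {0..1}) = 1"
        by (subst unit_interval.emeasure_pair_measure_Times) (auto simp: emeasure_restrict_space)
      then have "measure unit_pair (space unit_pair) = 1" by (simp add: measure_def space_pair_measure)
      then show ?thesis using int1 by simp
    qed
    also have "\<dots> \<le> 4 * \<eta>\<^sup>2" using g(3) by simp
    finally show ?thesis by (simp add: power_mult_distrib)
  qed
  obtain K where K: "compact K"
      "\<And>a. (\<forall>j<Suc N. \<bar>a j\<bar> \<le> 1) \<Longrightarrow> (\<Sum>j<Suc N. a j *\<^sub>R abs_l2 (p j)) \<in> K"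
    using compact_combinations[of "Suc N" 1 "\<lambda>j. abs_l2 (p j)"] by blast
  have "\<exists>w\<in>K. dist (op_l2 k u) w < \<delta>" if u: "norm u \<le> 1" for u
  proof
    define f where "f = rep_l2 u"
    have f: "f \<in> square_integrable" "u = abs_l2 f"
      by (simp_all add: f_def rep_l2_square_integrable)
    define a where "a j = (\<integral>y. indicator (I j) y * f y \<partial>unit_interval)" for j
    have I_sq: "(indicator (I j) :: real \<Rightarrow> real) \<in> square_integrable" for j
      by (rule square_integrable_bounded[OF I', of _ 1]) (simp add: indicator_def)
    have "integral_op k' f = (\<lambda>x. \<Sum>j<Suc N. a j * p j x)"
    proof
      fix x
      have "integral_op k' f x = (\<integral>y. (\<Sum>j<Suc N. p j x * (indicator (I j) y * f y)) \<partial>unit_interval)"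
        unfolding integral_op_def k'_def by (simp only: sum_distrib_right mult.assoc)
      also have "\<dots> = (\<Sum>j<Suc N. \<integral>y. p j x * (indicator (I j) y * f y) \<partial>unit_interval)"
        by (intro Bochner_Integration.integral_sum integrable_mult_right integrable_mult_square_integrable I_sq f)
      also have "\<dots> = (\<Sum>j<Suc N. a j * p j x)"
        by (intro sum.cong refl) (simp add: a_def)
      finally show "integral_op k' f x = (\<Sum>j<Suc N. a j * p j x)" .
    qed
    then have "op_l2 k' u = abs_l2 (\<lambda>x. \<Sum>j<Suc N. a j * p j x)"
      using f by (simp only: k'.op_abs_l2)
    also have "\<dots> = (\<Sum>j<Suc N. a j *\<^sub>R abs_l2 (p j))"
      by (intro sum_abs_l2[symmetric] p_sq) simp
    also have "\<dots> \<in> K"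
    proof (rule K(2), intro allI impI)
      fix j
      have "(a j)\<^sup>2 \<le> (\<integral>y. (indicator (I j) y)\<^sup>2 \<partial>unit_interval) * (\<integral>y. (f y)\<^sup>2 \<partial>unit_interval)"
        unfolding a_def by (rule Cauchy_Schwarz_integral[OF I_sq f(1)])
      also have "\<dots> \<le> 1 * 1"
      proof (rule mult_mono)
        show "(\<integral>y. (indicator (I j) y :: real)\<^sup>2 \<partial>unit_interval) \<le> 1"
          by (rule integral_unit_interval_le_const[OF square_integrableD(2)[OF I_sq]]) (simp add: indicator_def)
        show "(\<integral>y. (f y)\<^sup>2 \<partial>unit_interval) \<le> 1"
          using u norm_abs_l2[OF f(1)] f(2) power_le_one[of "norm u" 2] by simp
      qed auto
      finally show "\<bar>a j\<bar> \<le> 1" by (simp add: abs_square_le_1)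
    qed
    finally show "op_l2 k' u \<in> K" .
    have "op_l2 k u - op_l2 k' u = op_l2 (\<lambda>x y. k x y - k' x y) u"
    proof -
      have "AE x in unit_interval. integral_op k f x - integral_op k' f x = integral_op (\<lambda>x y. k x y - k' x y) f x"
        by (rule AE_I2) (simp add: integral_op_def left_diff_distrib integrable_section k'.integrable_section f)
      then show ?thesis
        using f by (simp add: op_abs_l2 k'.op_abs_l2 D.op_abs_l2 minus_abs_l2 integral_op_square_integrable
            k'.integral_op_square_integrable D.integral_op_square_integrable abs_l2_eq_iff square_integrable_diff)
    qed
    then have "(dist (op_l2 k u) (op_l2 k' u))\<^sup>2 = (norm (op_l2 (\<lambda>x y. k x y - k' x y) u))\<^sup>2"
      by (simp add: dist_norm)
    also have "\<dots> \<le> (\<integral>z. (k (fst z) (snd z) - k' (fst z) (snd z))\<^sup>2 \<partial>unit_pair) * (norm u)\<^sup>2"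
      by (rule D.norm_op_l2_le)
    also have "\<dots> \<le> (2 * \<eta>)\<^sup>2 * 1"
      using u by (intro mult_mono Dsmall power_le_one) auto
    finally have "(dist (op_l2 k u) (op_l2 k' u))\<^sup>2 \<le> (2 * \<eta>)\<^sup>2" by simp
    then have "dist (op_l2 k u) (op_l2 k' u) \<le> 2 * \<eta>"
      by (rule power2_le_imp_le[of _ "2 * \<eta>"]) (use \<eta> in auto)
    then show "dist (op_l2 k u) (op_l2 k' u) < \<delta>" using assms by (simp add: \<eta>_def)
  qed
  then show ?thesis using K(1) by blast
qed

lemma compact_selfadjoint_op_l2:
  assumes sym: "\<And>x y. x \<in> {0..1} \<Longrightarrow> y \<in> {0..1} \<Longrightarrow> k x y = k y x"
  shows "compact_selfadjoint (op_l2 k)"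
proof (rule compact_selfadjoint.intro)
  show "bounded_linear (op_l2 k)" by (rule bounded_linear_op_l2)
  show "inner (op_l2 k u) v = inner u (op_l2 k v)" for u v by (rule selfadjoint_op_l2[OF sym])
  show "\<exists>r. strict_mono r \<and> convergent (\<lambda>n. op_l2 k (X (r n)))"
    if "\<And>n. norm (X n) \<le> 1" for X :: "nat \<Rightarrow> l2"
    by (rule convergent_subsequence_if_compact_approx[OF op_l2_compact_approx that])
qed

end

section \<open>Enumerations of eigenvalues\<close>

lemma has_multiplicity_cong:
  "eigenfunctions T \<mu> = eigenfunctions T' \<mu>' \<Longrightarrow> has_multiplicity T \<mu> m = has_multiplicity T' \<mu>' m"
  by (simp add: has_multiplicity_def)

text \<open>If m < m', the coefficients that express the m' independent functions through the m
  spanning ones form a system with more unknowns than equations. A nontrivial solution of it is a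
  linear relation among the independent functions.\<close>

lemma has_multiplicity_le:
  assumes m: "has_multiplicity T \<mu> m" and m': "has_multiplicity T \<mu> m'"
  shows "m' \<le> m"
proof (rule ccontr)
  assume "\<not> m' \<le> m"
  then have lt: "m < m'" by simp
  obtain b where span: "\<And>f. f \<in> eigenfunctions T \<mu> \<Longrightarrow>
      \<exists>a. AE x in unit_interval. f x = (\<Sum>i<m. a i * b i x)"
    using m unfolding has_multiplicity_def by blast
  obtain b' where b': "\<And>i. i < m' \<Longrightarrow> b' i \<in> eigenfunctions T \<mu>"
    and indep: "\<And>a. AE x in unit_interval. (\<Sum>i<m'. a i * b' i x) = 0 \<Longrightarrow> \<forall>i<m'. a i = 0"
    using m' unfolding has_multiplicity_def by blast
  have "\<forall>j. \<exists>c. j < m' \<longrightarrow> (AE x in unit_interval. b' j x = (\<Sum>i<m. c i * b i x))"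
    using span b' by blast
  then obtain c where c: "\<And>j. j < m' \<Longrightarrow> AE x in unit_interval. b' j x = (\<Sum>i<m. c j i * b i x)"
    by metis
  obtain a where a: "\<exists>j<m'. a j \<noteq> 0" "\<And>i. i < m \<Longrightarrow> (\<Sum>j<m'. c j i * a j) = 0"
    using homogeneous_system_nontrivial[OF lt, of "\<lambda>i j. c j i"] by blast
  have "AE x in unit_interval. \<forall>j\<in>{..<m'}. b' j x = (\<Sum>i<m. c j i * b i x)"
    using c by (subst AE_finite_all) auto
  then have "AE x in unit_interval. (\<Sum>j<m'. a j * b' j x) = 0"
  proof eventually_elim
    case (elim x)
    have "(\<Sum>j<m'. a j * b' j x) = (\<Sum>j<m'. \<Sum>i<m. a j * (c j i * b i x))"
      using elim by (simp add: sum_distrib_left)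
    also have "\<dots> = (\<Sum>i<m. \<Sum>j<m'. a j * (c j i * b i x))" by (rule sum.swap)
    also have "\<dots> = (\<Sum>i<m. (\<Sum>j<m'. c j i * a j) * b i x)"
      by (intro sum.cong refl) (simp add: sum_distrib_left sum_distrib_right mult_ac)
    finally show ?case using a(2) by simp
  qed
  from indep[OF this] a(1) show False by blast
qed

lemma has_multiplicity_unique:
  "has_multiplicity T \<mu> m \<Longrightarrow> has_multiplicity T \<mu> m' \<Longrightarrow> m = m'"
  by (meson has_multiplicity_le order_antisym)

text \<open>At a first index with l i > l' i, the value \<mu> = l i is not attained by
  \<open>l'\<close> from i on, and before i both sequences agree. So \<mu> occurs strictly less
  often in \<open>l'\<close> than in \<open>l\<close>, although both counts are its
  multiplicity.\<close>

lemma eigenvalues_above_le: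
  assumes l: "eigenvalues_above c T l" and l': "eigenvalues_above c T l'"
    and less: "\<And>j. j < i \<Longrightarrow> l j = l' j"
  shows "l i \<le> l' i"
proof (rule ccontr)
  assume "\<not> l i \<le> l' i"
  then have lt: "l' i < l i" by simp
  have ge: "c \<le> l' i" and dec: "decseq l'" using l' by (auto simp: eigenvalues_above_def)
  define \<mu> where "\<mu> = l i"
  have \<mu>: "\<mu> > c" using lt ge by (simp add: \<mu>_def)
  have fin: "finite {j. l j = \<mu>}" and eq: "card {j. l j = \<mu>} = card {j. l' j = \<mu>}"
    using l l' \<mu> has_multiplicity_unique unfolding eigenvalues_above_def by blast+
  have "l' j < \<mu>" if "i \<le> j" for j
    using dec that lt unfolding decseq_def \<mu>_def by (meson order.strict_trans1)
  note below = this
  have "{j. l' j = \<mu>} \<subseteq> {j. l j = \<mu>} - {i}"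
  proof
    fix j assume "j \<in> {j. l' j = \<mu>}"
    then have j: "l' j = \<mu>" by simp
    then have "j < i" using below[of j] by (cases "i \<le> j") auto
    then show "j \<in> {j. l j = \<mu>} - {i}" using less[of j] j by auto
  qed
  then have "card {j. l' j = \<mu>} \<le> card ({j. l j = \<mu>} - {i})"
    using fin by (intro card_mono) auto
  also have "\<dots> < card {j. l j = \<mu>}"
    using fin by (intro psubset_card_mono) (auto simp: \<mu>_def)
  finally show False using eq by simp
qed

text \<open>This allows an arbitrary enumeration to be identified with the one that a spectral
  sequence provides.\<close>

lemma eigenvalues_above_unique:
  assumes "eigenvalues_above c T l" "eigenvalues_above c T l'"
  shows "l = l'"
proof
  fix i show "l i = l' i"
  proof (induction i rule: less_induct)
    case (less i)
    then have "\<And>j. j < i \<Longrightarrow> l j = l' j" "\<And>j. j < i \<Longrightarrow> l' j = l j" by simp_all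
    then show ?case
      using eigenvalues_above_le[OF assms] eigenvalues_above_le[OF assms(2,1)] by (meson order_antisym)
  qed
qed

section \<open>Moving enumerations between operators\<close>

lemma eigenvalues_above_shift:
  assumes l: "eigenvalues_above c T l"
    and eq: "\<And>\<mu>. \<mu> > c \<Longrightarrow> eigenfunctions T' (\<mu> + d) = eigenfunctions T \<mu>"
  shows "eigenvalues_above (c + d) T' (\<lambda>i. l i + d)"
  unfolding eigenvalues_above_def
proof (intro conjI allI impI)
  show "decseq (\<lambda>i. l i + d)" and "c + d \<le> l i + d" for i
    using l by (auto simp: eigenvalues_above_def decseq_def)
next
  fix \<mu> assume "c + d < \<mu>"
  then have \<mu>: "\<mu> - d > c" by simp
  have *: "{i. l i + d = \<mu>} = {i. l i = \<mu> - d}" by auto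
  show "finite {i. l i + d = \<mu>}" using l \<mu> unfolding * eigenvalues_above_def by blast
  have "has_multiplicity T (\<mu> - d) (card {i. l i = \<mu> - d})"
    using l \<mu> unfolding eigenvalues_above_def by blast
  then show "has_multiplicity T' \<mu> (card {i. l i + d = \<mu>})"
    unfolding * using has_multiplicity_cong[OF eq[OF \<mu>]] by simp
qed

lemma eigenvalues_below_reflect:
  assumes l: "eigenvalues_above c T l"
    and eq: "\<And>\<mu>. \<mu> > c \<Longrightarrow> eigenfunctions T' (d - \<mu>) = eigenfunctions T \<mu>"
  shows "eigenvalues_below (d - c) T' (\<lambda>i. d - l i)"
  unfolding eigenvalues_below_def
proof (intro conjI allI impI)
  show "incseq (\<lambda>i. d - l i)" and "d - l i \<le> d - c" for i
    using l by (auto simp: eigenvalues_above_def decseq_def incseq_def)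
next
  fix \<mu> assume "\<mu> < d - c"
  then have \<mu>: "d - \<mu> > c" by simp
  have *: "{i. d - l i = \<mu>} = {i. l i = d - \<mu>}" by auto
  show "finite {i. d - l i = \<mu>}" using l \<mu> unfolding * eigenvalues_above_def by blast
  have "has_multiplicity T (d - \<mu>) (card {i. l i = d - \<mu>})"
    using l \<mu> unfolding eigenvalues_above_def by blast
  then show "has_multiplicity T' \<mu> (card {i. d - l i = \<mu>})"
    unfolding * using has_multiplicity_cong[OF eq[OF \<mu>]] by simp
qed

lemma square_integrable_compose:
  assumes \<psi>: "\<psi> \<in> measure_preserving_maps" and f: "f \<in> square_integrable"
  shows "(\<lambda>x. f (\<psi> x)) \<in> square_integrable"
proof -
  have m: "\<psi> \<in> measurable unit_interval unit_interval" and d: "distr unit_interval unit_interval \<psi> = unit_interval"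
    using \<psi> by (auto simp: measure_preserving_maps_def)
  have "integrable (distr unit_interval unit_interval \<psi>) (\<lambda>x. (f x)\<^sup>2)"
    using f by (simp add: d square_integrableD)
  then have "integrable unit_interval (\<lambda>x. (f (\<psi> x))\<^sup>2)"
    by (rule integrable_distr[OF m])
  moreover have "(\<lambda>x. f (\<psi> x)) \<in> borel_measurable unit_interval"
    by (rule measurable_compose[OF m square_integrableD(1)[OF f]])
  ultimately show ?thesis by (simp add: square_integrable_def)
qed

text \<open>The map sending f to w (f o \<psi>) is injective modulo null functions, as
  \<open>w\<close> has no zeros and \<open>\<psi>\<close> preserves measure, so it carries bases of
  eigenspaces to bases. It serves twice: with \<open>\<psi>\<close> the identity for conjugation by
  a weight, and with \<open>w = 1\<close> for pullbacks.\<close>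

lemma eigenvalues_above_transfer:
  assumes \<psi>: "\<psi> \<in> measure_preserving_maps" and w: "\<And>x. w x \<noteq> 0"
    and into: "\<And>\<mu> f. \<mu> > c \<Longrightarrow> f \<in> eigenfunctions T \<mu> \<Longrightarrow> (\<lambda>x. w x * f (\<psi> x)) \<in> eigenfunctions T' \<mu>"
    and onto: "\<And>\<mu> h. \<mu> > c \<Longrightarrow> h \<in> eigenfunctions T' \<mu> \<Longrightarrow>
                 \<exists>f\<in>eigenfunctions T \<mu>. AE x in unit_interval. h x = w x * f (\<psi> x)"
    and l: "eigenvalues_above c T l"
  shows "eigenvalues_above c T' l"
proof -
  have m: "\<psi> \<in> measurable unit_interval unit_interval" and d: "distr unit_interval unit_interval \<psi> = unit_interval"
    using \<psi> by (auto simp: measure_preserving_maps_def)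
  have "has_multiplicity T' \<mu> n" if \<mu>: "\<mu> > c" and n: "has_multiplicity T \<mu> n" for \<mu> n
  proof -
    obtain b where b: "\<And>i. i < n \<Longrightarrow> b i \<in> eigenfunctions T \<mu>"
      and indep: "\<And>a. AE x in unit_interval. (\<Sum>i<n. a i * b i x) = 0 \<Longrightarrow> \<forall>i<n. a i = 0"
      and span: "\<And>f. f \<in> eigenfunctions T \<mu> \<Longrightarrow> \<exists>a. AE x in unit_interval. f x = (\<Sum>i<n. a i * b i x)"
      using n unfolding has_multiplicity_def by blast
    have pull: "(\<Sum>i<n. a i * (w x * b i (\<psi> x))) = w x * (\<Sum>i<n. a i * b i (\<psi> x))" for a x
      by (simp add: sum_distrib_left mult.left_commute)
    show ?thesis
      unfolding has_multiplicity_def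
    proof (intro exI[of _ "\<lambda>i x. w x * b i (\<psi> x)"] conjI allI impI ballI)
      show "(\<lambda>x. w x * b i (\<psi> x)) \<in> eigenfunctions T' \<mu>" if "i < n" for i
        by (rule into[OF \<mu> b[OF that]])
    next
      fix a i assume "AE x in unit_interval. (\<Sum>i<n. a i * (w x * b i (\<psi> x))) = 0" and i: "i < n"
      then have ae: "AE x in unit_interval. (\<Sum>i<n. a i * b i (\<psi> x)) = 0"
        unfolding pull using w by simp
      have meas: "(\<lambda>x. \<Sum>i<n. a i * b i x) \<in> borel_measurable unit_interval"
        using b by (intro square_integrableD square_integrable_sum) (auto simp: eigenfunctions_def)
      \<comment> \<open>A relation that holds at \<psi> x for almost every x holds almost everywhere
        for the image measure, which is the original one.\<close>
      have "AE x in distr unit_interval unit_interval \<psi>. (\<Sum>i<n. a i * b i x) = 0"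
      proof (subst AE_distr_iff[OF m])
        show "{x \<in> space unit_interval. (\<Sum>i<n. a i * b i x) = 0} \<in> sets unit_interval"
          using meas by measurable
      qed (rule ae)
      then have "AE x in unit_interval. (\<Sum>i<n. a i * b i x) = 0" by (simp only: d)
      from indep[OF this] i show "a i = 0" by blast
    next
      fix h assume "h \<in> eigenfunctions T' \<mu>"
      then obtain f where f: "f \<in> eigenfunctions T \<mu>" and h: "AE x in unit_interval. h x = w x * f (\<psi> x)"
        using onto[OF \<mu>] by blast
      obtain a where a: "AE x in unit_interval. f x = (\<Sum>i<n. a i * b i x)" using span[OF f] by blast
      have "AE x in unit_interval. f (\<psi> x) = (\<Sum>i<n. a i * b i (\<psi> x))"
        by (rule AE_distrD[OF m]) (simp only: d a)
      with h have "AE x in unit_interval. h x = (\<Sum>i<n. a i * (w x * b i (\<psi> x)))"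
        unfolding pull by eventually_elim simp
      then show "\<exists>a. AE x in unit_interval. h x = (\<Sum>i<n. a i * (w x * b i (\<psi> x)))" by blast
    qed
  qed
  then show ?thesis using l unfolding eigenvalues_above_def by blast
qed

section \<open>Enumerations for symmetric integral operators\<close>

context bounded_kernel
begin

lemma eigenfunctions_integral_op:
  assumes f: "f \<in> square_integrable"
  shows "f \<in> eigenfunctions (integral_op k) \<mu> \<longleftrightarrow> op_l2 k (abs_l2 f) = \<mu> *\<^sub>R abs_l2 f"
  using f by (simp add: eigenfunctions_def op_abs_l2 scaleR_abs_l2 abs_l2_eq_iff
      integral_op_square_integrable square_integrable_scale)

text \<open>The vectors \<open>e i\<close> with \<open>l i = \<mu>\<close> represent a basis of the
  eigenspace: orthonormality makes them independent and \<open>eigenvector_expansion\<close> shows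
  that they span.\<close>

lemma eigenvalues_above_integral_op:
  assumes sym: "\<And>x y. x \<in> {0..1} \<Longrightarrow> y \<in> {0..1} \<Longrightarrow> k x y = k y x"
    and S: "spectral_sequence (op_l2 k) l e"
  shows "eigenvalues_above 0 (integral_op k) l"
proof -
  interpret T: compact_selfadjoint "op_l2 k" by (rule compact_selfadjoint_op_l2[OF sym])
  have "has_multiplicity (integral_op k) \<mu> (card {i. l i = \<mu>})" if \<mu>: "\<mu> > 0" for \<mu>
  proof -
    define m where "m = card {i. l i = \<mu>}"
    have fin: "finite {i. l i = \<mu>}" by (rule finite_spectral_sequence_level[OF S \<mu>])
    obtain h where h: "bij_betw h {..<m} {i. l i = \<mu>}"
      using ex_bij_betw_nat_finite[OF fin] unfolding m_def atLeast0LessThan by blast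
    have lh: "l (h i) = \<mu>" if "i < m" for i using h that by (auto simp: bij_betw_def)
    define b where "b i = rep_l2 (e (h i))" for i
    have b: "b i \<in> square_integrable" "abs_l2 (b i) = e (h i)" for i
      by (simp_all add: b_def rep_l2_square_integrable)
    have sum_b: "(\<Sum>i<m. a i *\<^sub>R e (h i)) = abs_l2 (\<lambda>x. \<Sum>i<m. a i * b i x)" for a
      using sum_abs_l2[of "{..<m}" b a] b by simp
    have sum_sq: "(\<lambda>x. \<Sum>i<m. a i * b i x) \<in> square_integrable" for a
      by (rule square_integrable_sum) (rule b)
    show ?thesis
      unfolding has_multiplicity_def m_def[symmetric]
    proof (intro exI[of _ b] conjI allI impI ballI)
      show "b i \<in> eigenfunctions (integral_op k) \<mu>" if "i < m" for i
        using S lh[OF that] by (simp add: eigenfunctions_integral_op b spectral_sequence_def)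
    next
      fix a i assume "AE x in unit_interval. (\<Sum>i<m. a i * b i x) = 0" and i: "i < m"
      then have 0: "(\<Sum>i<m. a i *\<^sub>R e (h i)) = 0"
        unfolding sum_b zero_l2_eq by (subst abs_l2_eq_iff[OF sum_sq square_integrable_const])
      have "inner (e (h j)) (e (h i)) = (if j = i then 1 else 0)" if j: "j < m" for j
      proof (cases "j = i")
        case True
        have "norm (e (h i)) = 1" using S lh[OF i] \<mu> by (simp add: spectral_sequence_def)
        then show ?thesis using True by (simp add: norm_eq_sqrt_inner)
      next
        case False
        then have "h j \<noteq> h i" using h i j by (auto simp: bij_betw_def inj_on_def)
        then show ?thesis using False S by (simp add: spectral_sequence_def)
      qed
      then have "inner (\<Sum>j<m. a j *\<^sub>R e (h j)) (e (h i)) = (\<Sum>j<m. if j = i then a i else 0)"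
        unfolding inner_sum_left by (intro sum.cong refl) auto
      then show "a i = 0" using 0 i by simp
    next
      fix f assume f: "f \<in> eigenfunctions (integral_op k) \<mu>"
      then have sq: "f \<in> square_integrable" by (simp add: eigenfunctions_def)
      then have "op_l2 k (abs_l2 f) = \<mu> *\<^sub>R abs_l2 f" using f eigenfunctions_integral_op by blast
      from T.eigenvector_expansion[OF S \<mu> this]
      have "abs_l2 f = (\<Sum>i | l i = \<mu>. inner (abs_l2 f) (e i) *\<^sub>R e i)" .
      also have "\<dots> = (\<Sum>i<m. inner (abs_l2 f) (e (h i)) *\<^sub>R e (h i))"
        by (rule sum.reindex_bij_betw[OF h, symmetric])
      also have "\<dots> = abs_l2 (\<lambda>x. \<Sum>i<m. inner (abs_l2 f) (e (h i)) * b i x)" by (rule sum_b)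
      finally have "AE x in unit_interval. f x = (\<Sum>i<m. inner (abs_l2 f) (e (h i)) * b i x)"
        by (subst (asm) abs_l2_eq_iff[OF sq sum_sq])
      then show "\<exists>a. AE x in unit_interval. f x = (\<Sum>i<m. a i * b i x)"
        by (intro exI[of _ "\<lambda>i. inner (abs_l2 f) (e (h i))"])
    qed
  qed
  then show ?thesis
    using S finite_spectral_sequence_level[OF S] by (simp add: eigenvalues_above_def spectral_sequence_def)
qed

end

lemma ex_eigenvalues_above_integral_op:
  assumes "bounded_kernel k B" and "\<And>x y. x \<in> {0..1} \<Longrightarrow> y \<in> {0..1} \<Longrightarrow> k x y = k y x"
  shows "\<exists>l. eigenvalues_above 0 (integral_op k) l"
  using compact_selfadjoint.ex_spectral_sequence[OF bounded_kernel.compact_selfadjoint_op_l2[OF assms]]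
    bounded_kernel.eigenvalues_above_integral_op[OF assms] by blast

text \<open>Weyl's inequality in both directions. It compares quadratic forms only, so the
  hypothesis bounds the form of the difference on the diagonal, with the same \<open>f\<close> in
  both variables.\<close>

lemma eigenvalues_above_perturbation:
  assumes k: "bounded_kernel k B" and ksym: "\<And>x y. x \<in> {0..1} \<Longrightarrow> y \<in> {0..1} \<Longrightarrow> k x y = k y x"
    and k': "bounded_kernel k' B'" and ksym': "\<And>x y. x \<in> {0..1} \<Longrightarrow> y \<in> {0..1} \<Longrightarrow> k' x y = k' y x"
    and l: "eigenvalues_above 0 (integral_op k) l" and l': "eigenvalues_above 0 (integral_op k') l'"
    and close: "\<And>f. f \<in> square_integrable \<Longrightarrow>
      \<bar>\<integral>z. (k (fst z) (snd z) - k' (fst z) (snd z)) * f (snd z) * f (fst z) \<partial>unit_pair\<bar>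
        \<le> \<delta> * (\<integral>x. (f x)\<^sup>2 \<partial>unit_interval)"
    and "\<delta> \<ge> 0"
  shows "\<bar>l i - l' i\<bar> \<le> \<delta>"
proof -
  interpret k: bounded_kernel k B by (rule k)
  interpret k': bounded_kernel k' B' by (rule k')
  obtain e where S: "spectral_sequence (op_l2 k) l e"
    using compact_selfadjoint.ex_spectral_sequence[OF k.compact_selfadjoint_op_l2[OF ksym]]
      k.eigenvalues_above_integral_op[OF ksym] eigenvalues_above_unique[OF l] by metis
  obtain e' where S': "spectral_sequence (op_l2 k') l' e'"
    using compact_selfadjoint.ex_spectral_sequence[OF k'.compact_selfadjoint_op_l2[OF ksym']]
      k'.eigenvalues_above_integral_op[OF ksym'] eigenvalues_above_unique[OF l'] by metis
  have "\<bar>inner (op_l2 k u) u - inner (op_l2 k' u) u\<bar> \<le> \<delta> * (norm u)\<^sup>2" for u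
  proof -
    define f where "f = rep_l2 u"
    have f: "f \<in> square_integrable" "u = abs_l2 f"
      by (simp_all add: f_def rep_l2_square_integrable)
    have "inner (op_l2 k u) u - inner (op_l2 k' u) u =
        (\<integral>z. k (fst z) (snd z) * f (snd z) * f (fst z) \<partial>unit_pair) -
        (\<integral>z. k' (fst z) (snd z) * f (snd z) * f (fst z) \<partial>unit_pair)"
      by (simp only: f k.inner_op_l2 k'.inner_op_l2 k.integral_op_inner k'.integral_op_inner)
    also have "\<dots> = (\<integral>z. k (fst z) (snd z) * f (snd z) * f (fst z) -
        k' (fst z) (snd z) * f (snd z) * f (fst z) \<partial>unit_pair)"
      by (intro Bochner_Integration.integral_diff[symmetric] k.integrable_kernel_times k'.integrable_kernel_times f)
    finally show ?thesis using close[OF f(1)] by (simp add: f norm_abs_l2 left_diff_distrib)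
  qed
  note * = this
  have "inner (op_l2 k u) u \<le> inner (op_l2 k' u) u + \<delta> * (norm u)\<^sup>2"
    "inner (op_l2 k' u) u \<le> inner (op_l2 k u) u + \<delta> * (norm u)\<^sup>2" for u
    using *[of u] by linarith+
  from spectral_sequence_perturbation[OF S' S k.linear_op_l2 this(1) \<open>\<delta> \<ge> 0\<close>]
    spectral_sequence_perturbation[OF S S' k'.linear_op_l2 this(2) \<open>\<delta> \<ge> 0\<close>]
  show ?thesis by (meson abs_diff_le_iff diff_le_eq)
qed

section \<open>Graphons\<close>

lemma borel_measurable_lebesgue_on_cong_AE:
  fixes f g :: "'a::euclidean_space \<Rightarrow> real"
  assumes S: "S \<in> sets lebesgue" and f: "f \<in> borel_measurable (lebesgue_on S)"
    and ae: "AE x in lebesgue_on S. f x = g x"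
  shows "g \<in> borel_measurable (lebesgue_on S)"
proof -
  have "(\<lambda>x. if x \<in> S then f x else 0) \<in> borel_measurable lebesgue"
    using f borel_measurable_if[OF S] by blast
  moreover have "AE x in lebesgue. x \<in> S \<longrightarrow> f x = g x"
    using ae S by (subst (asm) AE_restrict_space_iff) auto
  then have "AE x in lebesgue. (if x \<in> S then f x else 0) = (if x \<in> S then g x else 0)"
    by eventually_elim simp
  ultimately have "(\<lambda>x. if x \<in> S then g x else 0) \<in> borel_measurable lebesgue"
    by (rule borel_measurable_AE)
  then show ?thesis using borel_measurable_if[OF S] by blast
qed

text \<open>Symmetry and bounds are demanded on the whole plane, so they survive composition with
  any map and need no membership side conditions; product measurability makes every section over the
  interval measurable.\<close>

definition regular_graphon :: "(real \<Rightarrow> real \<Rightarrow> real) \<Rightarrow> bool" where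
  "regular_graphon U \<longleftrightarrow> (\<lambda>z. U (fst z) (snd z)) \<in> borel_measurable unit_pair \<and>
     (\<forall>x y. 0 \<le> U x y \<and> U x y \<le> 1 \<and> U x y = U y x)"

lemma regular_graphonD:
  assumes "regular_graphon U"
  shows "(\<lambda>z. U (fst z) (snd z)) \<in> borel_measurable unit_pair"
    "0 \<le> U x y" "U x y \<le> 1" "U x y = U y x"
  using assms unfolding regular_graphon_def by blast+

lemma AE_unit_pair_swap:
  assumes "AE z in unit_pair. P z"
  shows "AE z in unit_pair. P (snd z, fst z)"
proof -
  have "AE z in distr unit_pair unit_pair (\<lambda>(x, y). (y, x)). P z"
    unfolding unit_pair.distr_pair_swap[symmetric] by (rule assms)
  from AE_distrD[OF measurable_pair_swap' this] show ?thesis by (simp add: split_beta')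
qed

text \<open>\<open>W\<close> agrees almost everywhere with a Borel function. Clipping that function
  to [0, 1] and averaging it with its transpose enforces bounds and symmetry at every point, and
  changes it only on a null set because \<open>W\<close> has both properties already.\<close>

lemma ex_regular_graphon:
  assumes W: "graphon W"
  shows "\<exists>U. regular_graphon U \<and> (AE z in unit_pair. W (fst z) (snd z) = U (fst z) (snd z))"
proof -
  define h where "h z = (if z \<in> {0..1} \<times> {0..1} then W (fst z) (snd z) else 0)" for z
  have "h \<in> borel_measurable lebesgue"
    unfolding h_def borel_measurable_if[OF unit_square_in_sets] using W unfolding graphon_def by (rule conjunct1)
  then obtain g where g: "g \<in> borel_measurable lborel" and ae: "AE z in lborel. h z = g z"
    using completion_ex_borel_measurable_real by blast
  have "AE z in lebesgue. h z = g z" using ae by (rule AE_completion)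
  then have "AE z in lebesgue. z \<in> {0..1} \<times> {0..1} \<longrightarrow> W (fst z) (snd z) = g z"
    by eventually_elim (auto simp: h_def)
  then have "AE z in unit_square. W (fst z) (snd z) = g z"
    using unit_square_in_sets by (subst AE_restrict_space_iff) auto
  then have 1: "AE z in unit_pair. W (fst z) (snd z) = g z" by (rule AE_unit_pair_if_unit_square)
  from AE_unit_pair_swap[OF this] have 2: "AE z in unit_pair. W (snd z) (fst z) = g (snd z, fst z)" by simp
  have gm: "g \<in> borel_measurable unit_pair"
    using g by (intro measurable_compose[OF measurable_id_unit_pair]) simp
  have gm': "(\<lambda>z. g (snd z, fst z)) \<in> borel_measurable unit_pair"
    by (rule measurable_compose[OF _ gm]) measurable
  define c where "c t = max 0 (min 1 t)" for t :: real
  define U where "U x y = (c (g (x, y)) + c (g (y, x))) / 2" for x y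
  have "regular_graphon U"
    unfolding regular_graphon_def
  proof (intro conjI allI)
    show "(\<lambda>z. U (fst z) (snd z)) \<in> borel_measurable unit_pair"
      unfolding U_def c_def using gm gm' by simp
    show "0 \<le> U x y" "U x y \<le> 1" "U x y = U y x" for x y
      by (auto simp: U_def c_def)
  qed
  moreover have "AE z in unit_pair. z \<in> {0..1} \<times> {0..1}"
    by (rule AE_I2) (auto simp: space_pair_measure)
  with 1 2 have "AE z in unit_pair. W (fst z) (snd z) = U (fst z) (snd z)"
  proof eventually_elim
    case (elim z)
    have "\<forall>x\<in>{0..1}. \<forall>y\<in>{0..1}. W x y \<in> {0..1} \<and> W x y = W y x"
      using W unfolding graphon_def by (rule conjunct2)
    moreover have "fst z \<in> {0..1}" "snd z \<in> {0..1}" using elim(3) by auto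
    ultimately have "W (fst z) (snd z) \<in> {0..1} \<and> W (fst z) (snd z) = W (snd z) (fst z)"
      by blast
    then show ?case using elim(1,2) by (simp add: U_def c_def)
  qed
  ultimately show ?thesis by blast
qed

lemma bounded_kernel_regular_graphon: "regular_graphon U \<Longrightarrow> bounded_kernel U 1"
  by unfold_locales (auto simp: regular_graphon_def)

lemma degree_fun_regular_graphon:
  assumes U: "regular_graphon U"
  shows "degree_fun U \<in> borel_measurable unit_interval"
    and "x \<in> {0..1} \<Longrightarrow> degree_fun U x \<in> {0..1}"
proof -
  interpret bounded_kernel U 1 by (rule bounded_kernel_regular_graphon[OF U])
  have eq: "degree_fun U = integral_op U (\<lambda>_. 1)" by (auto simp: degree_fun_def integral_op_def)
  show "degree_fun U \<in> borel_measurable unit_interval"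
    unfolding eq by (rule measurable_integral_op) simp
  show "degree_fun U x \<in> {0..1}" if x: "x \<in> {0..1}"
  proof -
    have "degree_fun U x \<le> 1"
      unfolding degree_fun_def using regular_graphonD[OF U]
      by (intro integral_unit_interval_le_const integrable_unit_interval_bounded[of _ 1] measurable_section x) auto
    moreover have "0 \<le> degree_fun U x"
      unfolding degree_fun_def using regular_graphonD[OF U] by (intro integral_nonneg_AE) auto
    ultimately show ?thesis by simp
  qed
qed

text \<open>For almost every x the sections of \<open>W\<close> and \<open>U\<close> at x agree
  almost everywhere. Completeness of Lebesgue measure makes such a section of \<open>W\<close>
  measurable, so degree and operator have the same value at x.\<close>

lemma rw_kernel_op_cong:
  assumes U: "regular_graphon U" and ae: "AE z in unit_pair. W (fst z) (snd z) = U (fst z) (snd z)"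
  shows "AE x in unit_interval. degree_fun W x = degree_fun U x"
    and "f \<in> borel_measurable unit_interval \<Longrightarrow> AE x in unit_interval. rw_kernel_op W f x = rw_kernel_op U f x"
proof -
  interpret bounded_kernel U 1 by (rule bounded_kernel_regular_graphon[OF U])
  have S: "{0..1} \<in> sets (lebesgue :: real measure)" by simp
  have ae': "AE x in unit_interval. AE y in unit_interval. W x y = U x y"
    using unit_pair.AE_pair[OF ae] by simp
  have sec: "W x \<in> borel_measurable unit_interval \<and> degree_fun W x = degree_fun U x"
    if x: "x \<in> {0..1}" and ae: "AE y in unit_interval. W x y = U x y" for x
  proof
    show m: "W x \<in> borel_measurable unit_interval"
      by (rule borel_measurable_lebesgue_on_cong_AE[OF S measurable_section[OF x]])
         (use ae in eventually_elim, simp)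
    show "degree_fun W x = degree_fun U x"
      unfolding degree_fun_def by (rule integral_cong_AE[OF m measurable_section[OF x] ae])
  qed
  show "AE x in unit_interval. degree_fun W x = degree_fun U x"
    using ae' AE_space by eventually_elim (use sec in simp)
  assume f: "f \<in> borel_measurable unit_interval"
  show "AE x in unit_interval. rw_kernel_op W f x = rw_kernel_op U f x"
    using ae' AE_space
  proof eventually_elim
    case (elim x)
    then have x: "x \<in> {0..1}" by simp
    note Wx = sec[OF x elim(1)]
    have *: "rw_kernel V x = (\<lambda>y. (if degree_fun V x > 0 then 1 / degree_fun V x else 0) * V x y)" for V
      by (auto simp: rw_kernel_def)
    show ?case
      unfolding rw_kernel_op_def *
      using Wx elim(1) measurable_section[OF x] f
      by (intro integral_cong_AE borel_measurable_times borel_measurable_const) auto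
  qed
qed

section \<open>The symmetrized random walk kernel\<close>

lemma square_integrable_mult_bounded:
  assumes g: "g \<in> borel_measurable unit_interval" "\<And>x. x \<in> {0..1} \<Longrightarrow> \<bar>g x\<bar> \<le> B"
    and f: "f \<in> square_integrable"
  shows "(\<lambda>x. g x * f x) \<in> square_integrable"
proof -
  have m: "(\<lambda>x. g x * f x) \<in> borel_measurable unit_interval"
    by (intro borel_measurable_times g square_integrableD(1)[OF f])
  have "integrable unit_interval (\<lambda>x. (g x * f x)\<^sup>2)"
  proof (rule Bochner_Integration.integrable_bound)
    show "integrable unit_interval (\<lambda>x. B\<^sup>2 * (f x)\<^sup>2)" using square_integrableD(2)[OF f] by simp
    show "(\<lambda>x. (g x * f x)\<^sup>2) \<in> borel_measurable unit_interval" using m by simp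
    show "AE x in unit_interval. norm ((g x * f x)\<^sup>2) \<le> norm (B\<^sup>2 * (f x)\<^sup>2)"
    proof (rule AE_I2)
      fix x assume "x \<in> space unit_interval"
      then have "(g x)\<^sup>2 \<le> B\<^sup>2" using power_mono[OF g(2)[of x], of 2] by simp
      then show "norm ((g x * f x)\<^sup>2) \<le> norm (B\<^sup>2 * (f x)\<^sup>2)"
        by (simp add: power_mult_distrib mult_right_mono)
    qed
  qed
  with m show ?thesis by (simp add: square_integrable_def)
qed

definition inv_sqrt_degree :: "real \<Rightarrow> (real \<Rightarrow> real \<Rightarrow> real) \<Rightarrow> real \<Rightarrow> real" where
  "inv_sqrt_degree \<epsilon> U x = 1 / sqrt (max \<epsilon> (degree_fun U x))"

text \<open>Conjugating the random walk kernel by the square root of the degree makes it symmetric; the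
  degree is cut off at \<open>\<epsilon>\<close> so that the kernel is bounded everywhere.\<close>

definition symmetric_kernel :: "real \<Rightarrow> (real \<Rightarrow> real \<Rightarrow> real) \<Rightarrow> real \<Rightarrow> real \<Rightarrow> real" where
  "symmetric_kernel \<epsilon> U x y = inv_sqrt_degree \<epsilon> U x * U x y * inv_sqrt_degree \<epsilon> U y"

lemma inv_sqrt_degree_bounds:
  assumes "\<epsilon> > 0"
  shows "0 < inv_sqrt_degree \<epsilon> U x" "inv_sqrt_degree \<epsilon> U x \<le> 1 / sqrt \<epsilon>"
  using assms by (auto simp: inv_sqrt_degree_def intro!: divide_left_mono)

lemma measurable_inv_sqrt_degree:
  assumes "regular_graphon U"
  shows "inv_sqrt_degree \<epsilon> U \<in> borel_measurable unit_interval"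
  unfolding inv_sqrt_degree_def[abs_def] using degree_fun_regular_graphon(1)[OF assms] by simp

lemma symmetric_kernel_sym:
  "regular_graphon U \<Longrightarrow> symmetric_kernel \<epsilon> U x y = symmetric_kernel \<epsilon> U y x"
  using regular_graphonD(4)[of U x y] by (simp add: symmetric_kernel_def)

lemma bounded_kernel_symmetric_kernel:
  assumes U: "regular_graphon U" and \<epsilon>: "\<epsilon> > 0"
  shows "bounded_kernel (\<lambda>x y. c * symmetric_kernel \<epsilon> U x y) (\<bar>c\<bar> / \<epsilon>)"
proof
  show "(\<lambda>z. c * symmetric_kernel \<epsilon> U (fst z) (snd z)) \<in> borel_measurable unit_pair"
    unfolding symmetric_kernel_def
    by (intro borel_measurable_times borel_measurable_const regular_graphonD(1)[OF U]
          measurable_compose[OF measurable_fst measurable_inv_sqrt_degree[OF U]]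
          measurable_compose[OF measurable_snd measurable_inv_sqrt_degree[OF U]])
  fix x y
  have "inv_sqrt_degree \<epsilon> U x * U x y * inv_sqrt_degree \<epsilon> U y \<le> 1 / sqrt \<epsilon> * 1 * (1 / sqrt \<epsilon>)"
    using inv_sqrt_degree_bounds[OF \<epsilon>, of U] regular_graphonD[OF U] \<epsilon>
    by (intro mult_mono) (auto simp: less_imp_le)
  moreover have "0 \<le> inv_sqrt_degree \<epsilon> U x * U x y * inv_sqrt_degree \<epsilon> U y"
    using inv_sqrt_degree_bounds[OF \<epsilon>, of U] regular_graphonD[OF U]
    by (intro mult_nonneg_nonneg) (auto simp: less_imp_le)
  ultimately have "\<bar>symmetric_kernel \<epsilon> U x y\<bar> \<le> 1 / \<epsilon>"
    using \<epsilon> by (simp add: symmetric_kernel_def)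
  then show "\<bar>c * symmetric_kernel \<epsilon> U x y\<bar> \<le> \<bar>c\<bar> / \<epsilon>"
    using mult_left_mono[of "\<bar>symmetric_kernel \<epsilon> U x y\<bar>" "1 / \<epsilon>" "\<bar>c\<bar>"] by (simp add: abs_mult)
qed

lemma rw_kernel_op_symmetric_kernel:
  assumes U: "regular_graphon U" and \<epsilon>: "\<epsilon> > 0" and d: "degree_fun U x \<ge> \<epsilon>"
  shows "rw_kernel_op U (\<lambda>y. inv_sqrt_degree \<epsilon> U y * f y) x =
         inv_sqrt_degree \<epsilon> U x * integral_op (symmetric_kernel \<epsilon> U) f x"
proof -
  \<comment> \<open>Where the degree is at least \<epsilon> the cutoff is inactive, and the squared
    weight is the reciprocal of the degree.\<close>
  have "1 / degree_fun U x = inv_sqrt_degree \<epsilon> U x * inv_sqrt_degree \<epsilon> U x"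
    using d \<epsilon> by (simp add: inv_sqrt_degree_def)
  then have "rw_kernel U x y * (inv_sqrt_degree \<epsilon> U y * f y) =
      inv_sqrt_degree \<epsilon> U x * (symmetric_kernel \<epsilon> U x y * f y)" for y
  proof -
    have "rw_kernel U x y = (1 / degree_fun U x) * U x y" using d \<epsilon> by (simp add: rw_kernel_def)
    also have "\<dots> = inv_sqrt_degree \<epsilon> U x * inv_sqrt_degree \<epsilon> U x * U x y"
      by (simp only: \<open>1 / degree_fun U x = inv_sqrt_degree \<epsilon> U x * inv_sqrt_degree \<epsilon> U x\<close>)
    finally show ?thesis by (simp add: symmetric_kernel_def mult_ac)
  qed
  then have "rw_kernel_op U (\<lambda>y. inv_sqrt_degree \<epsilon> U y * f y) x =
      (\<integral>y. inv_sqrt_degree \<epsilon> U x * (symmetric_kernel \<epsilon> U x y * f y) \<partial>unit_interval)"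
    by (simp only: rw_kernel_op_def)
  then show ?thesis by (simp add: integral_op_def)
qed

lemma id_measure_preserving: "(\<lambda>x. x) \<in> measure_preserving_maps"
  by (simp add: measure_preserving_maps_def distr_id)

text \<open>Multiplication by the weight a maps the eigenspaces of the symmetric kernel onto those
  of the random walk operator. It preserves square integrability in both directions, as a is at most
  1 / sqrt \<epsilon> and 1 / a is the square root of a bounded function.\<close>

lemma eigenvalues_above_rw_kernel_op:
  assumes U: "regular_graphon U" and \<epsilon>: "\<epsilon> > 0"
    and d: "AE x in unit_interval. degree_fun U x \<ge> \<epsilon>"
    and l: "eigenvalues_above 0 (integral_op (\<lambda>x y. c * symmetric_kernel \<epsilon> U x y)) l"
  shows "eigenvalues_above 0 (\<lambda>f x. c * rw_kernel_op U f x) l"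
proof (rule eigenvalues_above_transfer[OF id_measure_preserving _ _ _ l])
  let ?a = "inv_sqrt_degree \<epsilon> U"
  have a: "0 < ?a x" "?a x \<le> 1 / sqrt \<epsilon>" for x by (rule inv_sqrt_degree_bounds[OF \<epsilon>])+
  show "?a x \<noteq> 0" for x using a(1)[of x] by simp
  \<comment> \<open>The exceptional null set comes from the degree alone, so it serves all
    \<open>f\<close> at once and both directions below.\<close>
  have ae: "AE x in unit_interval. \<forall>f. c * rw_kernel_op U (\<lambda>y. ?a y * f y) x =
      ?a x * integral_op (\<lambda>x y. c * symmetric_kernel \<epsilon> U x y) f x"
    using d
  proof eventually_elim
    case (elim x)
    have "integral_op (\<lambda>x y. c * symmetric_kernel \<epsilon> U x y) f x = c * integral_op (symmetric_kernel \<epsilon> U) f x" for f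
      by (simp add: integral_op_def mult.assoc)
    then show ?case using rw_kernel_op_symmetric_kernel[OF U \<epsilon> elim] by simp
  qed
  have a_m: "?a \<in> borel_measurable unit_interval" by (rule measurable_inv_sqrt_degree[OF U])
  fix \<mu>
  show "(\<lambda>x. ?a x * f x) \<in> eigenfunctions (\<lambda>f x. c * rw_kernel_op U f x) \<mu>"
    if f: "f \<in> eigenfunctions (integral_op (\<lambda>x y. c * symmetric_kernel \<epsilon> U x y)) \<mu>" for f
    unfolding eigenfunctions_def
  proof (intro CollectI conjI)
    show "(\<lambda>x. ?a x * f x) \<in> square_integrable"
      using f a by (intro square_integrable_mult_bounded[OF a_m, of "1 / sqrt \<epsilon>"]) (auto simp: eigenfunctions_def less_imp_le)
    have "AE x in unit_interval. integral_op (\<lambda>x y. c * symmetric_kernel \<epsilon> U x y) f x = \<mu> * f x"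
      using f by (simp add: eigenfunctions_def)
    then show "AE x in unit_interval. c * rw_kernel_op U (\<lambda>x. ?a x * f x) x = \<mu> * (?a x * f x)"
      using ae by eventually_elim simp
  qed
  show "\<exists>f\<in>eigenfunctions (integral_op (\<lambda>x y. c * symmetric_kernel \<epsilon> U x y)) \<mu>.
      AE x in unit_interval. h x = ?a x * f x"
    if h: "h \<in> eigenfunctions (\<lambda>f x. c * rw_kernel_op U f x) \<mu>" for h
  proof
    define f where "f x = 1 / ?a x * h x" for x
    have af: "?a x * f x = h x" for x using a(1)[of x] by (simp add: f_def)
    then show "AE x in unit_interval. h x = ?a x * f x" by simp
    have inv: "1 / ?a x = sqrt (max \<epsilon> (degree_fun U x))" for x by (simp add: inv_sqrt_degree_def)
    have f: "f \<in> square_integrable"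
      unfolding f_def
    proof (rule square_integrable_mult_bounded)
      show "(\<lambda>x. 1 / ?a x) \<in> borel_measurable unit_interval" using a_m by simp
      show "\<bar>1 / ?a x\<bar> \<le> sqrt (max \<epsilon> 1)" if "x \<in> {0..1}" for x
        unfolding inv using degree_fun_regular_graphon(2)[OF U that] \<epsilon> by auto
      show "h \<in> square_integrable" using h by (simp add: eigenfunctions_def)
    qed
    have "AE x in unit_interval. c * rw_kernel_op U h x = \<mu> * h x"
      using h by (simp add: eigenfunctions_def)
    then have "AE x in unit_interval. integral_op (\<lambda>x y. c * symmetric_kernel \<epsilon> U x y) f x = \<mu> * f x"
      using ae
    proof eventually_elim
      case (elim x)
      have "?a x * integral_op (\<lambda>x y. c * symmetric_kernel \<epsilon> U x y) f x = c * rw_kernel_op U h x"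
        using elim(2)[rule_format, of f] by (simp only: af)
      also have "\<dots> = \<mu> * (?a x * f x)" using elim(1) by (simp only: af)
      also have "\<dots> = ?a x * (\<mu> * f x)" by (rule mult.left_commute)
      finally have "?a x * integral_op (\<lambda>x y. c * symmetric_kernel \<epsilon> U x y) f x = ?a x * (\<mu> * f x)" .
      then show ?case using a(1)[of x] by (simp only: mult_cancel_left) simp
    qed
    then show "f \<in> eigenfunctions (integral_op (\<lambda>x y. c * symmetric_kernel \<epsilon> U x y)) \<mu>"
      using f by (simp add: eigenfunctions_def)
  qed
qed

section \<open>Pullbacks along measure preserving maps\<close>

lemma integral_measure_preserving:
  fixes f :: "real \<Rightarrow> real"
  assumes "\<psi> \<in> measure_preserving_maps" and "f \<in> borel_measurable unit_interval"
  shows "(\<integral>x. f (\<psi> x) \<partial>unit_interval) = (\<integral>x. f x \<partial>unit_interval)"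
  using integral_distr[of \<psi> unit_interval unit_interval f] assms
  by (simp add: measure_preserving_maps_def)

lemma AE_measure_preserving:
  assumes "\<psi> \<in> measure_preserving_maps" and "AE x in unit_interval. P x"
  shows "AE x in unit_interval. P (\<psi> x)"
proof -
  have m: "\<psi> \<in> measurable unit_interval unit_interval"
    and d: "distr unit_interval unit_interval \<psi> = unit_interval"
    using assms(1) by (auto simp: measure_preserving_maps_def)
  have "AE x in distr unit_interval unit_interval \<psi>. P x" by (simp only: d assms(2))
  from AE_distrD[OF m this] show ?thesis .
qed

lemma measure_preserving_in_unit_interval:
  "\<psi> \<in> measure_preserving_maps \<Longrightarrow> x \<in> {0..1} \<Longrightarrow> \<psi> x \<in> {0..1}"
  using measurable_space[of \<psi> unit_interval unit_interval x] by (simp add: measure_preserving_maps_def)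

lemma measurable_pair_compose:
  assumes \<psi>: "\<psi> \<in> measurable unit_interval unit_interval" and \<theta>: "\<theta> \<in> measurable unit_interval unit_interval"
    and h: "h \<in> borel_measurable unit_pair"
  shows "(\<lambda>z. h (\<psi> (fst z), \<theta> (snd z))) \<in> borel_measurable unit_pair"
  by (rule measurable_compose[OF _ h])
     (intro measurable_Pair measurable_compose[OF measurable_fst \<psi>] measurable_compose[OF measurable_snd \<theta>])

text \<open>The product of \<open>\<psi>\<close> with itself pushes \<open>unit_pair\<close> forward
  to \<open>unit_pair\<close>, so null sets have null preimages.\<close>

lemma AE_unit_pair_compose:
  assumes \<psi>: "\<psi> \<in> measure_preserving_maps" and ae: "AE z in unit_pair. P z"
  shows "AE z in unit_pair. P (\<psi> (fst z), \<psi> (snd z))"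
proof -
  have m: "\<psi> \<in> measurable unit_interval unit_interval" and d: "distr unit_interval unit_interval \<psi> = unit_interval"
    using \<psi> by (auto simp: measure_preserving_maps_def)
  have "distr unit_pair unit_pair (\<lambda>(x, y). (\<psi> x, \<psi> y)) = unit_pair"
    using pair_measure_distr[OF m m] d unit_interval.sigma_finite_measure_axioms by simp
  then have "AE z in distr unit_pair unit_pair (\<lambda>(x, y). (\<psi> x, \<psi> y)). P z" by (simp only: ae)
  moreover have "(\<lambda>(x, y). (\<psi> x, \<psi> y)) \<in> measurable unit_pair unit_pair"
    using m by (simp add: split_beta' measurable_Pair)
  ultimately have "AE z in unit_pair. P (case z of (x, y) \<Rightarrow> (\<psi> x, \<psi> y))" by (rule AE_distrD[rotated])
  then show ?thesis by (simp add: split_beta')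
qed

text \<open>For a measure preserving \<open>\<psi>\<close>, possibly not invertible, an eigenfunction of the pulled back
  kernel for a nonzero eigenvalue is a function of \<open>\<psi> x\<close>, by the eigenvalue equation itself.\<close>

lemma eigenvalues_above_compose:
  assumes k: "bounded_kernel k B" and \<psi>: "\<psi> \<in> measure_preserving_maps"
    and l: "eigenvalues_above 0 (integral_op k) l"
  shows "eigenvalues_above 0 (integral_op (\<lambda>x y. k (\<psi> x) (\<psi> y))) l"
proof (rule eigenvalues_above_transfer[OF \<psi>, of "\<lambda>_. 1", OF _ _ _ l])
  interpret k: bounded_kernel k B by (rule k)
  have m: "\<psi> \<in> measurable unit_interval unit_interval"
    using \<psi> by (auto simp: measure_preserving_maps_def)
  have \<psi>01: "\<psi> x \<in> {0..1}" if "x \<in> {0..1}" for x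
    by (rule measure_preserving_in_unit_interval[OF \<psi> that])
  have op: "integral_op (\<lambda>u y. k u (\<psi> y)) (\<lambda>y. f (\<psi> y)) u = integral_op k f u"
    if "u \<in> {0..1}" "f \<in> square_integrable" for f u
    unfolding integral_op_def
    using that by (intro integral_measure_preserving[OF \<psi>] borel_measurable_times k.measurable_section square_integrableD)
  fix \<mu> :: real assume \<mu>: "\<mu> > 0"
  show "(\<lambda>x. 1 * f (\<psi> x)) \<in> eigenfunctions (integral_op (\<lambda>x y. k (\<psi> x) (\<psi> y))) \<mu>"
    if f: "f \<in> eigenfunctions (integral_op k) \<mu>" for f
  proof -
    have sq: "f \<in> square_integrable" and ae: "AE x in unit_interval. integral_op k f x = \<mu> * f x"
      using f by (auto simp: eigenfunctions_def)
    have "AE x in unit_interval. integral_op k f (\<psi> x) = \<mu> * f (\<psi> x)"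
      by (rule AE_measure_preserving[OF \<psi> ae])
    then have "AE x in unit_interval. integral_op (\<lambda>x y. k (\<psi> x) (\<psi> y)) (\<lambda>x. f (\<psi> x)) x = \<mu> * f (\<psi> x)"
      using AE_space
    proof eventually_elim
      case (elim x)
      then show ?case using op[OF \<psi>01 sq, of x] by (simp add: integral_op_def)
    qed
    then show ?thesis using square_integrable_compose[OF \<psi> sq] by (simp add: eigenfunctions_def)
  qed
  show "\<exists>f\<in>eigenfunctions (integral_op k) \<mu>. AE x in unit_interval. h x = 1 * f (\<psi> x)"
    if h: "h \<in> eigenfunctions (integral_op (\<lambda>x y. k (\<psi> x) (\<psi> y))) \<mu>" for h
  proof
    have sq: "h \<in> square_integrable"
      and ae: "AE x in unit_interval. integral_op (\<lambda>x y. k (\<psi> x) (\<psi> y)) h x = \<mu> * h x"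
      using h by (auto simp: eigenfunctions_def)
    interpret k2: bounded_kernel "\<lambda>u y. k u (\<psi> y)" B
    proof
      show "(\<lambda>z. k (fst z) (\<psi> (snd z))) \<in> borel_measurable unit_pair"
        using measurable_pair_compose[OF measurable_ident m k.measurable_pair] by simp
      show "\<bar>k x (\<psi> y)\<bar> \<le> B" if "x \<in> {0..1}" "y \<in> {0..1}" for x y
        by (rule k.bound[OF that(1) \<psi>01[OF that(2)]])
    qed
    \<comment> \<open>The integral in the eigenvalue equation with \<psi> x replaced by a free
      variable u, divided by \<mu>.\<close>
    define g where "g u = 1 / \<mu> * integral_op (\<lambda>u y. k u (\<psi> y)) h u" for u
    have g: "g \<in> square_integrable"
      unfolding g_def by (intro square_integrable_scale k2.integral_op_square_integrable sq)
    have hg: "AE x in unit_interval. g (\<psi> x) = h x"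
      using ae by eventually_elim (use \<mu> in \<open>simp add: g_def integral_op_def\<close>)
    then show "AE x in unit_interval. h x = 1 * g (\<psi> x)" by eventually_elim simp
    \<comment> \<open>\<open>g\<close> satisfies its equation at every u, also outside the range of
      \<open>\<psi>\<close>: a change of variables turns the integral of k(u, y) g(y) into one over
      k(u, \<psi> y) g(\<psi> y), where g(\<psi> y) is h(y).\<close>
    have "integral_op k g u = \<mu> * g u" if u: "u \<in> {0..1}" for u
    proof -
      have "integral_op k g u = integral_op (\<lambda>u y. k u (\<psi> y)) (\<lambda>y. g (\<psi> y)) u"
        using op[OF u g] by simp
      also have "\<dots> = integral_op (\<lambda>u y. k u (\<psi> y)) h u"
        by (intro integral_op_cong_AE k2.measurable_section u hg square_integrableD(1)[OF sq]
              square_integrableD(1)[OF square_integrable_compose[OF \<psi> g]])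
      finally show ?thesis using \<mu> by (simp add: g_def)
    qed
    then have "AE u in unit_interval. integral_op k g u = \<mu> * g u" by (intro AE_I2) simp
    then show "g \<in> eigenfunctions (integral_op k) \<mu>" using g by (simp add: eigenfunctions_def)
  qed
qed simp

lemma regular_graphon_compose:
  assumes U: "regular_graphon U" and \<psi>: "\<psi> \<in> measure_preserving_maps"
  shows "regular_graphon (\<lambda>x y. U (\<psi> x) (\<psi> y))"
  using measurable_pair_compose[of \<psi> \<psi>, OF _ _ regular_graphonD(1)[OF U]] regular_graphonD(2-)[OF U] \<psi>
  by (simp add: regular_graphon_def measure_preserving_maps_def)

text \<open>The degree of a pullback is the pullback of the degree, since \<open>\<psi>\<close>
  preserves measure; hence pulling back commutes with symmetrization.\<close>

lemma symmetric_kernel_compose: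
  assumes U: "regular_graphon U" and \<psi>: "\<psi> \<in> measure_preserving_maps"
    and x: "x \<in> {0..1}" and y: "y \<in> {0..1}"
  shows "symmetric_kernel \<epsilon> (\<lambda>x y. U (\<psi> x) (\<psi> y)) x y = symmetric_kernel \<epsilon> U (\<psi> x) (\<psi> y)"
proof -
  interpret bounded_kernel U 1 by (rule bounded_kernel_regular_graphon[OF U])
  have "degree_fun (\<lambda>x y. U (\<psi> x) (\<psi> y)) x = degree_fun U (\<psi> x)" if "x \<in> {0..1}" for x
    unfolding degree_fun_def
    by (intro integral_measure_preserving[OF \<psi>] measurable_section measure_preserving_in_unit_interval[OF \<psi> that])
  with x y show ?thesis by (simp add: symmetric_kernel_def inv_sqrt_degree_def)
qed

section \<open>The cut norm and quadratic forms\<close>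

lemma unit_valuedD:
  assumes "f \<in> unit_valued"
  shows "f \<in> borel_measurable unit_interval" "x \<in> {0..1} \<Longrightarrow> 0 \<le> f x" "x \<in> {0..1} \<Longrightarrow> f x \<le> 1"
    "f \<in> square_integrable"
proof -
  show m: "f \<in> borel_measurable unit_interval" and b: "x \<in> {0..1} \<Longrightarrow> 0 \<le> f x" "x \<in> {0..1} \<Longrightarrow> f x \<le> 1" for x
    using assms by (auto simp: unit_valued_def)
  then show "f \<in> square_integrable" by (intro square_integrable_bounded[of _ 1]) auto
qed

text \<open>The number \<open>c\<close> is any upper bound for the cut norm. The test integral is
  written as a pairing with the integral operator, ready for use with
  \<open>op_l2 D\<close>.\<close>

locale cut_close =
  fixes D :: "real \<Rightarrow> real \<Rightarrow> real" and c :: real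
  assumes kernel: "bounded_kernel D 1"
    and sym: "x \<in> {0..1} \<Longrightarrow> y \<in> {0..1} \<Longrightarrow> D x y = D y x"
    and cut: "f \<in> unit_valued \<Longrightarrow> g \<in> unit_valued \<Longrightarrow> \<bar>\<integral>x. integral_op D f x * g x \<partial>unit_interval\<bar> \<le> c"
begin

sublocale bounded_kernel D 1 by (rule kernel)

lemma cut_inner: "f \<in> unit_valued \<Longrightarrow> g \<in> unit_valued \<Longrightarrow> \<bar>inner (op_l2 D (abs_l2 f)) (abs_l2 g)\<bar> \<le> c"
  using cut by (simp add: inner_op_l2 unit_valuedD)

text \<open>Each function is the difference of its positive and negative part, both with values in
  [0, 1]; bilinearity leaves four terms, whence the factor 4.\<close>

lemma cut_inner_signed:
  assumes f: "f \<in> borel_measurable unit_interval" "\<And>x. x \<in> {0..1} \<Longrightarrow> \<bar>f x\<bar> \<le> 1"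
    and g: "g \<in> borel_measurable unit_interval" "\<And>x. x \<in> {0..1} \<Longrightarrow> \<bar>g x\<bar> \<le> 1"
  shows "\<bar>inner (op_l2 D (abs_l2 f)) (abs_l2 g)\<bar> \<le> 4 * c"
proof -
  have split: "(\<lambda>x. max 0 (f x)) \<in> unit_valued \<and> (\<lambda>x. max 0 (- f x)) \<in> unit_valued \<and>
      abs_l2 f = abs_l2 (\<lambda>x. max 0 (f x)) - abs_l2 (\<lambda>x. max 0 (- f x))"
    if f: "f \<in> borel_measurable unit_interval" "\<And>x. x \<in> {0..1} \<Longrightarrow> \<bar>f x\<bar> \<le> 1" for f
  proof -
    have u: "(\<lambda>x. max 0 (f x)) \<in> unit_valued" "(\<lambda>x. max 0 (- f x)) \<in> unit_valued"
      using f by (auto simp: unit_valued_def abs_le_iff)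
    have "f = (\<lambda>x. max 0 (f x) - max 0 (- f x))" by auto
    then show ?thesis using u by (simp add: minus_abs_l2 unit_valuedD)
  qed
  define fp fm gp gm where "fp x = max 0 (f x)" and "fm x = max 0 (- f x)"
    and "gp x = max 0 (g x)" and "gm x = max 0 (- g x)" for x
  have u: "fp \<in> unit_valued" "fm \<in> unit_valued" "gp \<in> unit_valued" "gm \<in> unit_valued"
    and eq: "abs_l2 f = abs_l2 fp - abs_l2 fm" "abs_l2 g = abs_l2 gp - abs_l2 gm"
    using split[OF f] split[OF g] by (simp_all add: fp_def[abs_def] fm_def[abs_def] gp_def[abs_def] gm_def[abs_def])
  have "inner (op_l2 D (abs_l2 f)) (abs_l2 g) =
      (inner (op_l2 D (abs_l2 fp)) (abs_l2 gp) - inner (op_l2 D (abs_l2 fp)) (abs_l2 gm)) -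
      (inner (op_l2 D (abs_l2 fm)) (abs_l2 gp) - inner (op_l2 D (abs_l2 fm)) (abs_l2 gm))"
    unfolding eq by (simp only: linear_diff[OF linear_op_l2] inner_diff_left inner_diff_right)
  then show ?thesis
    using cut_inner[OF u(1) u(3)] cut_inner[OF u(1) u(4)] cut_inner[OF u(2) u(3)] cut_inner[OF u(2) u(4)]
    by linarith
qed

lemma cut_nonneg: "0 \<le> c"
proof -
  have "(\<lambda>x. 0) \<in> unit_valued" by (simp add: unit_valued_def)
  from cut[OF this this] show ?thesis by simp
qed

text \<open>This is the integral of D(z, y) D(x, y) over y, the kernel of the square of the operator
  because \<open>D\<close> is symmetric.\<close>

definition square_kernel :: "real \<Rightarrow> real \<Rightarrow> real" where
  "square_kernel x z = integral_op D (D x) z"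

lemma bounded_kernel_square_kernel: "bounded_kernel square_kernel 1"
proof
  have "(\<lambda>w. (snd (fst w), snd w)) \<in> measurable (unit_pair \<Otimes>\<^sub>M unit_interval) unit_pair"
    "(\<lambda>w. (fst (fst w), snd w)) \<in> measurable (unit_pair \<Otimes>\<^sub>M unit_interval) unit_pair"
    by measurable
  from this[THEN measurable_compose, OF measurable_pair]
  have "(\<lambda>w. D (snd (fst w)) (snd w) * D (fst (fst w)) (snd w)) \<in> borel_measurable (unit_pair \<Otimes>\<^sub>M unit_interval)"
    by simp
  then show "(\<lambda>z. square_kernel (fst z) (snd z)) \<in> borel_measurable unit_pair"
    unfolding square_kernel_def integral_op_def
    by (intro unit_interval.borel_measurable_lebesgue_integral) (simp add: split_beta')
  fix x z :: real assume x: "x \<in> {0..1}" and z: "z \<in> {0..1}"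
  have "(integral_op D (D x) z)\<^sup>2 \<le> 1\<^sup>2 * (\<integral>y. (D x y)\<^sup>2 \<partial>unit_interval)"
    by (rule integral_op_le_bound[OF z section_square_integrable[OF x]])
  moreover have "(\<integral>y. (D x y)\<^sup>2 \<partial>unit_interval) \<le> 1"
    using bound[OF x]
    by (intro integral_unit_interval_le_const square_integrableD section_square_integrable[OF x])
       (simp add: abs_square_le_1)
  ultimately have "(square_kernel x z)\<^sup>2 \<le> 1" by (simp add: square_kernel_def)
  then show "\<bar>square_kernel x z\<bar> \<le> 1" by (simp add: abs_square_le_1)
qed

text \<open>The value of D(D f) at x is the pairing of D f with the section \<open>D x\<close>.
  Self-adjointness moves the operator onto the section, so no exchange of integrals has to be
  written out.\<close>

lemma op_l2_square: "op_l2 D (op_l2 D u) = op_l2 square_kernel u"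
proof -
  interpret sq: bounded_kernel square_kernel 1 by (rule bounded_kernel_square_kernel)
  define f where "f = rep_l2 u"
  have f: "f \<in> square_integrable" "u = abs_l2 f" by (simp_all add: f_def rep_l2_square_integrable)
  have "integral_op D (integral_op D f) x = integral_op square_kernel f x" if x: "x \<in> {0..1}" for x
  proof -
    have Dx: "D x \<in> square_integrable" by (rule section_square_integrable[OF x])
    have "integral_op D (integral_op D f) x = (\<integral>y. integral_op D f y * D x y \<partial>unit_interval)"
      by (subst integral_op_def) (simp add: mult.commute)
    also have "\<dots> = inner (op_l2 D (abs_l2 f)) (abs_l2 (D x))" by (simp add: inner_op_l2 f Dx)
    also have "\<dots> = inner (op_l2 D (abs_l2 (D x))) (abs_l2 f)"
      by (subst selfadjoint_op_l2[OF sym]) (simp_all add: inner_commute)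
    also have "\<dots> = integral_op square_kernel f x"
      by (simp add: inner_op_l2 f Dx integral_op_def[of square_kernel] square_kernel_def)
    finally show ?thesis .
  qed
  then have "AE x in unit_interval. integral_op D (integral_op D f) x = integral_op square_kernel f x"
    by (intro AE_I2) simp
  then show ?thesis
    by (simp add: f op_abs_l2 sq.op_abs_l2 integral_op_square_integrable sq.integral_op_square_integrable abs_l2_eq_iff)
qed

text \<open>The integrand \<open>D(x,y) D(z,y) D\<^sub>2(x,z)\<close> is, for fixed \<open>x\<close>, the kernel \<open>D(z,y)\<close> tested against
  a function of \<open>y\<close> and a function of \<open>z\<close>.\<close>

lemma square_kernel_L2: "(\<integral>z. (square_kernel (fst z) (snd z))\<^sup>2 \<partial>unit_pair) \<le> 4 * c"
proof -
  interpret sq: bounded_kernel square_kernel 1 by (rule bounded_kernel_square_kernel)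
  have int: "integrable unit_pair (\<lambda>z. (square_kernel (fst z) (snd z))\<^sup>2)"
  proof (rule integrable_unit_pair_bounded)
    show "\<bar>(square_kernel (fst (x, y)) (snd (x, y)))\<^sup>2\<bar> \<le> 1" if "x \<in> {0..1}" "y \<in> {0..1}" for x y
      using sq.bound[OF that] by (simp add: abs_square_le_1)
  qed (use sq.measurable_pair in auto)
  have "(\<integral>z. (square_kernel (fst z) (snd z))\<^sup>2 \<partial>unit_pair) =
      (\<integral>x. (\<integral>z. (square_kernel x z)\<^sup>2 \<partial>unit_interval) \<partial>unit_interval)"
    using unit_pair.integral_fst'[OF int] by simp
  also have "\<dots> \<le> 4 * c"
  proof (rule integral_unit_interval_le_const)
    show "integrable unit_interval (\<lambda>x. \<integral>z. (square_kernel x z)\<^sup>2 \<partial>unit_interval)"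
      using unit_pair.integrable_fst'[OF int] by simp
    fix x :: real assume x: "x \<in> {0..1}"
    have "(\<integral>z. (square_kernel x z)\<^sup>2 \<partial>unit_interval) = (\<integral>z. integral_op D (D x) z * square_kernel x z \<partial>unit_interval)"
      by (simp add: square_kernel_def power2_eq_square)
    also have "\<dots> = inner (op_l2 D (abs_l2 (D x))) (abs_l2 (square_kernel x))"
      by (rule inner_op_l2[OF section_square_integrable[OF x] sq.section_square_integrable[OF x], symmetric])
    also have "\<dots> \<le> 4 * c"
      using cut_inner_signed[OF measurable_section[OF x] bound[OF x] sq.measurable_section[OF x] sq.bound[OF x]]
      by linarith
    finally show "(\<integral>z. (square_kernel x z)\<^sup>2 \<partial>unit_interval) \<le> 4 * c" .
  qed
  finally show ?thesis .
qed

text \<open>The squared norm of D u equals the pairing of u with D^2 u, so \<open>D\<close> inherits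
  the square root of a bound for its square. As \<open>4 * c\<close> bounds the squared
  Hilbert-Schmidt norm of that square, a fourth root results.\<close>

lemma norm_op_l2_cut: "norm (op_l2 D u) \<le> sqrt (sqrt (4 * c)) * norm u"
proof (rule power2_le_imp_le)
  interpret sq: bounded_kernel square_kernel 1 by (rule bounded_kernel_square_kernel)
  have "(norm (op_l2 square_kernel u))\<^sup>2 \<le> (4 * c) * (norm u)\<^sup>2"
    using sq.norm_op_l2_le[of u] square_kernel_L2 by (meson mult_right_mono order_trans zero_le_power2)
  then have "(norm (op_l2 square_kernel u))\<^sup>2 \<le> (sqrt (4 * c) * norm u)\<^sup>2"
    using cut_nonneg by (simp add: power_mult_distrib)
  then have *: "norm (op_l2 square_kernel u) \<le> sqrt (4 * c) * norm u"
    by (rule power2_le_imp_le) (use cut_nonneg in simp)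
  have "(norm (op_l2 D u))\<^sup>2 = inner u (op_l2 square_kernel u)"
    using selfadjoint_op_l2[OF sym, of u "op_l2 D u"] by (simp add: power2_norm_eq_inner op_l2_square)
  also have "\<dots> \<le> norm u * norm (op_l2 square_kernel u)" by (rule norm_cauchy_schwarz)
  also have "\<dots> \<le> norm u * (sqrt (4 * c) * norm u)" by (intro mult_left_mono * norm_ge_zero)
  also have "\<dots> = (sqrt (sqrt (4 * c)) * norm u)\<^sup>2"
    using cut_nonneg by (simp add: power_mult_distrib power2_eq_square)
  finally show "(norm (op_l2 D u))\<^sup>2 \<le> (sqrt (sqrt (4 * c)) * norm u)\<^sup>2" .
qed (use cut_nonneg in simp)

lemma quadratic_form_cut:
  assumes f: "f \<in> square_integrable"
  shows "\<bar>\<integral>z. D (fst z) (snd z) * f (snd z) * f (fst z) \<partial>unit_pair\<bar> \<le>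
         sqrt (sqrt (4 * c)) * (\<integral>x. (f x)\<^sup>2 \<partial>unit_interval)"
proof -
  let ?u = "abs_l2 f"
  have "\<bar>inner (op_l2 D ?u) ?u\<bar> \<le> norm (op_l2 D ?u) * norm ?u" by (rule Cauchy_Schwarz_ineq2)
  also have "\<dots> \<le> (sqrt (sqrt (4 * c)) * norm ?u) * norm ?u" by (intro mult_right_mono norm_op_l2_cut) simp
  also have "\<dots> = sqrt (sqrt (4 * c)) * (norm ?u)\<^sup>2" by (simp add: power2_eq_square)
  finally show ?thesis
    by (simp only: inner_op_l2[OF f f] integral_op_inner[OF f f] norm_abs_l2[OF f])
qed

text \<open>The row sums are tested on the set where they are nonnegative and on its complement,
  with at most \<open>c\<close> from each. For a difference of two graphons they are the differences
  of the degrees.\<close>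

lemma integral_abs_row_sums: "(\<integral>x. \<bar>integral_op D (\<lambda>_. 1) x\<bar> \<partial>unit_interval) \<le> 2 * c"
proof -
  define h where "h = integral_op D (\<lambda>_. 1)"
  have h: "h \<in> square_integrable" unfolding h_def by (rule integral_op_square_integrable[OF square_integrable_const])
  note [measurable] = square_integrableD(1)[OF h]
  define p q :: "real \<Rightarrow> real" where "p x = (if h x \<ge> 0 then 1 else 0)" and "q x = (if h x \<ge> 0 then 0 else 1)" for x
  have pq: "p \<in> unit_valued" "q \<in> unit_valued" "(\<lambda>_. 1) \<in> unit_valued"
    by (auto simp: unit_valued_def p_def[abs_def] q_def[abs_def])
  have "(\<integral>x. \<bar>h x\<bar> \<partial>unit_interval) = (\<integral>x. h x * p x - h x * q x \<partial>unit_interval)"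
    by (intro Bochner_Integration.integral_cong) (auto simp: p_def q_def)
  also have "\<dots> = (\<integral>x. h x * p x \<partial>unit_interval) - (\<integral>x. h x * q x \<partial>unit_interval)"
    by (intro Bochner_Integration.integral_diff integrable_mult_square_integrable h unit_valuedD pq)
  also have "\<dots> \<le> 2 * c"
    using cut[OF pq(3) pq(1)] cut[OF pq(3) pq(2)] unfolding h_def by linarith
  finally show ?thesis by (simp add: h_def)
qed

end

section \<open>Perturbation of the symmetrized kernel\<close>

lemma integral_op_diff_one:
  assumes U: "regular_graphon U" and V: "regular_graphon V" and x: "x \<in> {0..1}"
  shows "integral_op (\<lambda>x y. U x y - V x y) (\<lambda>_. 1) x = degree_fun U x - degree_fun V x"
proof -
  interpret U: bounded_kernel U 1 by (rule bounded_kernel_regular_graphon[OF U])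
  interpret V: bounded_kernel V 1 by (rule bounded_kernel_regular_graphon[OF V])
  show ?thesis
    using U.integrable_section[OF x square_integrable_const[of 1]] V.integrable_section[OF x square_integrable_const[of 1]]
    by (simp add: integral_op_def degree_fun_def)
qed

text \<open>The difference equals (t - s) / ((sqrt t + sqrt s) sqrt s sqrt t), and each of the three
  factors of the denominator is at least sqrt \<epsilon>.\<close>

lemma inv_sqrt_lipschitz:
  fixes s t \<epsilon> :: real
  assumes "\<epsilon> > 0" "s \<ge> \<epsilon>" "t \<ge> \<epsilon>"
  shows "\<bar>1 / sqrt s - 1 / sqrt t\<bar> \<le> \<bar>s - t\<bar> / (\<epsilon> * sqrt \<epsilon>)"
proof -
  have pos: "sqrt s > 0" "sqrt t > 0" "sqrt \<epsilon> > 0" using assms by auto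
  have le: "sqrt \<epsilon> \<le> sqrt s" "sqrt \<epsilon> \<le> sqrt t" using assms by auto
  have "1 / sqrt s - 1 / sqrt t = (sqrt t - sqrt s) / (sqrt s * sqrt t)"
    using pos by (simp add: field_simps)
  also have "sqrt t - sqrt s = (t - s) / (sqrt t + sqrt s)"
  proof -
    have "(sqrt t - sqrt s) * (sqrt t + sqrt s) = t - s"
      using assms by (simp add: algebra_simps)
    moreover have "sqrt t + sqrt s \<noteq> 0" using pos by linarith
    ultimately show ?thesis using nonzero_eq_divide_eq by blast
  qed
  finally have eq: "1 / sqrt s - 1 / sqrt t = (t - s) / ((sqrt t + sqrt s) * (sqrt s * sqrt t))" by simp
  have "\<epsilon> * sqrt \<epsilon> = sqrt \<epsilon> * (sqrt \<epsilon> * sqrt \<epsilon>)" using assms by simp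
  also have "\<dots> \<le> (sqrt t + sqrt s) * (sqrt s * sqrt t)"
  proof (intro mult_mono le)
    show "sqrt \<epsilon> \<le> sqrt t + sqrt s" using pos le by linarith
  qed (use pos in \<open>auto intro: mult_nonneg_nonneg\<close>)
  finally have "\<epsilon> * sqrt \<epsilon> \<le> (sqrt t + sqrt s) * (sqrt s * sqrt t)" .
  then have "\<bar>t - s\<bar> / ((sqrt t + sqrt s) * (sqrt s * sqrt t)) \<le> \<bar>t - s\<bar> / (\<epsilon> * sqrt \<epsilon>)"
    using assms pos by (intro divide_left_mono mult_pos_pos add_pos_pos) auto
  moreover have "\<bar>1 / sqrt s - 1 / sqrt t\<bar> = \<bar>t - s\<bar> / ((sqrt t + sqrt s) * (sqrt s * sqrt t))"
    unfolding eq using pos by (simp add: abs_mult)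
  ultimately show ?thesis by (simp add: abs_minus_commute)
qed

text \<open>With weights a and b for U and V, the difference of the kernels is a(x) (U - V)(x, y)
  a(y) plus V(x, y) (a(x) a(y) - b(x) b(y)). The first summand gives the form of U - V at a f, where
  a^2 \<le> 1 / \<epsilon>; the second has small Hilbert-Schmidt norm because the weights are close
  in L^1. The constant is the sum of the two bounds in this order.\<close>

lemma symmetric_kernel_quadratic_form:
  assumes U: "regular_graphon U" and V: "regular_graphon V" and \<epsilon>: "\<epsilon> > 0"
    and close: "cut_close (\<lambda>x y. U x y - V x y) c"
    and f: "f \<in> square_integrable"
  shows "\<bar>\<integral>z. (symmetric_kernel \<epsilon> U (fst z) (snd z) - symmetric_kernel \<epsilon> V (fst z) (snd z)) * f (snd z) * f (fst z) \<partial>unit_pair\<bar>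
    \<le> (sqrt (sqrt (4 * c)) / \<epsilon> + sqrt (4 * c / \<epsilon> ^ 3)) * (\<integral>x. (f x)\<^sup>2 \<partial>unit_interval)"
proof -
  interpret D: cut_close "\<lambda>x y. U x y - V x y" c by (rule close)
  define a b where "a = inv_sqrt_degree \<epsilon> U" and "b = inv_sqrt_degree \<epsilon> V"
  have a: "0 < a x" "a x \<le> 1 / sqrt \<epsilon>" and b: "0 < b x" "b x \<le> 1 / sqrt \<epsilon>" for x
    unfolding a_def b_def by (rule inv_sqrt_degree_bounds[OF \<epsilon>])+
  have am: "a \<in> borel_measurable unit_interval" and bm: "b \<in> borel_measurable unit_interval"
    unfolding a_def b_def by (rule measurable_inv_sqrt_degree[OF U] measurable_inv_sqrt_degree[OF V])+
  have af: "(\<lambda>x. a x * f x) \<in> square_integrable"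
    using a by (intro square_integrable_mult_bounded[OF am _ f, of "1 / sqrt \<epsilon>"]) (auto simp: less_imp_le)
  define R where "R x y = V x y * (a x * a y - b x * b y)" for x y
  have aa: "\<bar>a x * a y - b x * b y\<bar> \<le> (\<bar>a x - b x\<bar> + \<bar>a y - b y\<bar>) / sqrt \<epsilon>" for x y
  proof -
    have "\<bar>a x * a y - b x * b y\<bar> = \<bar>(a x - b x) * a y + b x * (a y - b y)\<bar>"
      by (simp add: algebra_simps)
    also have "\<dots> \<le> \<bar>a x - b x\<bar> * a y + b x * \<bar>a y - b y\<bar>"
      using abs_triangle_ineq[of "(a x - b x) * a y" "b x * (a y - b y)"] a(1)[of y] b(1)[of x]
      by (simp add: abs_mult)
    also have "\<dots> \<le> \<bar>a x - b x\<bar> * (1 / sqrt \<epsilon>) + (1 / sqrt \<epsilon>) * \<bar>a y - b y\<bar>"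
      using a b \<epsilon> by (intro add_mono mult_mono) (auto simp: less_imp_le)
    finally show ?thesis by (simp add: add_divide_distrib)
  qed
  have aa1: "\<bar>a x * a y - b x * b y\<bar> \<le> 1 / \<epsilon>" for x y
  proof -
    have "0 \<le> a x * a y" "a x * a y \<le> (1 / sqrt \<epsilon>) * (1 / sqrt \<epsilon>)"
      "0 \<le> b x * b y" "b x * b y \<le> (1 / sqrt \<epsilon>) * (1 / sqrt \<epsilon>)"
      by (intro mult_nonneg_nonneg mult_mono a b less_imp_le[OF a(1)] less_imp_le[OF b(1)]; use \<epsilon> in simp)+
    then show ?thesis using \<epsilon> by auto
  qed
  have RR: "\<bar>R x y\<bar> \<le> \<bar>a x * a y - b x * b y\<bar>" for x y
    using regular_graphonD(2,3)[OF V] by (simp add: R_def abs_mult mult_left_le_one_le)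
  interpret R: bounded_kernel R "1 / \<epsilon>"
  proof
    show "(\<lambda>z. R (fst z) (snd z)) \<in> borel_measurable unit_pair"
      unfolding R_def
      by (intro borel_measurable_times borel_measurable_diff regular_graphonD(1)[OF V]
          measurable_compose[OF measurable_fst am] measurable_compose[OF measurable_snd am]
          measurable_compose[OF measurable_fst bm] measurable_compose[OF measurable_snd bm])
    show "\<bar>R x y\<bar> \<le> 1 / \<epsilon>" for x y using RR[of x y] aa1[of x y] by linarith
  qed
  define h where "h x = \<bar>a x - b x\<bar>" for x
  have hm: "h \<in> borel_measurable unit_interval" unfolding h_def using am bm by simp
  have h_le: "h x \<le> 1 / sqrt \<epsilon>" for x using a[of x] b[of x] by (simp add: h_def abs_le_iff)
  have h0: "0 \<le> h x" for x by (simp add: h_def)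
  have h_int: "integrable unit_interval h"
    using h_le h0 by (intro integrable_unit_interval_bounded[OF hm, of "1 / sqrt \<epsilon>"]) simp
  have h_small: "(\<integral>x. h x \<partial>unit_interval) \<le> 2 * c / (\<epsilon> * sqrt \<epsilon>)"
  proof -
    let ?r = "integral_op (\<lambda>x y. U x y - V x y) (\<lambda>_. 1)"
    have "(\<integral>x. h x \<partial>unit_interval) \<le> (\<integral>x. \<bar>?r x\<bar> / (\<epsilon> * sqrt \<epsilon>) \<partial>unit_interval)"
    proof (rule integral_unit_interval_mono[OF h_int])
      show "integrable unit_interval (\<lambda>x. \<bar>?r x\<bar> / (\<epsilon> * sqrt \<epsilon>))"
        by (intro integrable_divide integrable_abs integrable_square_integrable D.integral_op_square_integrable square_integrable_const)
      fix x :: real assume x: "x \<in> {0..1}"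
      have "h x \<le> \<bar>max \<epsilon> (degree_fun U x) - max \<epsilon> (degree_fun V x)\<bar> / (\<epsilon> * sqrt \<epsilon>)"
        unfolding h_def a_def b_def inv_sqrt_degree_def by (rule inv_sqrt_lipschitz[OF \<epsilon>]) auto
      \<comment> \<open>Cutting off from below at \<epsilon> does not increase distances.\<close>
      also have "\<dots> \<le> \<bar>degree_fun U x - degree_fun V x\<bar> / (\<epsilon> * sqrt \<epsilon>)"
        using \<epsilon> by (intro divide_right_mono) auto
      finally show "h x \<le> \<bar>?r x\<bar> / (\<epsilon> * sqrt \<epsilon>)" by (simp add: integral_op_diff_one[OF U V x])
    qed
    also have "\<dots> = (\<integral>x. \<bar>?r x\<bar> \<partial>unit_interval) / (\<epsilon> * sqrt \<epsilon>)" by simp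
    also have "\<dots> \<le> 2 * c / (\<epsilon> * sqrt \<epsilon>)"
      using \<epsilon> by (intro divide_right_mono D.integral_abs_row_sums) auto
    finally show ?thesis .
  qed
  have R_small: "(\<integral>z. (R (fst z) (snd z))\<^sup>2 \<partial>unit_pair) \<le> 4 * c / \<epsilon> ^ 3"
  proof -
    \<comment> \<open>R^2 is at most the uniform bound 1 / \<epsilon> times |R| \<le> (h(x) + h(y))
      / sqrt \<epsilon>, which gives \<open>C\<close>. The L^1 bound for \<open>h\<close>
      contributes the same factor once more, hence \<epsilon>^3 in the end.\<close>
    define C where "C = 1 / (\<epsilon> * sqrt \<epsilon>)"
    have C: "C \<ge> 0" using \<epsilon> by (simp add: C_def)
    have meas: "(\<lambda>z. C * (h (fst z) + h (snd z))) \<in> borel_measurable unit_pair"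
      by (intro borel_measurable_times borel_measurable_const borel_measurable_add
          measurable_compose[OF measurable_fst hm] measurable_compose[OF measurable_snd hm])
    have int: "integrable unit_pair (\<lambda>z. C * (h (fst z) + h (snd z)))"
    proof (rule integrable_unit_pair_bounded[OF meas])
      show "\<bar>C * (h (fst (x, y)) + h (snd (x, y)))\<bar> \<le> C * (1 / sqrt \<epsilon> + 1 / sqrt \<epsilon>)" for x y
      proof -
        have "C * (h x + h y) \<le> C * (1 / sqrt \<epsilon> + 1 / sqrt \<epsilon>)"
          by (intro mult_left_mono add_mono h_le C)
        moreover have "0 \<le> C * (h x + h y)" using C h0[of x] h0[of y] by simp
        ultimately show ?thesis by simp
      qed
    qed
    have "(\<integral>z. (R (fst z) (snd z))\<^sup>2 \<partial>unit_pair) \<le> (\<integral>z. C * (h (fst z) + h (snd z)) \<partial>unit_pair)"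
    proof (rule integral_mono[OF _ int])
      show "integrable unit_pair (\<lambda>z. (R (fst z) (snd z))\<^sup>2)"
      proof (rule integrable_unit_pair_bounded)
        show "\<bar>(R (fst (x, y)) (snd (x, y)))\<^sup>2\<bar> \<le> (1 / \<epsilon>)\<^sup>2" if "x \<in> {0..1}" "y \<in> {0..1}" for x y
          using power_mono[OF R.bound[OF that], of 2] by simp
      qed (use R.measurable_pair in auto)
      fix z :: "real \<times> real"
      define x y where "x = fst z" and "y = snd z"
      have "(R x y)\<^sup>2 = \<bar>R x y\<bar> * \<bar>R x y\<bar>" by (simp add: power2_eq_square)
      also have "\<dots> \<le> (1 / \<epsilon>) * ((h x + h y) / sqrt \<epsilon>)"
        using RR[of x y] aa[of x y] aa1[of x y] \<epsilon> unfolding h_def by (intro mult_mono) linarith+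
      also have "\<dots> = C * (h x + h y)" by (simp add: C_def)
      finally show "(R (fst z) (snd z))\<^sup>2 \<le> C * (h (fst z) + h (snd z))" by (simp add: x_def y_def)
    qed
    also have "\<dots> = (\<integral>x. (\<integral>y. C * (h x + h y) \<partial>unit_interval) \<partial>unit_interval)"
      using unit_pair.integral_fst'[OF int, symmetric] by (simp only: fst_conv snd_conv)
    also have "\<dots> = C * (2 * (\<integral>x. h x \<partial>unit_interval))"
      using h_int by simp
    also have "\<dots> \<le> C * (2 * (2 * c / (\<epsilon> * sqrt \<epsilon>)))"
      using C h_small by (intro mult_left_mono) auto
    also have "\<dots> = 4 * c / \<epsilon> ^ 3"
      using \<epsilon> by (simp add: C_def power3_eq_cube mult_ac)
    finally show ?thesis .
  qed
  let ?n = "\<integral>x. (f x)\<^sup>2 \<partial>unit_interval"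
  have n0: "0 \<le> ?n" by simp
  have 1: "\<bar>\<integral>z. (U (fst z) (snd z) - V (fst z) (snd z)) * (a (snd z) * f (snd z)) * (a (fst z) * f (fst z)) \<partial>unit_pair\<bar>
      \<le> sqrt (sqrt (4 * c)) / \<epsilon> * ?n"
  proof -
    have "(\<integral>x. (a x * f x)\<^sup>2 \<partial>unit_interval) \<le> (\<integral>x. (f x)\<^sup>2 / \<epsilon> \<partial>unit_interval)"
    proof (intro integral_unit_interval_mono integrable_divide square_integrableD(2) af f)
      fix x
      have "(a x)\<^sup>2 \<le> (1 / sqrt \<epsilon>)\<^sup>2" using a[of x] by (intro power_mono) auto
      then show "(a x * f x)\<^sup>2 \<le> (f x)\<^sup>2 / \<epsilon>"
        using \<epsilon> mult_right_mono[of "(a x)\<^sup>2" "1 / \<epsilon>" "(f x)\<^sup>2"] by (simp add: power_mult_distrib power_divide)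
    qed
    also have "\<dots> = ?n / \<epsilon>" by simp
    finally have "sqrt (sqrt (4 * c)) * (\<integral>x. (a x * f x)\<^sup>2 \<partial>unit_interval) \<le> sqrt (sqrt (4 * c)) * (?n / \<epsilon>)"
      using D.cut_nonneg by (intro mult_left_mono) auto
    then show ?thesis using D.quadratic_form_cut[OF af] by simp
  qed
  have 2: "\<bar>\<integral>z. R (fst z) (snd z) * f (snd z) * f (fst z) \<partial>unit_pair\<bar> \<le> sqrt (4 * c / \<epsilon> ^ 3) * ?n"
  proof -
    let ?u = "abs_l2 f"
    have "(norm (op_l2 R ?u))\<^sup>2 \<le> (4 * c / \<epsilon> ^ 3) * (norm ?u)\<^sup>2"
      using R.norm_op_l2_le[of ?u] R_small by (meson mult_right_mono order_trans zero_le_power2)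
    then have "(norm (op_l2 R ?u))\<^sup>2 \<le> (sqrt (4 * c / \<epsilon> ^ 3) * norm ?u)\<^sup>2"
      using D.cut_nonneg \<epsilon> by (simp add: power_mult_distrib)
    then have R': "norm (op_l2 R ?u) \<le> sqrt (4 * c / \<epsilon> ^ 3) * norm ?u"
      by (rule power2_le_imp_le) (use D.cut_nonneg \<epsilon> in simp)
    have "\<bar>inner (op_l2 R ?u) ?u\<bar> \<le> norm (op_l2 R ?u) * norm ?u" by (rule Cauchy_Schwarz_ineq2)
    also have "\<dots> \<le> (sqrt (4 * c / \<epsilon> ^ 3) * norm ?u) * norm ?u" by (intro mult_right_mono R') simp
    also have "\<dots> = sqrt (4 * c / \<epsilon> ^ 3) * (norm ?u)\<^sup>2" by (simp add: power2_eq_square)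
    finally show ?thesis
      by (simp only: R.inner_op_l2[OF f f] R.integral_op_inner[OF f f] norm_abs_l2[OF f])
  qed
  have "(\<integral>z. (symmetric_kernel \<epsilon> U (fst z) (snd z) - symmetric_kernel \<epsilon> V (fst z) (snd z)) * f (snd z) * f (fst z) \<partial>unit_pair)
    = (\<integral>z. (U (fst z) (snd z) - V (fst z) (snd z)) * (a (snd z) * f (snd z)) * (a (fst z) * f (fst z)) +
        R (fst z) (snd z) * f (snd z) * f (fst z) \<partial>unit_pair)"
    by (intro Bochner_Integration.integral_cong refl)
       (simp add: symmetric_kernel_def R_def a_def[symmetric] b_def[symmetric] algebra_simps)
  also have "\<dots> = (\<integral>z. (U (fst z) (snd z) - V (fst z) (snd z)) * (a (snd z) * f (snd z)) * (a (fst z) * f (fst z)) \<partial>unit_pair)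
      + (\<integral>z. R (fst z) (snd z) * f (snd z) * f (fst z) \<partial>unit_pair)"
    by (intro Bochner_Integration.integral_add D.integrable_kernel_times[OF af af] R.integrable_kernel_times[OF f f])
  finally show ?thesis using 1 2 by (simp add: distrib_right)
qed

section \<open>Convergence of spectra\<close>

lemma abs_integral_unit_square_le:
  fixes h :: "real \<times> real \<Rightarrow> real"
  assumes h: "\<And>z. z \<in> {0..1} \<times> {0..1} \<Longrightarrow> \<bar>h z\<bar> \<le> 1"
  shows "\<bar>\<integral>z. h z \<partial>unit_square\<bar> \<le> 1"
\<comment> \<open>An integral that does not exist has the default value 0, so the bound holds in
  that case too.\<close>
proof (cases "integrable unit_square h")
  case True
  have "emeasure unit_square ({0..1} \<times> {0..1}) = emeasure lebesgue ({0..1 :: real} \<times> {0..1 :: real})"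
    using unit_square_in_sets by (intro emeasure_restrict_space) auto
  also have "\<dots> = 1" by (subst emeasure_lebesgue_Times) auto
  finally have "emeasure unit_square (space unit_square) = 1" by (simp add: space_restrict_space)
  then have m: "finite_measure unit_square" "measure unit_square (space unit_square) = 1"
    by (auto intro: finite_measureI simp: measure_def)
  interpret finite_measure unit_square by (rule m)
  have "\<bar>\<integral>z. h z \<partial>unit_square\<bar> \<le> (\<integral>z. \<bar>h z\<bar> \<partial>unit_square)" by (rule integral_abs_bound)
  also have "\<dots> \<le> (\<integral>z. 1 \<partial>unit_square)"
    using True h unit_square_in_sets by (intro integral_mono) (auto simp: space_restrict_space)
  also have "\<dots> = 1" using m(2) by simp
  finally show ?thesis .
qed (simp add: not_integrable_integral_eq)

text \<open>A real supremum dominates its members only if the family is bounded above; the pointwise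
  bound on \<open>V\<close> and the test functions provides the upper bound 1.\<close>

lemma abs_integral_le_cut_norm:
  assumes V: "\<And>x y. x \<in> {0..1} \<Longrightarrow> y \<in> {0..1} \<Longrightarrow> \<bar>V x y\<bar> \<le> 1"
    and f: "f \<in> unit_valued" and g: "g \<in> unit_valued"
  shows "\<bar>\<integral>z. V (fst z) (snd z) * f (fst z) * g (snd z) \<partial>unit_square\<bar> \<le> cut_norm V"
proof -
  define I where "I = (\<lambda>(f, g). \<bar>\<integral>z. V (fst z) (snd z) * f (fst z) * g (snd z) \<partial>unit_square\<bar>)"
  have "bdd_above (I ` (unit_valued \<times> unit_valued))"
  proof (rule bdd_aboveI2)
    fix p assume p: "p \<in> unit_valued \<times> unit_valued"
    obtain f g where fg: "p = (f, g)" by (cases p)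
    have "\<bar>V (fst z) (snd z) * f (fst z) * g (snd z)\<bar> \<le> 1" if "z \<in> {0..1} \<times> {0..1}" for z
    proof -
      have z: "fst z \<in> {0..1}" "snd z \<in> {0..1}" using that by auto
      have "\<bar>f (fst z)\<bar> \<le> 1" "\<bar>g (snd z)\<bar> \<le> 1" using p fg z by (auto simp: unit_valued_def)
      with V[OF z] have "\<bar>V (fst z) (snd z)\<bar> * \<bar>f (fst z)\<bar> * \<bar>g (snd z)\<bar> \<le> 1 * 1 * 1"
        by (intro mult_mono) auto
      then show ?thesis by (simp add: abs_mult)
    qed
    then show "I p \<le> 1" by (simp add: I_def fg abs_integral_unit_square_le)
  qed
  then have "I (f, g) \<le> (SUP p\<in>unit_valued \<times> unit_valued. I p)"
    using f g by (intro cSUP_upper) auto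
  then show ?thesis by (simp add: I_def cut_norm_def)
qed

text \<open>Representatives alter the integrand only on a null set, also after composition with
  \<open>\<psi>\<close>, since null sets pull back to null sets. The cut norm of the original
  graphons therefore bounds every test of the regular ones.\<close>

lemma cut_close_regular_graphons:
  assumes W\<^sub>0: "graphon W\<^sub>0" and W: "graphon W" and \<psi>: "\<psi> \<in> measure_preserving_maps"
    and U\<^sub>0: "regular_graphon U\<^sub>0" "AE z in unit_pair. W\<^sub>0 (fst z) (snd z) = U\<^sub>0 (fst z) (snd z)"
    and U: "regular_graphon U" "AE z in unit_pair. W (fst z) (snd z) = U (fst z) (snd z)"
    and c: "cut_norm (\<lambda>x y. W\<^sub>0 x y - W (\<psi> x) (\<psi> y)) \<le> c"
  shows "cut_close (\<lambda>x y. U\<^sub>0 x y - U (\<psi> x) (\<psi> y)) c"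
proof (rule cut_close.intro)
  have U\<psi>: "regular_graphon (\<lambda>x y. U (\<psi> x) (\<psi> y))" by (rule regular_graphon_compose[OF U(1) \<psi>])
  show D: "bounded_kernel (\<lambda>x y. U\<^sub>0 x y - U (\<psi> x) (\<psi> y)) 1"
  proof
    show "(\<lambda>z. U\<^sub>0 (fst z) (snd z) - U (\<psi> (fst z)) (\<psi> (snd z))) \<in> borel_measurable unit_pair"
      by (intro borel_measurable_diff regular_graphonD(1) U U\<^sub>0 U\<psi>)
    show "\<bar>U\<^sub>0 x y - U (\<psi> x) (\<psi> y)\<bar> \<le> 1" for x y
      using regular_graphonD(2,3)[OF U\<^sub>0(1), of x y] regular_graphonD(2,3)[OF U(1), of "\<psi> x" "\<psi> y"] by linarith
  qed
  then interpret D: bounded_kernel "\<lambda>x y. U\<^sub>0 x y - U (\<psi> x) (\<psi> y)" 1 .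
  show "U\<^sub>0 x y - U (\<psi> x) (\<psi> y) = U\<^sub>0 y x - U (\<psi> y) (\<psi> x)" for x y
    using regular_graphonD(4)[OF U\<^sub>0(1), of x y] regular_graphonD(4)[OF U(1), of "\<psi> x" "\<psi> y"] by simp
  fix f g assume f: "f \<in> unit_valued" and g: "g \<in> unit_valued"
  \<comment> \<open>The operator integrates over the second variable, so \<open>f\<close> is tested
    there and \<open>g\<close> in the first one.\<close>
  let ?h = "\<lambda>z. (U\<^sub>0 (fst z) (snd z) - U (\<psi> (fst z)) (\<psi> (snd z))) * g (fst z) * f (snd z)"
  let ?V = "\<lambda>x y. W\<^sub>0 x y - W (\<psi> x) (\<psi> y)"
  have hm: "?h \<in> borel_measurable unit_pair"
    by (intro borel_measurable_times D.measurable_pair measurable_compose[OF measurable_fst unit_valuedD(1)[OF g]]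
        measurable_compose[OF measurable_snd unit_valuedD(1)[OF f]])
  then have hm': "?h \<in> borel_measurable unit_square"
    by (rule measurable_compose[OF measurable_id_unit_square])
  have "AE z in unit_pair. W (\<psi> (fst z)) (\<psi> (snd z)) = U (\<psi> (fst z)) (\<psi> (snd z))"
    using AE_unit_pair_compose[OF \<psi> U(2)] by simp
  then have "AE z in unit_pair. ?h z = ?V (fst z) (snd z) * g (fst z) * f (snd z)"
    using U\<^sub>0(2) by eventually_elim simp
  then have ae: "AE z in unit_square. ?h z = ?V (fst z) (snd z) * g (fst z) * f (snd z)"
    by (rule AE_unit_square_if_unit_pair)
  have "(\<integral>x. integral_op (\<lambda>x y. U\<^sub>0 x y - U (\<psi> x) (\<psi> y)) f x * g x \<partial>unit_interval) = (\<integral>z. ?h z \<partial>unit_pair)"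
    using D.integral_op_inner[OF unit_valuedD(4)[OF f] unit_valuedD(4)[OF g]] by (simp add: mult_ac)
  also have "\<dots> = (\<integral>z. ?h z \<partial>unit_square)" by (rule integral_unit_square[OF hm, symmetric])
  also have "\<dots> = (\<integral>z. ?V (fst z) (snd z) * g (fst z) * f (snd z) \<partial>unit_square)"
    by (rule integral_cong_AE[OF hm' borel_measurable_lebesgue_on_cong_AE[OF unit_square_in_sets hm' ae] ae])
  also have "\<bar>\<dots>\<bar> \<le> cut_norm ?V"
  proof (rule abs_integral_le_cut_norm[OF _ g f])
    fix x y :: real assume x: "x \<in> {0..1}" and y: "y \<in> {0..1}"
    have "W\<^sub>0 x y \<in> {0..1}" using W\<^sub>0 x y unfolding graphon_def by blast
    moreover have "W (\<psi> x) (\<psi> y) \<in> {0..1}"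
      using W measure_preserving_in_unit_interval[OF \<psi> x] measure_preserving_in_unit_interval[OF \<psi> y]
      unfolding graphon_def by blast
    ultimately show "\<bar>?V x y\<bar> \<le> 1" by auto
  qed
  finally show "\<bar>\<integral>x. integral_op (\<lambda>x y. U\<^sub>0 x y - U (\<psi> x) (\<psi> y)) f x * g x \<partial>unit_interval\<bar> \<le> c"
    using c by linarith
qed

text \<open>Pulled back along \<open>\<psi>\<close>, the deficit is at most the difference of
  degrees integrated over the set where the degree of \<open>U\<close> at \<psi> x is below
  \<epsilon>, and this is one cut norm test against the constant 1. Since \<open>\<psi>\<close>
  preserves integrals, the bound no longer mentions it and can be used with another
  \<open>\<psi>\<close> for each \<open>c\<close>.\<close>

lemma degree_deficit_le:
  assumes U\<^sub>0: "regular_graphon U\<^sub>0" and U: "regular_graphon U" and \<psi>: "\<psi> \<in> measure_preserving_maps"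
    and close: "cut_close (\<lambda>x y. U\<^sub>0 x y - U (\<psi> x) (\<psi> y)) c"
    and d: "AE x in unit_interval. degree_fun U\<^sub>0 x \<ge> \<epsilon>"
  shows "(\<integral>x. max 0 (\<epsilon> - degree_fun U x) \<partial>unit_interval) \<le> c"
proof -
  interpret D: cut_close "\<lambda>x y. U\<^sub>0 x y - U (\<psi> x) (\<psi> y)" c by (rule close)
  interpret U: bounded_kernel U 1 by (rule bounded_kernel_regular_graphon[OF U])
  have U\<psi>: "regular_graphon (\<lambda>x y. U (\<psi> x) (\<psi> y))" by (rule regular_graphon_compose[OF U \<psi>])
  define r where "r x = max 0 (\<epsilon> - degree_fun U x)" for x
  have rm: "r \<in> borel_measurable unit_interval"
    unfolding r_def[abs_def] using degree_fun_regular_graphon(1)[OF U] by simp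
  have r_sq: "r \<in> square_integrable"
  proof (rule square_integrable_bounded[OF rm])
    show "\<bar>r x\<bar> \<le> \<bar>\<epsilon>\<bar>" if "x \<in> {0..1}" for x
      using degree_fun_regular_graphon(2)[OF U that] by (simp add: r_def max_def)
  qed
  define h where "h = integral_op (\<lambda>x y. U\<^sub>0 x y - U (\<psi> x) (\<psi> y)) (\<lambda>_. 1)"
  have h: "h x = degree_fun U\<^sub>0 x - degree_fun U (\<psi> x)" if x: "x \<in> {0..1}" for x
  proof -
    have "degree_fun (\<lambda>x y. U (\<psi> x) (\<psi> y)) x = degree_fun U (\<psi> x)"
      unfolding degree_fun_def
      by (intro integral_measure_preserving[OF \<psi>] U.measurable_section measure_preserving_in_unit_interval[OF \<psi> x])
    then show ?thesis unfolding h_def using integral_op_diff_one[OF U\<^sub>0 U\<psi> x] by simp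
  qed
  have h_sq: "h \<in> square_integrable"
    unfolding h_def by (rule D.integral_op_square_integrable[OF square_integrable_const])
  define p where "p x = (if degree_fun U (\<psi> x) < \<epsilon> then 1 else 0 :: real)" for x
  have "(\<lambda>x. degree_fun U (\<psi> x)) \<in> borel_measurable unit_interval"
    using \<psi> by (intro measurable_compose[OF _ degree_fun_regular_graphon(1)[OF U]]) (simp add: measure_preserving_maps_def)
  then have "p \<in> borel_measurable unit_interval" unfolding p_def[abs_def] by simp
  then have p: "p \<in> unit_valued" by (auto simp: unit_valued_def p_def)
  have "(\<integral>x. r x \<partial>unit_interval) = (\<integral>x. r (\<psi> x) \<partial>unit_interval)"
    by (rule integral_measure_preserving[OF \<psi> rm, symmetric])
  also have "\<dots> \<le> (\<integral>x. h x * p x \<partial>unit_interval)"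
  proof (rule integral_mono_AE)
    show "integrable unit_interval (\<lambda>x. r (\<psi> x))"
      by (intro integrable_square_integrable square_integrable_compose[OF \<psi> r_sq])
    show "integrable unit_interval (\<lambda>x. h x * p x)"
      by (intro integrable_mult_square_integrable h_sq unit_valuedD(4)[OF p])
    show "AE x in unit_interval. r (\<psi> x) \<le> h x * p x"
      using d AE_space
    proof eventually_elim
      case (elim x)
      then have "h x = degree_fun U\<^sub>0 x - degree_fun U (\<psi> x)" by (intro h) simp
      with elim(1) show ?case by (simp add: r_def p_def)
    qed
  qed
  also have "\<dots> \<le> c"
    using D.cut[OF _ p, of "\<lambda>_. 1"] unfolding h_def by (simp add: unit_valued_def)
  finally show ?thesis by (simp add: r_def)
qed

lemma ex_measure_preserving_cut_norm_less:
  assumes "cut_dist W\<^sub>0 W < c"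
  shows "\<exists>\<psi>\<in>measure_preserving_maps. cut_norm (\<lambda>x y. W\<^sub>0 x y - W (\<psi> x) (\<psi> y)) < c"
proof -
  have "(\<lambda>\<psi>. cut_norm (\<lambda>x y. W\<^sub>0 x y - W (\<psi> x) (\<psi> y))) ` measure_preserving_maps \<noteq> {}"
    using id_measure_preserving by blast
  from cInf_lessD[OF this assms[unfolded cut_dist_def]] show ?thesis by blast
qed

lemma bounded_kernel_compose:
  assumes "bounded_kernel k B" and \<psi>: "\<psi> \<in> measure_preserving_maps"
  shows "bounded_kernel (\<lambda>x y. k (\<psi> x) (\<psi> y)) B"
proof -
  interpret bounded_kernel k B by fact
  show ?thesis
  proof
    have m: "\<psi> \<in> measurable unit_interval unit_interval"
      using \<psi> by (simp add: measure_preserving_maps_def)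
    show "(\<lambda>z. k (\<psi> (fst z)) (\<psi> (snd z))) \<in> borel_measurable unit_pair"
      using measurable_pair_compose[OF m m measurable_pair] by simp
    show "\<bar>k (\<psi> x) (\<psi> y)\<bar> \<le> B" if "x \<in> {0..1}" "y \<in> {0..1}" for x y
      using that by (intro bound measure_preserving_in_unit_interval[OF \<psi>])
  qed
qed

section \<open>Spectra of the random walk operators\<close>

lemma eigenvalues_above_rw_kernel_op_cong:
  assumes U: "regular_graphon U" and ae: "AE z in unit_pair. W (fst z) (snd z) = U (fst z) (snd z)"
  shows "eigenvalues_above 0 (\<lambda>f x. s * rw_kernel_op W f x) l \<longleftrightarrow>
         eigenvalues_above 0 (\<lambda>f x. s * rw_kernel_op U f x) l"
proof -
  have eq: "eigenfunctions (\<lambda>f x. s * rw_kernel_op W f x) \<mu> = eigenfunctions (\<lambda>f x. s * rw_kernel_op U f x) \<mu>" for \<mu>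
  proof -
    have "(AE x in unit_interval. s * rw_kernel_op W f x = \<mu> * f x) \<longleftrightarrow>
        (AE x in unit_interval. s * rw_kernel_op U f x = \<mu> * f x)" if "f \<in> square_integrable" for f
    proof -
      have "AE x in unit_interval. rw_kernel_op W f x = rw_kernel_op U f x"
        by (rule rw_kernel_op_cong(2)[OF U ae square_integrableD(1)[OF that]])
      then have "AE x in unit_interval. (s * rw_kernel_op W f x = \<mu> * f x) = (s * rw_kernel_op U f x = \<mu> * f x)"
        by eventually_elim simp
      then show ?thesis by (rule eventually_subst)
    qed
    then show ?thesis unfolding eigenfunctions_def by blast
  qed
  show ?thesis by (simp add: eigenvalues_above_def has_multiplicity_cong[OF eq])
qed

lemma signed_eigenvalues_converge:
  fixes Wn :: "nat \<Rightarrow> real \<Rightarrow> real \<Rightarrow> real" and W :: "real \<Rightarrow> real \<Rightarrow> real"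
  assumes Wn: "\<And>n. graphon (Wn n)" and W: "graphon W"
    and conv: "(\<lambda>n. cut_dist (Wn n) W) \<longlonglongrightarrow> 0"
    and \<epsilon>: "\<epsilon> > 0" and deg: "\<And>n. AE x in unit_interval. degree_fun (Wn n) x > \<epsilon>"
    and s: "\<bar>s\<bar> = 1"
  shows "\<exists>ls l. (\<forall>n. eigenvalues_above 0 (\<lambda>f x. s * rw_kernel_op (Wn n) f x) (ls n)) \<and>
    eigenvalues_above 0 (\<lambda>f x. s * rw_kernel_op W f x) l \<and> (\<forall>i. (\<lambda>n. ls n i) \<longlonglongrightarrow> l i)"
proof -
  obtain U where U: "regular_graphon U" "AE z in unit_pair. W (fst z) (snd z) = U (fst z) (snd z)"
    using ex_regular_graphon[OF W] by blast
  have "\<forall>n. \<exists>U. regular_graphon U \<and> (AE z in unit_pair. Wn n (fst z) (snd z) = U (fst z) (snd z))"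
    using ex_regular_graphon[OF Wn] by blast
  then obtain Us where Us: "\<And>n. regular_graphon (Us n)"
      "\<And>n. AE z in unit_pair. Wn n (fst z) (snd z) = Us n (fst z) (snd z)"
    by metis
  have degUs: "AE x in unit_interval. degree_fun (Us n) x \<ge> \<epsilon>" for n
    using deg[of n] rw_kernel_op_cong(1)[OF Us(1)[of n] Us(2)[of n]] by eventually_elim simp
  \<comment> \<open>The infimum in the cut metric need not be attained; the extra 1 / (n + 1) leaves
    room for a map \<open>\<psi> n\<close> and vanishes in the limit.\<close>
  define c where "c n = cut_dist (Wn n) W + 1 / real (Suc n)" for n
  have c0: "c \<longlonglongrightarrow> 0"
    unfolding c_def using tendsto_add[OF conv LIMSEQ_Suc[OF lim_1_over_n]] by simp
  have "\<exists>\<psi>\<in>measure_preserving_maps. cut_norm (\<lambda>x y. Wn n x y - W (\<psi> x) (\<psi> y)) < c n" for n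
    by (rule ex_measure_preserving_cut_norm_less) (simp add: c_def)
  then obtain \<psi> where \<psi>: "\<And>n. \<psi> n \<in> measure_preserving_maps"
      "\<And>n. cut_norm (\<lambda>x y. Wn n x y - W (\<psi> n x) (\<psi> n y)) < c n"
    by metis
  have close: "cut_close (\<lambda>x y. Us n x y - U (\<psi> n x) (\<psi> n y)) (c n)" for n
    by (rule cut_close_regular_graphons[OF Wn W \<psi>(1) Us U less_imp_le[OF \<psi>(2)]])
  have degU: "AE x in unit_interval. degree_fun U x \<ge> \<epsilon>"
  proof -
    have int: "integrable unit_interval (\<lambda>x. max 0 (\<epsilon> - degree_fun U x))"
    proof (rule integrable_unit_interval_bounded)
      show "(\<lambda>x. max 0 (\<epsilon> - degree_fun U x)) \<in> borel_measurable unit_interval"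
        using degree_fun_regular_graphon(1)[OF U(1)] by simp
      show "\<bar>max 0 (\<epsilon> - degree_fun U x)\<bar> \<le> \<epsilon>" if "x \<in> {0..1}" for x
        using degree_fun_regular_graphon(2)[OF U(1) that] \<epsilon> by auto
    qed
    have "(\<integral>x. max 0 (\<epsilon> - degree_fun U x) \<partial>unit_interval) \<le> 0"
      by (rule LIMSEQ_le_const[OF c0]) (use degree_deficit_le[OF Us(1) U(1) \<psi>(1) close degUs] in blast)
    moreover have "0 \<le> (\<integral>x. max 0 (\<epsilon> - degree_fun U x) \<partial>unit_interval)"
      by (intro integral_nonneg_AE) auto
    ultimately have "(\<integral>x. max 0 (\<epsilon> - degree_fun U x) \<partial>unit_interval) = 0" by linarith
    then have "AE x in unit_interval. max 0 (\<epsilon> - degree_fun U x) = 0"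
      by (subst (asm) integral_nonneg_eq_0_iff_AE[OF int]) auto
    then show ?thesis by eventually_elim (auto simp: max_def split: if_splits)
  qed
  define k where "k V x y = s * symmetric_kernel \<epsilon> V x y" for V x y
  have kb: "bounded_kernel (k V) (1 / \<epsilon>)" if "regular_graphon V" for V
    using bounded_kernel_symmetric_kernel[OF that \<epsilon>, of s] s by (simp add: k_def[abs_def])
  have ksym: "k V x y = k V y x" if "regular_graphon V" for V x y
    using symmetric_kernel_sym[OF that] by (simp add: k_def)
  obtain l where l: "eigenvalues_above 0 (integral_op (k U)) l"
    using ex_eigenvalues_above_integral_op[OF kb[OF U(1)] ksym[OF U(1)]] by blast
  have "\<forall>n. \<exists>l. eigenvalues_above 0 (integral_op (k (Us n))) l"
    using ex_eigenvalues_above_integral_op[OF kb[OF Us(1)] ksym[OF Us(1)]] by blast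
  then obtain ls where ls: "\<And>n. eigenvalues_above 0 (integral_op (k (Us n))) (ls n)" by metis
  define \<delta> where "\<delta> n = sqrt (sqrt (4 * c n)) / \<epsilon> + sqrt (4 * c n / \<epsilon> ^ 3)" for n
  have "\<delta> \<longlonglongrightarrow> sqrt (sqrt (4 * 0)) / \<epsilon> + sqrt (4 * 0 / \<epsilon> ^ 3)"
    unfolding \<delta>_def using \<epsilon> by (intro tendsto_intros c0) auto
  then have \<delta>0: "\<delta> \<longlonglongrightarrow> 0" by simp
  \<comment> \<open>\<open>ls n\<close> is compared with the enumeration for the pullback of
    \<open>U\<close> along \<open>\<psi> n\<close>, which is again \<open>l\<close>; the maps may
    thus vary freely with n.\<close>
  have dist: "\<bar>ls n i - l i\<bar> \<le> \<delta> n" for n i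
  proof (rule eigenvalues_above_perturbation[OF kb[OF Us(1)] ksym[OF Us(1)]])
    let ?k = "\<lambda>x y. k U (\<psi> n x) (\<psi> n y)" and ?U = "\<lambda>x y. U (\<psi> n x) (\<psi> n y)"
    have U\<psi>: "regular_graphon ?U" by (rule regular_graphon_compose[OF U(1) \<psi>(1)])
    show "bounded_kernel ?k (1 / \<epsilon>)" by (rule bounded_kernel_compose[OF kb[OF U(1)] \<psi>(1)])
    show "?k x y = ?k y x" for x y by (rule ksym[OF U(1)])
    show "eigenvalues_above 0 (integral_op (k (Us n))) (ls n)" by (rule ls)
    show "eigenvalues_above 0 (integral_op ?k) l"
      by (rule eigenvalues_above_compose[OF kb[OF U(1)] \<psi>(1) l])
    show "0 \<le> \<delta> n" unfolding \<delta>_def using cut_close.cut_nonneg[OF close, of n] \<epsilon> by simp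
    fix f assume f: "f \<in> square_integrable"
    have "(\<integral>z. (k (Us n) (fst z) (snd z) - ?k (fst z) (snd z)) * f (snd z) * f (fst z) \<partial>unit_pair) =
        (\<integral>z. s * ((symmetric_kernel \<epsilon> (Us n) (fst z) (snd z) - symmetric_kernel \<epsilon> ?U (fst z) (snd z)) * f (snd z) * f (fst z)) \<partial>unit_pair)"
      by (intro Bochner_Integration.integral_cong refl)
         (auto simp: space_pair_measure k_def symmetric_kernel_compose[OF U(1) \<psi>(1)] algebra_simps)
    then show "\<bar>\<integral>z. (k (Us n) (fst z) (snd z) - ?k (fst z) (snd z)) * f (snd z) * f (fst z) \<partial>unit_pair\<bar>
        \<le> \<delta> n * (\<integral>x. (f x)\<^sup>2 \<partial>unit_interval)"
      using symmetric_kernel_quadratic_form[OF Us(1) U\<psi> \<epsilon> close f] s by (simp add: abs_mult \<delta>_def)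
  qed
  have "(\<lambda>n. ls n i) \<longlonglongrightarrow> l i" for i
  proof (rule LIM_zero_cancel)
    show "(\<lambda>n. ls n i - l i) \<longlonglongrightarrow> 0"
      by (rule Lim_null_comparison[OF _ \<delta>0]) (use dist in auto)
  qed
  moreover have "eigenvalues_above 0 (\<lambda>f x. s * rw_kernel_op W f x) l"
    unfolding eigenvalues_above_rw_kernel_op_cong[OF U]
    using l unfolding k_def by (rule eigenvalues_above_rw_kernel_op[OF U(1) \<epsilon> degU])
  moreover have "eigenvalues_above 0 (\<lambda>f x. s * rw_kernel_op (Wn n) f x) (ls n)" for n
    unfolding eigenvalues_above_rw_kernel_op_cong[OF Us]
    using ls[of n] unfolding k_def by (rule eigenvalues_above_rw_kernel_op[OF Us(1) \<epsilon> degUs])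
  ultimately show ?thesis by blast
qed

text \<open>A positive eigenvalue \<mu> of the negated kernel operator corresponds to -\<mu> for the
  operator and to 1 + \<mu> for the Laplacian, while a positive \<mu> of the operator itself
  corresponds to 1 - \<mu>. So the Laplacian spectrum above 1 comes from the negative part and the
  one below 1 from the positive part. The spellings \<open>0 - \<mu>\<close>,
  \<open>\<mu> + 1\<close> and \<open>1 * ...\<close> match the reflection, the shift and the signed
  operators.\<close>

lemma eigenfunctions_rw_ops:
  "eigenfunctions (rw_kernel_op W) (0 - \<mu>) = eigenfunctions (\<lambda>f x. - 1 * rw_kernel_op W f x) \<mu>"
  "eigenfunctions (rw_laplacian_op W) (1 - \<mu>) = eigenfunctions (\<lambda>f x. 1 * rw_kernel_op W f x) \<mu>"
  "eigenfunctions (rw_laplacian_op W) (\<mu> + 1) = eigenfunctions (\<lambda>f x. - 1 * rw_kernel_op W f x) \<mu>"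
proof -
  have eqs: "(a = (0 - \<mu>) * b) = (- 1 * a = \<mu> * b)"
    "(b - a = (1 - \<mu>) * b) = (1 * a = \<mu> * b)" "(b - a = (\<mu> + 1) * b) = (- 1 * a = \<mu> * b)" for a b :: real
    by (auto simp: algebra_simps)
  show "eigenfunctions (rw_kernel_op W) (0 - \<mu>) = eigenfunctions (\<lambda>f x. - 1 * rw_kernel_op W f x) \<mu>"
      "eigenfunctions (rw_laplacian_op W) (1 - \<mu>) = eigenfunctions (\<lambda>f x. 1 * rw_kernel_op W f x) \<mu>"
    "eigenfunctions (rw_laplacian_op W) (\<mu> + 1) = eigenfunctions (\<lambda>f x. - 1 * rw_kernel_op W f x) \<mu>"
    unfolding eigenfunctions_def rw_laplacian_op_def eqs by (rule refl)+
qed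

theorem mainTheorem2:
  fixes Wn :: "nat \<Rightarrow> real \<Rightarrow> real \<Rightarrow> real" and W :: "real \<Rightarrow> real \<Rightarrow> real"
  assumes "\<And>n. graphon (Wn n)"
    and "graphon W"
    and "(\<lambda>n. cut_dist (Wn n) W) \<longlonglongrightarrow> 0"
    and "\<exists>\<epsilon>>0. \<forall>n. AE x in unit_interval. degree_fun (Wn n) x > \<epsilon>"
  shows "spectra_converge_pointwise 0 (\<lambda>n. rw_kernel_op (Wn n)) (rw_kernel_op W)
       \<and> spectra_converge_pointwise 1 (\<lambda>n. rw_laplacian_op (Wn n)) (rw_laplacian_op W)"
proof -
  obtain \<epsilon> where \<epsilon>: "\<epsilon> > 0" "\<And>n. AE x in unit_interval. degree_fun (Wn n) x > \<epsilon>"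
    using assms(4) by blast
  obtain ps p where p: "\<And>n. eigenvalues_above 0 (\<lambda>f x. 1 * rw_kernel_op (Wn n) f x) (ps n)"
      "eigenvalues_above 0 (\<lambda>f x. 1 * rw_kernel_op W f x) p" "\<And>i. (\<lambda>n. ps n i) \<longlonglongrightarrow> p i"
    using signed_eigenvalues_converge[OF assms(1-3) \<epsilon>, of 1] by auto
  obtain qs q where q: "\<And>n. eigenvalues_above 0 (\<lambda>f x. - 1 * rw_kernel_op (Wn n) f x) (qs n)"
      "eigenvalues_above 0 (\<lambda>f x. - 1 * rw_kernel_op W f x) q" "\<And>i. (\<lambda>n. qs n i) \<longlonglongrightarrow> q i"
    using signed_eigenvalues_converge[OF assms(1-3) \<epsilon>, of "- 1"] by auto
  have "\<exists>ls l. (\<forall>n. eigenvalues_above 0 (rw_kernel_op (Wn n)) (ls n)) \<and>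
      eigenvalues_above 0 (rw_kernel_op W) l \<and> (\<forall>i. (\<lambda>n. ls n i) \<longlonglongrightarrow> l i)"
    using p by (intro exI[of _ ps] exI[of _ p]) simp
  moreover have "\<exists>ls l. (\<forall>n. eigenvalues_below 0 (rw_kernel_op (Wn n)) (ls n)) \<and>
      eigenvalues_below 0 (rw_kernel_op W) l \<and> (\<forall>i. (\<lambda>n. ls n i) \<longlonglongrightarrow> l i)"
    using eigenvalues_below_reflect[OF q(1) eigenfunctions_rw_ops(1)]
      eigenvalues_below_reflect[OF q(2) eigenfunctions_rw_ops(1)] tendsto_diff[OF tendsto_const[of 0] q(3)]
    by (intro exI[of _ "\<lambda>n i. 0 - qs n i"] exI[of _ "\<lambda>i. 0 - q i"]) simp
  moreover have "\<exists>ls l. (\<forall>n. eigenvalues_above 1 (rw_laplacian_op (Wn n)) (ls n)) \<and>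
      eigenvalues_above 1 (rw_laplacian_op W) l \<and> (\<forall>i. (\<lambda>n. ls n i) \<longlonglongrightarrow> l i)"
    using eigenvalues_above_shift[OF q(1) eigenfunctions_rw_ops(3)]
      eigenvalues_above_shift[OF q(2) eigenfunctions_rw_ops(3)] tendsto_add[OF q(3) tendsto_const[of 1]]
    by (intro exI[of _ "\<lambda>n i. qs n i + 1"] exI[of _ "\<lambda>i. q i + 1"]) simp
  moreover have "\<exists>ls l. (\<forall>n. eigenvalues_below 1 (rw_laplacian_op (Wn n)) (ls n)) \<and>
      eigenvalues_below 1 (rw_laplacian_op W) l \<and> (\<forall>i. (\<lambda>n. ls n i) \<longlonglongrightarrow> l i)"
    using eigenvalues_below_reflect[OF p(1) eigenfunctions_rw_ops(2)]
      eigenvalues_below_reflect[OF p(2) eigenfunctions_rw_ops(2)] tendsto_diff[OF tendsto_const[of 1] p(3)]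
    by (intro exI[of _ "\<lambda>n i. 1 - ps n i"] exI[of _ "\<lambda>i. 1 - p i"]) simp
  ultimately show ?thesis unfolding spectra_converge_pointwise_def by blast
qed

end
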